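(* Assume that the meshes $\mathcal{T}_j$ satisfy the face-simplex condition, the volume condition, the sub-triangulation condition, the covering condition and the agglomeration condition (all defined in the context). Let $\mathsf{C}_{\mathsf{2lvl}}$, $\mathsf{C}_{\mathsf{stab}}$, $\mu$ and $\widetilde{\mathsf{C}}_{j,j-1}=\mathsf{C}_{\mathsf{eig}}^{j}(\mathsf{C}_{L^2}^{j}+\mathsf{C}_{L^2}^{j-1})$, $j=2,\dots,J$, be as in the context, with the convention $\widetilde{\mathsf{C}}_{1,0}=0$. Then there exists a constant $\widehat{\mathsf{C}}>\mathsf{C}_{\mathsf{2lvl}}$, independent of the mesh size, the polynomial approximation degree and the level $j$, $j=1,\dots,J$, such that, if the numbers $m_1,m_2$ of pre- and post-smoothing steps satisfy, for $j=2,\dots,J$, $$(m_1+1)^{1/2}(m_2+1)^{1/2}\ge\begin{cases}p_j^{2+\mu}\,\widetilde{\mathsf{C}}_{j,j-1}\,\dfrac{\mathsf{C}_{\mathsf{stab}}^2\,\widehat{\mathsf{C}}^2}{\widehat{\mathsf{C}}-\mathsf{C}_{\mathsf{2lvl}}}&\text{if }\widetilde{\mathsf{C}}_{j-1,j-2}\le\widetilde{\mathsf{C}}_{j,j-1},\\[2ex] p_j^{2+\mu}\,\dfrac{(\widetilde{\mathsf{C}}_{j-1,j-2})^2}{\widetilde{\mathsf{C}}_{j,j-1}}\,\dfrac{\mathsf{C}_{\mathsf{stab}}^2\,\widehat{\mathsf{C}}^2}{\widehat{\mathsf{C}}-\mathsf{C}_{\mathsf{2lvl}}}&\text{otherwise,}\end{cases}$$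 then, for $j=1,\dots,J$, $$|||\mathbb{E}_{j,m_1,m_2}v|||_{1,j}\le\widehat{\mathsf{C}}\,\Sigma_j\,|||v|||_{1,j}\qquad\forall v\in V_j,$$ with $$\Sigma_j=\widetilde{\mathsf{C}}_{j,j-1}\,\frac{p_j^{2+\mu}}{(1+m_1)^{1/2}(1+m_2)^{1/2}}.$$
   Context: Model problem. Let $d\in\{2,3\}$, let $\Omega\subset\mathbb{R}^d$ be a convex polygonal/polyhedral domain with Lipschitz boundary, $f\in L^2(\Omega)$, $V=H^2(\Omega)\cap H^1_0(\Omega)$, and let $u\in V$ satisfy $\int_\Omega\nabla u\cdot\nabla v\,dx=\int_\Omega fv\,dx$ for all $v\in V$. We write $x\lesssim y$ if $x\le Cy$ with $C>0$ independent of the discretization parameters, and $x\approx y$ if $x\lesssim y\lesssim x$. Meshes and spaces. $\{\mathcal{T}_j\}_{j=1}^J$ is a sequence of partitions of $\Omega$ into disjoint open polygonal/polyhedral elements $\kappa$ of diameter $h_\kappa$ with $\overline\Omega=\bigcup_{\kappa\in\mathcal{T}_j}\overline\kappa$; $h_j=\max_{\kappa\in\mathcal{T}_j}h_\kappa$. $V_j=\{v\in L^2(\Omega): v|_\kappa\in\mathcal{P}_{p_j}(\kappa),\ \kappa\in\mathcal{T}_j\}$, where $\mathcal{P}_{p_j}(\kappa)$ is the space of polynomials of total degree at most $p_j\ge1$. Either ($h$-multigrid) $p_j=p$ for all $j$ and $\mathcal{T}_{j-1}$ is obtained by agglomerating elements of $\mathcal{T}_j$ with $h_{j-1}\lesssim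 h_j\le h_{j-1}$, $j=2,\dots,J$; or ($p$-multigrid) the mesh is the same for all $j$ and $p_{j-1}\le p_j\lesssim p_{j-1}$, $j=2,\dots,J$. In both cases $V_1\subseteq\dots\subseteq V_J$. The meshes are quasi-uniform: $h_j\approx\min_{\kappa\in\mathcal{T}_j}h_\kappa$. Faces. The interfaces of $\mathcal{T}_j$ are the intersections of the $(d-1)$-dimensional facets of neighbouring elements (and boundary facets); they are assumed subdivided into given $(d-1)$-dimensional simplices, called faces. $\mathcal{F}_j=\mathcal{F}_j^I\cup\mathcal{F}_j^B$ is the set of all faces, with $\mathcal{F}_j^I$ the interior ones ($F\subseteq\partial\kappa^+\cap\partial\kappa^-$, $\kappa^\pm\in\mathcal{T}_j$ adjacent) and $\mathcal{F}_j^B$ the boundary ones ($F\subset\partial\Omega$). Mesh conditions, for all $j=1,\dots,J$: - Face-simplex condition: for each $\kappa\in\mathcal{T}_j$ there is a set of nonoverlapping (not necessarily shape-regular) $d$-simplices $T_\ell\subseteq\kappa$, $\ell=1,\dots,n_\kappa$, such that for any face $F\subset\partial\kappa$, $\overline F=\partial\overline\kappa\cap\partial\overline{T_\ell}$ for some $\ell$, $\bigcup_{\ell=1}^{n_\kappa}\overline T_\ell\subseteq\overline\kappa$, and $h_\kappa\lesssim d|T_\ell|/|F|$, $\ell=1,\dots,n_\kappa$. - Volume condition: $h_\kappa^d\ge|\kappa|\gtrsim h_\kappa^d$ for any $\kappa\in\mathcal{T}_j$. - Sub-triangulation condition: every $\kappa\in\mathcal{T}_j$ admits a sub-triangulation into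 at most $m_\kappa\in\mathbb{N}$ shape-regular simplices $\mathfrak{s}_i$ with $\overline\kappa=\bigcup_{i=1}^{m_\kappa}\overline{\mathfrak{s}}_i$ and $|\mathfrak{s}_i|\gtrsim|\kappa|$ for all $i$, the hidden constant being independent of $\kappa$ and $\mathcal{T}_j$. - Covering condition: there is a covering $\mathcal{T}_j^\sharp=\{\mathcal{K}\}$ of $\Omega$ by shape-regular $d$-simplices such that for any $\kappa\in\mathcal{T}_j$ there is $\mathcal{K}\in\mathcal{T}_j^\sharp$ with $\kappa\subset\mathcal{K}$, and $\max_{\kappa\in\mathcal{T}_j}\mathrm{card}\{\kappa'\in\mathcal{T}_j:\kappa'\cap\mathcal{K}\ne\emptyset,\ \mathcal{K}\in\mathcal{T}_j^\sharp\text{ such that }\kappa\subset\mathcal{K}\}\lesssim1$; consequently $\mathrm{diam}(\mathcal{K})\lesssim h_\kappa$ for each pair $\kappa\subset\mathcal{K}$. - Agglomeration condition: for $F\in\mathcal{F}_j\cap\mathcal{F}_{j-1}$, $j=2,\dots,J$, let $\kappa_j^\pm$ and $\kappa_{j-1}^\pm$ be the neighbouring elements sharing $F$ in $\mathcal{T}_j$ and $\mathcal{T}_{j-1}$; there exists $\Theta>0$ such that $1<h_{\kappa_{j-1}^\pm}/h_{\kappa_j^\pm}\le\Theta$ for all $F\in\mathcal{F}_j\cap\mathcal{F}_{j-1}$. DG form. On $F\in\mathcal{F}_j^I$: $[\![v]\!]=v^+\mathbf{n}^++v^-\mathbf{n}^-$, $\{\!\{\boldsymbol\tau\}\!\}=(\boldsymbol\tau^++\boldsymbol\tau^-)/2$;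 on $F\in\mathcal{F}_j^B$: $[\![v]\!]=v^+\mathbf{n}^+$, $\{\!\{\boldsymbol\tau\}\!\}=\boldsymbol\tau^+$, where $\pm$ denote traces from $\kappa^\pm$ and $\mathbf{n}^\pm$ is the outward unit normal to $\partial\kappa^\pm$. The bilinear form is $$\mathcal{A}_j(u,v)=\sum_{\kappa\in\mathcal{T}_j}\int_\kappa\nabla u\cdot\nabla v\,dx-\sum_{F\in\mathcal{F}_j}\int_F\left(\{\!\{\nabla u\}\!\}\cdot[\![v]\!]+[\![u]\!]\cdot\{\!\{\nabla v\}\!\}\right)ds+\sum_{F\in\mathcal{F}_j}\int_F\sigma_j[\![u]\!]\cdot[\![v]\!]\,ds,$$ with $\sigma_j=C_\sigma^j\max_{\kappa\in\{\kappa^+,\kappa^-\}}\{p_j^2/h_\kappa\}$ on $F\in\mathcal{F}_j^I$ and $\sigma_j=C_\sigma^jp_j^2/h_\kappa$ on $F\in\mathcal{F}_j^B$, $F\subset\partial\kappa\cap\partial\Omega$, where $C_\sigma^j>0$ is independent of $p_j,|F|,|\kappa|$. The DG norm is $\|w\|_{DG,j}^2=\sum_{\kappa\in\mathcal{T}_j}\int_\kappa|\nabla w|^2dx+\sum_{F\in\mathcal{F}_j}\int_F\sigma_j|[\![w]\!]|^2ds$. The constants $C_\sigma^j$ are chosen sufficiently large that $\mathcal{A}_j$ is continuous and coercive on $V_j$ with respect to $\|\cdot\|_{DG,j}$, with constants independent of the discretization parameters. The DG solution $u_j\in V_j$ satisfies $\mathcal{A}_j(u_j,v_j)=\int_\Omega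 fv_j\,dx$ for all $v_j\in V_j$. Operators. $(\cdot,\cdot)$ is the $L^2(\Omega)$ inner product. $A_j:V_j\to V_j$ is defined by $(A_ju,v)=\mathcal{A}_j(u,v)$ for all $u,v\in V_j$, and $|||v|||_{s,j}=\sqrt{(A_j^sv,v)}$ for $v\in V_j$, $s\in\mathbb{N}\cup\{0\}$. $I_{j-1}^j:V_{j-1}\to V_j$ is the prolongation (natural injection), $I_j^{j-1}$ its $L^2(\Omega)$-adjoint, and $P_j^{j-1}:V_j\to V_{j-1}$ is defined by $\mathcal{A}_{j-1}(P_j^{j-1}v,w)=\mathcal{A}_j(v,I_{j-1}^jw)$ for all $v\in V_j$, $w\in V_{j-1}$. The smoother is the Richardson iteration with $B_j=\Lambda_j\mathrm{Id}_j$, where $\Lambda_j\in\mathbb{R}$ is an upper bound for the spectral radius of $A_j$ with $\Lambda_j\lesssim\mathsf{C}_{\mathsf{eig}}^jp_j^4/h_j^2$, and $G_j=\mathrm{Id}_j-B_j^{-1}A_j$. Constants. $\mathcal{E}:H^s(\Omega)\to H^s(\mathbb{R}^d)$, $s\in\mathbb{N}_0$, is Stein's extension operator ($\mathcal{E}v|_\Omega=v$). - $\mu\in\{0,1\}$: there is a projection $\widetilde\Pi_j:L^2(\Omega)\to V_j$ such that $\|v-\widetilde\Pi_jv\|_{DG,j}\le\mathsf{C}^j_{\mathsf{interp}}\,h_j^{s-1}p_j^{-(k-1-\mu/2)}\|v\|_{H^k(\Omega)}$, $s=\min\{p_j+1,k\}$, whenever $v|_\kappa\in H^k(\kappa)$,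 $k>d/2$, and $\mathcal{E}v|_{\mathcal{K}}\in H^k(\mathcal{K})$ for each $\kappa\in\mathcal{T}_j$, $\kappa\subset\mathcal{K}\in\mathcal{T}_j^\sharp$; here $\mathsf{C}^j_{\mathsf{interp}}$ depends on the shape-regularity of $\mathcal{T}_j^\sharp$ but is independent of the discretization parameters, the number of faces per element and the relative measure of the faces; $\mu=0$ whenever a $p$-optimal interpolant can be constructed and $\mu=1$ otherwise. - $\mathsf{C}^j_{L^2}$ is the constant, independent of the discretization parameters, in the error bound $\|u-u_j\|_{L^2(\Omega)}\le\mathsf{C}^j_{L^2}h_j^sp_j^{-(k-\mu)}\|u\|_{H^k(\Omega)}$, $s=\min\{p_j+1,k\}$. - $\mathsf{C}^j_{\mathsf{eig}}$ is the constant, independent of the discretization parameters, in $\mathcal{A}_j(v,v)\le\mathsf{C}^j_{\mathsf{eig}}\,p_j^4h_j^{-2}\|v\|_{L^2(\Omega)}^2$, $v\in V_j$. - $\mathsf{C}_{\mathsf{2lvl}}>0$ is the constant, independent of the mesh size and the polynomial degree, in the two-level estimate $|||G_j^{m_2}(\mathrm{Id}_j-I_{j-1}^jP_j^{j-1})G_j^{m_1}v|||_{1,j}\le\mathsf{C}_{\mathsf{2lvl}}\Sigma_j|||v|||_{1,j}$, $v\in V_j$, $j=2,\dots,J$, with $\Sigma_j=\widetilde{\mathsf{C}}_{j,j-1}p_j^{2+\mu}(1+m_1)^{-1/2}(1+m_2)^{-1/2}$. - $\mathsf{C}_{\mathsf{stab}}\ge1$ is the constant, independent of the mesh size, the polynomial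 degree and the level $j$, in the stability bounds $|||I_{j-1}^jv|||_{1,j}\le\mathsf{C}_{\mathsf{stab}}|||v|||_{1,j-1}$ for $v\in V_{j-1}$ and $|||P_j^{j-1}v|||_{1,j-1}\le\mathsf{C}_{\mathsf{stab}}|||v|||_{1,j}$ for $v\in V_j$, $j=2,\dots,J$. W-cycle. The W-cycle multigrid iteration on level $j$ solves exactly on level $1$ and, for $j>1$, performs $m_1$ smoothing steps, two recursive level-$(j-1)$ W-cycle iterations for the coarse-grid residual equation (the first with zero initial guess, the second starting from the result of the first), correction through $I_{j-1}^j$, and $m_2$ smoothing steps. Its error propagation operator is $$\mathbb{E}_{1,m_1,m_2}v=0,\qquad \mathbb{E}_{j,m_1,m_2}v=G_j^{m_2}\left(\mathrm{Id}_j-I_{j-1}^j(\mathrm{Id}_j-\mathbb{E}_{j-1,m_1,m_2}^2)P_j^{j-1}\right)G_j^{m_1}v,\quad j=2,\dots,J,$$ where the identity inside the inner parentheses acts on $V_{j-1}$. *)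

theory Defs
  imports "HOL-Analysis.Analysis"
begin

section \<open>Lebesgue and Sobolev spaces\<close>

text \<open>Elements of \<open>L\<^sup>2(S)\<close> are represented by functions on the whole space of which only the
  values on \<open>S\<close> matter. A multi-index is a function \<open>\<alpha> :: 'n \<Rightarrow> nat\<close> of order \<open>sum \<alpha> UNIV\<close>.\<close>

definition L2 :: "(real^'n) set \<Rightarrow> (real^'n \<Rightarrow> 'b::euclidean_space) \<Rightarrow> bool" where
  "L2 S v \<longleftrightarrow> set_borel_measurable lebesgue S v \<and>
     set_integrable lebesgue S (\<lambda>x. (norm (v x))\<^sup>2)"

definition l2_inner :: "(real^'n) set \<Rightarrow> (real^'n \<Rightarrow> real) \<Rightarrow> (real^'n \<Rightarrow> real) \<Rightarrow> real" where
  "l2_inner S u v = (LINT x:S|lebesgue. u x * v x)"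

definition l2_norm :: "(real^'n) set \<Rightarrow> (real^'n \<Rightarrow> 'b::euclidean_space) \<Rightarrow> real" where
  "l2_norm S v = sqrt (LINT x:S|lebesgue. (norm (v x))\<^sup>2)"

definition grad :: "(real^'n \<Rightarrow> real) \<Rightarrow> real^'n \<Rightarrow> real^'n" where
  "grad v x = (\<chi> i. frechet_derivative v (at x) (axis i 1))"

fun iter_partial :: "'n list \<Rightarrow> (real^'n \<Rightarrow> real) \<Rightarrow> (real^'n \<Rightarrow> real)" where
  "iter_partial [] f = f"
| "iter_partial (i # is) f = (\<lambda>x. grad (iter_partial is f) x $ i)"

definition test_function :: "(real^'n) set \<Rightarrow> (real^'n \<Rightarrow> real) \<Rightarrow> bool" where
  "test_function S \<phi> \<longleftrightarrow> (\<forall>is x. iter_partial is \<phi> differentiable (at x)) \<and>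
     compact (closure {x. \<phi> x \<noteq> 0}) \<and> closure {x. \<phi> x \<noteq> 0} \<subseteq> S"

text \<open>\<open>g\<close> is the weak derivative of \<open>v\<close> of multi-index \<open>\<alpha>\<close>. The list \<open>is\<close> enumerates the
  directions of differentiation; on test functions their order is irrelevant.\<close>

definition weak_deriv ::
  "(real^'n) set \<Rightarrow> ('n \<Rightarrow> nat) \<Rightarrow> (real^'n \<Rightarrow> real) \<Rightarrow> (real^'n \<Rightarrow> real) \<Rightarrow> bool" where
  "weak_deriv S \<alpha> v g \<longleftrightarrow> (\<forall>\<phi> is. test_function S \<phi> \<longrightarrow> count_list is = \<alpha> \<longrightarrow>
     (LINT x:S|lebesgue. v x * iter_partial is \<phi> x) =
     (- 1) ^ length is * (LINT x:S|lebesgue. g x * \<phi> x))"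

text \<open>\<open>v \<in> H\<^sup>k(S)\<close> with norm \<open>N\<close>; a relation because the weak derivatives are determined only
  almost everywhere.\<close>

definition has_sobolev_norm :: "nat \<Rightarrow> (real^'n) set \<Rightarrow> (real^'n \<Rightarrow> real) \<Rightarrow> real \<Rightarrow> bool" where
  "has_sobolev_norm k S v N \<longleftrightarrow> L2 S v \<and>
     (\<exists>g. (\<forall>\<alpha>. sum \<alpha> UNIV \<le> k \<longrightarrow> L2 S (g \<alpha>) \<and> weak_deriv S \<alpha> v (g \<alpha>)) \<and>
          N = sqrt (\<Sum>\<alpha> | sum \<alpha> UNIV \<le> k. (l2_norm S (g \<alpha>))\<^sup>2))"

definition in_sobolev :: "nat \<Rightarrow> (real^'n) set \<Rightarrow> (real^'n \<Rightarrow> real) \<Rightarrow> bool" where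
  "in_sobolev k S v \<longleftrightarrow> (\<exists>N. has_sobolev_norm k S v N)"

definition weak_gradient ::
  "(real^'n) set \<Rightarrow> (real^'n \<Rightarrow> real) \<Rightarrow> (real^'n \<Rightarrow> real^'n) \<Rightarrow> bool" where
  "weak_gradient S v g \<longleftrightarrow> L2 S v \<and> L2 S g \<and>
     (\<forall>i. weak_deriv S (\<lambda>j. if j = i then 1 else 0) v (\<lambda>x. g x $ i))"

text \<open>\<open>H\<^sup>1\<^sub>0(S)\<close>, the closure of the test functions in \<open>H\<^sup>1(S)\<close>.\<close>

definition in_H10 :: "(real^'n) set \<Rightarrow> (real^'n \<Rightarrow> real) \<Rightarrow> bool" where
  "in_H10 S v \<longleftrightarrow> (\<exists>g \<phi>. weak_gradient S v g \<and> (\<forall>n::nat. test_function S (\<phi> n)) \<and>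
     (\<lambda>n. l2_norm S (\<lambda>x. v x - \<phi> n x)) \<longlonglongrightarrow> 0 \<and>
     (\<lambda>n. l2_norm S (\<lambda>x. g x - grad (\<phi> n) x)) \<longlonglongrightarrow> 0)"

text \<open>The properties of Stein's operator: one linear operator that extends and is bounded
  \<open>H\<^sup>s(\<Omega>) \<rightarrow> H\<^sup>s(\<real>\<^sup>d)\<close> for every order \<open>s\<close>.\<close>

definition extension_operator ::
  "(real^'n) set \<Rightarrow> ((real^'n \<Rightarrow> real) \<Rightarrow> (real^'n \<Rightarrow> real)) \<Rightarrow> bool" where
  "extension_operator \<Omega> E \<longleftrightarrow>
     (\<forall>v. L2 \<Omega> v \<longrightarrow> (AE x in lebesgue. x \<in> \<Omega> \<longrightarrow> E v x = v x)) \<and>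
     (\<forall>u v a b. L2 \<Omega> u \<longrightarrow> L2 \<Omega> v \<longrightarrow>
        (AE x in lebesgue. E (\<lambda>y. a * u y + b * v y) x = a * E u x + b * E v x)) \<and>
     (\<forall>s. \<exists>C. \<forall>v N. has_sobolev_norm s \<Omega> v N \<longrightarrow>
        (\<exists>N'. has_sobolev_norm s UNIV (E v) N' \<and> N' \<le> C * N))"


section \<open>Model problem\<close>

text \<open>A bounded convex domain automatically has a Lipschitz boundary.\<close>

definition convex_polytopal_domain :: "(real^'n) set \<Rightarrow> bool" where
  "convex_polytopal_domain \<Omega> \<longleftrightarrow> open \<Omega> \<and> \<Omega> \<noteq> {} \<and> convex \<Omega> \<and> polytope (closure \<Omega>)"

definition in_V :: "(real^'n) set \<Rightarrow> (real^'n \<Rightarrow> real) \<Rightarrow> bool" where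
  "in_V \<Omega> v \<longleftrightarrow> in_sobolev 2 \<Omega> v \<and> in_H10 \<Omega> v"

definition weak_solution :: "(real^'n) set \<Rightarrow> (real^'n \<Rightarrow> real) \<Rightarrow> (real^'n \<Rightarrow> real) \<Rightarrow> bool" where
  "weak_solution \<Omega> f u \<longleftrightarrow> in_V \<Omega> u \<and>
     (\<exists>gu. weak_gradient \<Omega> u gu \<and>
        (\<forall>v gv. in_V \<Omega> v \<longrightarrow> weak_gradient \<Omega> v gv \<longrightarrow>
           (LINT x:\<Omega>|lebesgue. gu x \<bullet> gv x) = l2_inner \<Omega> f v))"


section \<open>Meshes\<close>

text \<open>The data of one multigrid discretization, on levels \<open>1, \<dots>, levels\<close>. Faces and the simplices
  of the coverings are closed sets, elements are open. \<open>smooth_par D j\<close> is the parameter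
  \<open>\<Lambda>\<^sub>j\<close> of the Richardson smoother.\<close>

record ('n::finite) discretization =
  levels :: nat
  mesh :: "nat \<Rightarrow> (real^'n) set set"
  faces :: "nat \<Rightarrow> (real^'n) set set"
  covering :: "nat \<Rightarrow> (real^'n) set set"
  deg :: "nat \<Rightarrow> nat"
  smooth_par :: "nat \<Rightarrow> real"

definition polytopal_element :: "(real^'n) set \<Rightarrow> bool" where
  "polytopal_element \<kappa> \<longleftrightarrow> open \<kappa> \<and> \<kappa> \<noteq> {} \<and> connected \<kappa> \<and> interior (closure \<kappa>) = \<kappa> \<and>
     (\<exists>\<P>. finite \<P> \<and> (\<forall>P\<in>\<P>. polytope P) \<and> closure \<kappa> = \<Union>\<P>)"

definition is_mesh :: "(real^'n) set \<Rightarrow> (real^'n) set set \<Rightarrow> bool" where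
  "is_mesh \<Omega> T \<longleftrightarrow> finite T \<and> (\<forall>\<kappa>\<in>T. polytopal_element \<kappa>) \<and> pairwise disjnt T \<and>
     closure \<Omega> = (\<Union>\<kappa>\<in>T. closure \<kappa>)"

definition mesh_size :: "(real^'n) set set \<Rightarrow> real" where
  "mesh_size T = Max (diameter ` T)"

text \<open>The elements sharing a face: \<open>{\<kappa>\<^sup>+, \<kappa>\<^sup>-}\<close> for an interior face, \<open>{\<kappa>\<^sup>+}\<close> for a
  boundary face.\<close>

definition neighbours :: "(real^'n) set set \<Rightarrow> (real^'n) set \<Rightarrow> (real^'n) set set" where
  "neighbours T F = {\<kappa>\<in>T. F \<subseteq> frontier \<kappa>}"

definition is_face_set :: "(real^'n) set \<Rightarrow> (real^'n) set set \<Rightarrow> (real^'n) set set \<Rightarrow> bool" where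
  "is_face_set \<Omega> T \<F> \<longleftrightarrow> finite \<F> \<and>
     (\<forall>F\<in>\<F>. (int CARD('n) - 1) simplex F \<and>
        (\<not> F \<subseteq> frontier \<Omega> \<and> card (neighbours T F) = 2 \<or>
         F \<subseteq> frontier \<Omega> \<and> card (neighbours T F) = 1)) \<and>
     pairwise (\<lambda>F G. disjnt (rel_interior F) (rel_interior G)) \<F> \<and>
     (\<forall>\<kappa>\<in>T. frontier \<kappa> = \<Union>{F\<in>\<F>. F \<subseteq> frontier \<kappa>})"

text \<open>The \<open>(d-1)\<close>-dimensional measure on a face \<open>F\<close> is obtained from the \<open>d\<close>-dimensional Lebesgue
  measure on the prism of height one over \<open>F\<close>, projected back orthogonally onto \<open>F\<close>; the result
  does not depend on the choice of the unit normal and the base point.\<close>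

definition unit_normal :: "(real^'n) set \<Rightarrow> real^'n \<Rightarrow> bool" where
  "unit_normal F n \<longleftrightarrow> norm n = 1 \<and> (\<forall>x\<in>F. \<forall>y\<in>F. n \<bullet> (x - y) = 0)"

definition face_measure :: "(real^'n) set \<Rightarrow> (real^'n) measure" where
  "face_measure F = (let n = (SOME n. unit_normal F n); a = (SOME a. a \<in> F) in
     distr (restrict_space lborel {x + t *\<^sub>R n | x t. x \<in> F \<and> t \<in> {0..1}}) borel
       (\<lambda>y. y - (n \<bullet> (y - a)) *\<^sub>R n))"

definition face_area :: "(real^'n) set \<Rightarrow> real" where
  "face_area F = measure (face_measure F) F"

text \<open>The unit normal to \<open>F \<subseteq> \<partial>\<kappa>\<close> pointing out of \<open>\<kappa>\<close>.\<close>

definition outward_normal :: "(real^'n) set \<Rightarrow> (real^'n) set \<Rightarrow> real^'n" where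
  "outward_normal \<kappa> F = (THE n. unit_normal F n \<and>
     (AE x in face_measure F. \<forall>\<^sub>F t in at_right 0. x - t *\<^sub>R n \<in> \<kappa>))"

definition shape_regular_simplex :: "real \<Rightarrow> (real^'n) set \<Rightarrow> bool" where
  "shape_regular_simplex c S \<longleftrightarrow> (int CARD('n)) simplex S \<and>
     (\<exists>x r. r > 0 \<and> ball x r \<subseteq> S \<and> diameter S \<le> c * r)"


section \<open>Families of discretizations\<close>

text \<open>All estimates with hidden constants are stated for a set \<open>\<DD>\<close> of discretizations, and a hidden
  constant is one that serves all members of \<open>\<DD>\<close> and all levels simultaneously.\<close>

definition same_mesh :: "'n::finite discretization \<Rightarrow> bool" where
  "same_mesh D \<longleftrightarrow> (\<forall>j\<in>{2..levels D}. mesh D j = mesh D (j - 1) \<and> faces D j = faces D (j - 1))"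

definition h_multigrid :: "real \<Rightarrow> 'n::finite discretization \<Rightarrow> bool" where
  "h_multigrid C D \<longleftrightarrow> (\<forall>j\<in>{2..levels D}.
     deg D j = deg D (j - 1) \<and>
     (\<forall>\<kappa>\<in>mesh D j. \<exists>K\<in>mesh D (j - 1). \<kappa> \<subseteq> K) \<and>
     (\<forall>K\<in>mesh D (j - 1). closure K = (\<Union>\<kappa>\<in>{\<kappa>\<in>mesh D j. \<kappa> \<subseteq> K}. closure \<kappa>)) \<and>
     mesh_size (mesh D (j - 1)) \<le> C * mesh_size (mesh D j) \<and>
     mesh_size (mesh D j) \<le> mesh_size (mesh D (j - 1)))"

definition p_multigrid :: "real \<Rightarrow> 'n::finite discretization \<Rightarrow> bool" where
  "p_multigrid C D \<longleftrightarrow> same_mesh D \<and> (\<forall>j\<in>{2..levels D}.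
     deg D (j - 1) \<le> deg D j \<and> real (deg D j) \<le> C * real (deg D (j - 1)))"

definition multigrid_family :: "(real^'n) set \<Rightarrow> 'n discretization set \<Rightarrow> bool" where
  "multigrid_family \<Omega> \<DD> \<longleftrightarrow>
     (\<forall>D\<in>\<DD>. levels D \<ge> 1 \<and> (\<forall>j\<in>{1..levels D}.
        is_mesh \<Omega> (mesh D j) \<and> is_face_set \<Omega> (mesh D j) (faces D j) \<and> deg D j \<ge> 1)) \<and>
     (\<exists>C>0. \<forall>D\<in>\<DD>. h_multigrid C D \<or> p_multigrid C D) \<and>
     (\<exists>C>0. \<forall>D\<in>\<DD>. \<forall>j\<in>{1..levels D}. \<forall>\<kappa>\<in>mesh D j. mesh_size (mesh D j) \<le> C * diameter \<kappa>)"

definition face_simplex_condition :: "('n::finite) discretization set \<Rightarrow> bool" where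
  "face_simplex_condition \<DD> \<longleftrightarrow> (\<exists>C>0. \<forall>D\<in>\<DD>. \<forall>j\<in>{1..levels D}. \<forall>\<kappa>\<in>mesh D j.
     \<exists>\<T>. finite \<T> \<and> (\<forall>T\<in>\<T>. (int CARD('n)) simplex T \<and> interior T \<subseteq> \<kappa>) \<and>
       pairwise (\<lambda>S T. disjnt (interior S) (interior T)) \<T> \<and>
       \<Union>\<T> \<subseteq> closure \<kappa> \<and>
       (\<forall>F\<in>faces D j. F \<subseteq> frontier \<kappa> \<longrightarrow>
          (\<exists>T\<in>\<T>. F = frontier (closure \<kappa>) \<inter> frontier T)) \<and>
       (\<forall>T\<in>\<T>. \<forall>F\<in>faces D j. F \<subseteq> frontier \<kappa> \<and> F = frontier (closure \<kappa>) \<inter> frontier T \<longrightarrow>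
          diameter \<kappa> \<le> C * (real CARD('n) * measure lebesgue T / face_area F)))"

definition volume_condition :: "('n::finite) discretization set \<Rightarrow> bool" where
  "volume_condition \<DD> \<longleftrightarrow> (\<exists>c>0. \<forall>D\<in>\<DD>. \<forall>j\<in>{1..levels D}. \<forall>\<kappa>\<in>mesh D j.
     measure lebesgue \<kappa> \<le> diameter \<kappa> ^ CARD('n) \<and>
     c * diameter \<kappa> ^ CARD('n) \<le> measure lebesgue \<kappa>)"

definition subtriangulation_condition :: "('n::finite) discretization set \<Rightarrow> bool" where
  "subtriangulation_condition \<DD> \<longleftrightarrow> (\<exists>c>0. \<exists>C>0. \<forall>D\<in>\<DD>. \<forall>j\<in>{1..levels D}. \<forall>\<kappa>\<in>mesh D j.
     \<exists>\<S>. finite \<S> \<and> (\<forall>S\<in>\<S>. shape_regular_simplex C S \<and>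
            c * measure lebesgue \<kappa> \<le> measure lebesgue S) \<and>
       pairwise (\<lambda>S T. disjnt (interior S) (interior T)) \<S> \<and> closure \<kappa> = \<Union>\<S>)"

definition covering_condition :: "(real^'n) set \<Rightarrow> 'n discretization set \<Rightarrow> bool" where
  "covering_condition \<Omega> \<DD> \<longleftrightarrow> (\<exists>C>0. \<exists>m::nat. \<exists>C'>0. \<forall>D\<in>\<DD>. \<forall>j\<in>{1..levels D}.
     (\<forall>K\<in>covering D j. shape_regular_simplex C K) \<and>
     \<Omega> \<subseteq> \<Union>(covering D j) \<and>
     (\<forall>\<kappa>\<in>mesh D j.
        (\<exists>K\<in>covering D j. \<kappa> \<subseteq> K) \<and>
        card {\<kappa>'\<in>mesh D j. \<exists>K\<in>covering D j. \<kappa> \<subseteq> K \<and> \<kappa>' \<inter> K \<noteq> {}} \<le> m \<and>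
        (\<forall>K\<in>covering D j. \<kappa> \<subseteq> K \<longrightarrow> diameter K \<le> C' * diameter \<kappa>)))"

text \<open>The strict lower bound concerns agglomerated meshes only: it cannot hold when all levels
  share the same mesh.\<close>

definition agglomeration_condition :: "('n::finite) discretization set \<Rightarrow> bool" where
  "agglomeration_condition \<DD> \<longleftrightarrow> (\<exists>\<Theta>>0. \<forall>D\<in>\<DD>. \<not> same_mesh D \<longrightarrow>
     (\<forall>j\<in>{2..levels D}. \<forall>F\<in>faces D j \<inter> faces D (j - 1).
        \<forall>\<kappa>\<in>neighbours (mesh D j) F. \<forall>K\<in>neighbours (mesh D (j - 1)) F. \<kappa> \<subseteq> K \<longrightarrow>
          1 < diameter K / diameter \<kappa> \<and> diameter K / diameter \<kappa> \<le> \<Theta>))"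


section \<open>Discontinuous Galerkin discretization\<close>

definition polynomial_of_degree :: "nat \<Rightarrow> (real^'n \<Rightarrow> real) \<Rightarrow> bool" where
  "polynomial_of_degree p q \<longleftrightarrow>
     (\<exists>c. q = (\<lambda>x. \<Sum>\<alpha> | sum \<alpha> UNIV \<le> p. c \<alpha> * (\<Prod>i\<in>UNIV. (x $ i) ^ \<alpha> i)))"

text \<open>\<open>V\<^sub>j\<close>, each class of \<open>L\<^sup>2(\<Omega>)\<close> being represented by its unique member that is polynomial at
  every point of every open element and vanishes outside the elements.\<close>

definition dg_space :: "(real^'n) set \<Rightarrow> 'n discretization \<Rightarrow> nat \<Rightarrow> (real^'n \<Rightarrow> real) set" where
  "dg_space \<Omega> D j = {v. L2 \<Omega> v \<and>
     (\<forall>\<kappa>\<in>mesh D j. \<exists>q. polynomial_of_degree (deg D j) q \<and> (\<forall>x\<in>\<kappa>. v x = q x)) \<and>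
     (\<forall>x. x \<notin> \<Union>(mesh D j) \<longrightarrow> v x = 0)}"

text \<open>The trace from \<open>\<kappa>\<close>, as the limit of averages over \<open>\<kappa> \<inter> ball x r\<close>: on a Lipschitz element this
  is the Sobolev trace almost everywhere on the boundary, and the boundary value if the function
  is continuous up to the boundary.\<close>

definition bdry_trace :: "(real^'n) set \<Rightarrow> (real^'n \<Rightarrow> 'b::euclidean_space) \<Rightarrow> real^'n \<Rightarrow> 'b" where
  "bdry_trace \<kappa> w x = Lim (at_right 0) (\<lambda>r. (1 / measure lebesgue (\<kappa> \<inter> ball x r)) *\<^sub>R
     (LINT y:\<kappa> \<inter> ball x r|lebesgue. w y))"

definition jump ::
  "'n::finite discretization \<Rightarrow> nat \<Rightarrow> (real^'n) set \<Rightarrow> (real^'n \<Rightarrow> real) \<Rightarrow> real^'n \<Rightarrow> real^'n" where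
  "jump D j F v x =
     (\<Sum>\<kappa>\<in>neighbours (mesh D j) F. bdry_trace \<kappa> v x *\<^sub>R outward_normal \<kappa> F)"

definition average ::
  "'n::finite discretization \<Rightarrow> nat \<Rightarrow> (real^'n) set \<Rightarrow> (real^'n \<Rightarrow> real^'n) \<Rightarrow> real^'n \<Rightarrow> real^'n" where
  "average D j F w x = (1 / real (card (neighbours (mesh D j) F))) *\<^sub>R
     (\<Sum>\<kappa>\<in>neighbours (mesh D j) F. bdry_trace \<kappa> w x)"

definition penalty :: "(nat \<Rightarrow> real) \<Rightarrow> 'n::finite discretization \<Rightarrow> nat \<Rightarrow> (real^'n) set \<Rightarrow> real" where
  "penalty C\<sigma> D j F =
     C\<sigma> j * Max ((\<lambda>\<kappa>. (real (deg D j))\<^sup>2 / diameter \<kappa>) ` neighbours (mesh D j) F)"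

text \<open>The form is only used on \<open>dg_space\<close>, where the gradient is the classical one elementwise.\<close>

definition dg_form ::
  "(nat \<Rightarrow> real) \<Rightarrow> 'n::finite discretization \<Rightarrow> nat \<Rightarrow> (real^'n \<Rightarrow> real) \<Rightarrow> (real^'n \<Rightarrow> real) \<Rightarrow> real" where
  "dg_form C\<sigma> D j u v =
     (\<Sum>\<kappa>\<in>mesh D j. LINT x:\<kappa>|lebesgue. grad u x \<bullet> grad v x)
     - (\<Sum>F\<in>faces D j. LINT x:F|face_measure F.
          average D j F (grad u) x \<bullet> jump D j F v x + jump D j F u x \<bullet> average D j F (grad v) x)
     + (\<Sum>F\<in>faces D j. LINT x:F|face_measure F.
          penalty C\<sigma> D j F * (jump D j F u x \<bullet> jump D j F v x))"

text \<open>The norm is also used for elementwise Sobolev functions; the second function argument is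
  the elementwise gradient of the first one.\<close>

definition dg_norm ::
  "(nat \<Rightarrow> real) \<Rightarrow> 'n::finite discretization \<Rightarrow> nat \<Rightarrow> (real^'n \<Rightarrow> real) \<Rightarrow> (real^'n \<Rightarrow> real^'n) \<Rightarrow> real" where
  "dg_norm C\<sigma> D j w g = sqrt (
     (\<Sum>\<kappa>\<in>mesh D j. LINT x:\<kappa>|lebesgue. (norm (g x))\<^sup>2)
     + (\<Sum>F\<in>faces D j. LINT x:F|face_measure F. penalty C\<sigma> D j F * (norm (jump D j F w x))\<^sup>2))"

definition continuous_coercive ::
  "(real^'n) set \<Rightarrow> 'n discretization set \<Rightarrow> (nat \<Rightarrow> real) \<Rightarrow> bool" where
  "continuous_coercive \<Omega> \<DD> C\<sigma> \<longleftrightarrow> (\<exists>C>0. \<exists>c>0. \<forall>D\<in>\<DD>. \<forall>j\<in>{1..levels D}.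
     (\<forall>u\<in>dg_space \<Omega> D j. \<forall>v\<in>dg_space \<Omega> D j.
        \<bar>dg_form C\<sigma> D j u v\<bar> \<le> C * dg_norm C\<sigma> D j u (grad u) * dg_norm C\<sigma> D j v (grad v)) \<and>
     (\<forall>v\<in>dg_space \<Omega> D j. dg_form C\<sigma> D j v v \<ge> c * (dg_norm C\<sigma> D j v (grad v))\<^sup>2))"

definition dg_solution ::
  "(real^'n) set \<Rightarrow> (nat \<Rightarrow> real) \<Rightarrow> 'n discretization \<Rightarrow> nat \<Rightarrow>
   (real^'n \<Rightarrow> real) \<Rightarrow> (real^'n \<Rightarrow> real) \<Rightarrow> bool" where
  "dg_solution \<Omega> C\<sigma> D j f w \<longleftrightarrow> w \<in> dg_space \<Omega> D j \<and>
     (\<forall>v\<in>dg_space \<Omega> D j. dg_form C\<sigma> D j w v = l2_inner \<Omega> f v)"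


section \<open>Interpolation, error and inverse estimates\<close>

definition is_projection ::
  "(real^'n) set \<Rightarrow> 'n discretization \<Rightarrow> nat \<Rightarrow> ((real^'n \<Rightarrow> real) \<Rightarrow> (real^'n \<Rightarrow> real)) \<Rightarrow> bool" where
  "is_projection \<Omega> D j Q \<longleftrightarrow>
     (\<forall>v. L2 \<Omega> v \<longrightarrow> Q v \<in> dg_space \<Omega> D j) \<and>
     (\<forall>v\<in>dg_space \<Omega> D j. Q v = v) \<and>
     (\<forall>u v. L2 \<Omega> u \<longrightarrow> L2 \<Omega> v \<longrightarrow> (AE x in lebesgue. x \<in> \<Omega> \<longrightarrow> u x = v x) \<longrightarrow> Q u = Q v) \<and>
     (\<forall>u v a b. L2 \<Omega> u \<longrightarrow> L2 \<Omega> v \<longrightarrow>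
        Q (\<lambda>x. a * u x + b * v x) = (\<lambda>x. a * Q u x + b * Q v x))"

definition interpolation_estimate ::
  "(real^'n) set \<Rightarrow> ((real^'n \<Rightarrow> real) \<Rightarrow> (real^'n \<Rightarrow> real)) \<Rightarrow> 'n discretization set \<Rightarrow>
   (nat \<Rightarrow> real) \<Rightarrow> nat \<Rightarrow> nat \<Rightarrow> (nat \<Rightarrow> real) \<Rightarrow> bool" where
  "interpolation_estimate \<Omega> E \<DD> C\<sigma> k \<mu> C \<longleftrightarrow> (\<forall>D\<in>\<DD>. \<forall>j\<in>{1..levels D}.
     \<exists>Q. is_projection \<Omega> D j Q \<and>
       (\<forall>v N g. L2 \<Omega> v \<longrightarrow>
          (\<forall>\<kappa>\<in>mesh D j. in_sobolev k \<kappa> v \<and>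
             (\<forall>K\<in>covering D j. \<kappa> \<subseteq> K \<longrightarrow> in_sobolev k (interior K) (E v))) \<longrightarrow>
          has_sobolev_norm k \<Omega> v N \<longrightarrow>
          (\<forall>\<kappa>\<in>mesh D j. weak_gradient \<kappa> (\<lambda>x. v x - Q v x) g) \<longrightarrow>
          dg_norm C\<sigma> D j (\<lambda>x. v x - Q v x) g
            \<le> C j * mesh_size (mesh D j) ^ (min (deg D j + 1) k - 1)
                * real (deg D j) powr (- (real k - 1 - real \<mu> / 2)) * N))"

text \<open>\<open>\<mu> = 0\<close> whenever a \<open>p\<close>-optimal interpolant exists, \<open>\<mu> = 1\<close> otherwise.\<close>

definition interpolation_index ::
  "(real^'n) set \<Rightarrow> ((real^'n \<Rightarrow> real) \<Rightarrow> (real^'n \<Rightarrow> real)) \<Rightarrow> 'n discretization set \<Rightarrow>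
   (nat \<Rightarrow> real) \<Rightarrow> nat \<Rightarrow> nat \<Rightarrow> bool" where
  "interpolation_index \<Omega> E \<DD> C\<sigma> k \<mu> \<longleftrightarrow> \<mu> \<in> {0, 1} \<and>
     (\<exists>C. interpolation_estimate \<Omega> E \<DD> C\<sigma> k \<mu> C) \<and>
     ((\<exists>C. interpolation_estimate \<Omega> E \<DD> C\<sigma> k 0 C) \<longrightarrow> \<mu> = 0)"

definition L2_error_estimate ::
  "(real^'n) set \<Rightarrow> 'n discretization set \<Rightarrow> (nat \<Rightarrow> real) \<Rightarrow> nat \<Rightarrow> nat \<Rightarrow> (nat \<Rightarrow> real) \<Rightarrow> bool" where
  "L2_error_estimate \<Omega> \<DD> C\<sigma> k \<mu> CL2 \<longleftrightarrow> (\<forall>D\<in>\<DD>. \<forall>j\<in>{1..levels D}. \<forall>f u N w.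
     L2 \<Omega> f \<longrightarrow> weak_solution \<Omega> f u \<longrightarrow> has_sobolev_norm k \<Omega> u N \<longrightarrow> dg_solution \<Omega> C\<sigma> D j f w \<longrightarrow>
     l2_norm \<Omega> (\<lambda>x. u x - w x)
       \<le> CL2 j * mesh_size (mesh D j) ^ min (deg D j + 1) k
           * real (deg D j) powr (- (real k - real \<mu>)) * N)"

definition inverse_estimate ::
  "(real^'n) set \<Rightarrow> 'n discretization set \<Rightarrow> (nat \<Rightarrow> real) \<Rightarrow> (nat \<Rightarrow> real) \<Rightarrow> bool" where
  "inverse_estimate \<Omega> \<DD> C\<sigma> Ceig \<longleftrightarrow> (\<forall>D\<in>\<DD>. \<forall>j\<in>{1..levels D}. \<forall>v\<in>dg_space \<Omega> D j.
     dg_form C\<sigma> D j v v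
       \<le> Ceig j * real (deg D j) ^ 4 / (mesh_size (mesh D j))\<^sup>2 * (l2_norm \<Omega> v)\<^sup>2)"


section \<open>Multigrid operators\<close>

definition dg_operator ::
  "(real^'n) set \<Rightarrow> (nat \<Rightarrow> real) \<Rightarrow> 'n discretization \<Rightarrow> nat \<Rightarrow>
   (real^'n \<Rightarrow> real) \<Rightarrow> (real^'n \<Rightarrow> real)" where
  "dg_operator \<Omega> C\<sigma> D j u = (THE w. w \<in> dg_space \<Omega> D j \<and>
     (\<forall>v\<in>dg_space \<Omega> D j. l2_inner \<Omega> w v = dg_form C\<sigma> D j u v))"

definition energy_norm ::
  "(real^'n) set \<Rightarrow> (nat \<Rightarrow> real) \<Rightarrow> 'n discretization \<Rightarrow> nat \<Rightarrow> nat \<Rightarrow> (real^'n \<Rightarrow> real) \<Rightarrow> real" where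
  "energy_norm \<Omega> C\<sigma> D s j v = sqrt (l2_inner \<Omega> ((dg_operator \<Omega> C\<sigma> D j ^^ s) v) v)"

text \<open>The natural injection \<open>V\<^bsub>j-1\<^esub> \<rightarrow> V\<^bsub>j\<^esub>\<close>: the same class of \<open>L\<^sup>2(\<Omega>)\<close>, with its representative
  reset to zero on the skeleton of the finer mesh.\<close>

definition prolong :: "'n::finite discretization \<Rightarrow> nat \<Rightarrow> (real^'n \<Rightarrow> real) \<Rightarrow> (real^'n \<Rightarrow> real)" where
  "prolong D j v = (\<lambda>x. if x \<in> \<Union>(mesh D j) then v x else 0)"

definition coarse_proj ::
  "(real^'n) set \<Rightarrow> (nat \<Rightarrow> real) \<Rightarrow> 'n discretization \<Rightarrow> nat \<Rightarrow>
   (real^'n \<Rightarrow> real) \<Rightarrow> (real^'n \<Rightarrow> real)" where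
  "coarse_proj \<Omega> C\<sigma> D j v = (THE w. w \<in> dg_space \<Omega> D (j - 1) \<and>
     (\<forall>z\<in>dg_space \<Omega> D (j - 1). dg_form C\<sigma> D (j - 1) w z = dg_form C\<sigma> D j v (prolong D j z)))"

text \<open>\<open>A\<^sub>j\<close> is self-adjoint, so that its spectrum consists of real eigenvalues.\<close>

definition is_eigenvalue ::
  "(real^'n) set \<Rightarrow> (nat \<Rightarrow> real) \<Rightarrow> 'n discretization \<Rightarrow> nat \<Rightarrow> real \<Rightarrow> bool" where
  "is_eigenvalue \<Omega> C\<sigma> D j c \<longleftrightarrow> (\<exists>v\<in>dg_space \<Omega> D j. v \<noteq> (\<lambda>x. 0) \<and>
     dg_operator \<Omega> C\<sigma> D j v = (\<lambda>x. c * v x))"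

definition smoothing_condition ::
  "(real^'n) set \<Rightarrow> 'n discretization set \<Rightarrow> (nat \<Rightarrow> real) \<Rightarrow> (nat \<Rightarrow> real) \<Rightarrow> bool" where
  "smoothing_condition \<Omega> \<DD> C\<sigma> Ceig \<longleftrightarrow>
     (\<forall>D\<in>\<DD>. \<forall>j\<in>{1..levels D}. \<forall>c. is_eigenvalue \<Omega> C\<sigma> D j c \<longrightarrow> \<bar>c\<bar> \<le> smooth_par D j) \<and>
     (\<exists>C>0. \<forall>D\<in>\<DD>. \<forall>j\<in>{1..levels D}.
        smooth_par D j \<le> C * (Ceig j * real (deg D j) ^ 4 / (mesh_size (mesh D j))\<^sup>2))"

definition smoother ::
  "(real^'n) set \<Rightarrow> (nat \<Rightarrow> real) \<Rightarrow> 'n discretization \<Rightarrow> nat \<Rightarrow>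
   (real^'n \<Rightarrow> real) \<Rightarrow> (real^'n \<Rightarrow> real)" where
  "smoother \<Omega> C\<sigma> D j v = (\<lambda>x. v x - inverse (smooth_par D j) * dg_operator \<Omega> C\<sigma> D j v x)"

text \<open>\<open>G\<^bsub>j\<^esub>\<^bsup>m2\<^esup> (Id - I (Id - E) P) G\<^bsub>j\<^esub>\<^bsup>m1\<^esup>\<close> for an operator \<open>E\<close> on the coarser space. The
  two-level method is the case \<open>E = 0\<close>.\<close>

definition multilevel_step ::
  "(real^'n) set \<Rightarrow> (nat \<Rightarrow> real) \<Rightarrow> 'n discretization \<Rightarrow> nat \<Rightarrow> nat \<Rightarrow> nat \<Rightarrow>
   ((real^'n \<Rightarrow> real) \<Rightarrow> (real^'n \<Rightarrow> real)) \<Rightarrow> (real^'n \<Rightarrow> real) \<Rightarrow> (real^'n \<Rightarrow> real)" where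
  "multilevel_step \<Omega> C\<sigma> D m1 m2 j E v =
     (let w = (smoother \<Omega> C\<sigma> D j ^^ m1) v;
          z = coarse_proj \<Omega> C\<sigma> D j w
      in (smoother \<Omega> C\<sigma> D j ^^ m2) (\<lambda>x. w x - prolong D j (\<lambda>y. z y - E z y) x))"

text \<open>Levels are numbered from one; the value at level zero is irrelevant.\<close>

fun wcycle_error ::
  "(real^'n) set \<Rightarrow> (nat \<Rightarrow> real) \<Rightarrow> 'n discretization \<Rightarrow> nat \<Rightarrow> nat \<Rightarrow> nat \<Rightarrow>
   (real^'n \<Rightarrow> real) \<Rightarrow> (real^'n \<Rightarrow> real)" where
  "wcycle_error \<Omega> C\<sigma> D m1 m2 0 = (\<lambda>v x. 0)"
| "wcycle_error \<Omega> C\<sigma> D m1 m2 (Suc 0) = (\<lambda>v x. 0)"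
| "wcycle_error \<Omega> C\<sigma> D m1 m2 (Suc (Suc i)) =
     multilevel_step \<Omega> C\<sigma> D m1 m2 (Suc (Suc i))
       (wcycle_error \<Omega> C\<sigma> D m1 m2 (Suc i) \<circ> wcycle_error \<Omega> C\<sigma> D m1 m2 (Suc i))"

definition Ctilde :: "(nat \<Rightarrow> real) \<Rightarrow> (nat \<Rightarrow> real) \<Rightarrow> nat \<Rightarrow> real" where
  "Ctilde Ceig CL2 j = (if j \<le> 1 then 0 else Ceig j * (CL2 j + CL2 (j - 1)))"

definition Sigma_factor ::
  "(nat \<Rightarrow> real) \<Rightarrow> (nat \<Rightarrow> real) \<Rightarrow> nat \<Rightarrow> 'n::finite discretization \<Rightarrow> nat \<Rightarrow> nat \<Rightarrow> nat \<Rightarrow> real" where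
  "Sigma_factor Ceig CL2 \<mu> D m1 m2 j = Ctilde Ceig CL2 j *
     (real (deg D j) ^ (2 + \<mu>) / (sqrt (1 + real m1) * sqrt (1 + real m2)))"

definition two_level_estimate ::
  "(real^'n) set \<Rightarrow> 'n discretization set \<Rightarrow> (nat \<Rightarrow> real) \<Rightarrow> (nat \<Rightarrow> real) \<Rightarrow> (nat \<Rightarrow> real) \<Rightarrow>
   nat \<Rightarrow> real \<Rightarrow> bool" where
  "two_level_estimate \<Omega> \<DD> C\<sigma> Ceig CL2 \<mu> C2lvl \<longleftrightarrow>
     (\<forall>D\<in>\<DD>. \<forall>j\<in>{2..levels D}. \<forall>m1 m2. \<forall>v\<in>dg_space \<Omega> D j.
        energy_norm \<Omega> C\<sigma> D 1 j (multilevel_step \<Omega> C\<sigma> D m1 m2 j (\<lambda>w x. 0) v)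
          \<le> C2lvl * Sigma_factor Ceig CL2 \<mu> D m1 m2 j * energy_norm \<Omega> C\<sigma> D 1 j v)"

definition stability_estimate ::
  "(real^'n) set \<Rightarrow> 'n discretization set \<Rightarrow> (nat \<Rightarrow> real) \<Rightarrow> real \<Rightarrow> bool" where
  "stability_estimate \<Omega> \<DD> C\<sigma> Cstab \<longleftrightarrow> (\<forall>D\<in>\<DD>. \<forall>j\<in>{2..levels D}.
     (\<forall>v\<in>dg_space \<Omega> D (j - 1). energy_norm \<Omega> C\<sigma> D 1 j (prolong D j v)
        \<le> Cstab * energy_norm \<Omega> C\<sigma> D 1 (j - 1) v) \<and>
     (\<forall>v\<in>dg_space \<Omega> D j. energy_norm \<Omega> C\<sigma> D 1 (j - 1) (coarse_proj \<Omega> C\<sigma> D j v)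
        \<le> Cstab * energy_norm \<Omega> C\<sigma> D 1 j v))"

end

theory Submission
  imports Defs
begin

text \<open>The error operator of level \<open>j\<close> is the one of the two-level method plus
  \<open>G\<^bsup>m2\<^esup> I E\<^bsub>j-1\<^esub>\<^sup>2 P G\<^bsup>m1\<^esup>\<close>. The smoother does not increase the energy norm, since the
  spectrum of \<open>A\<^sub>j\<close> lies in \<open>[0, \<Lambda>\<^sub>j]\<close>; so by stability and induction the additional term has energy
  norm at most \<open>(Cstab Chat \<Sigma>\<^bsub>j-1\<^esub>)\<^sup>2\<close> times that of the argument. The condition on the number of
  smoothing steps says exactly that this is absorbed by \<open>(Chat - C2lvl) \<Sigma>\<^sub>j\<close>, whatever the choice of
  \<open>Chat > C2lvl\<close>.

  All operators exist by Riesz representation, which for \<open>P\<close> requires the form to be definite. A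
  function of vanishing DG norm is constant on every element, with equal values on both sides of a
  face and value zero at the boundary. If it had a nonzero value, the union of the elements with that
  value would be a bounded set with interior points whose frontier is contained in the relative
  boundaries of the faces, which have codimension two; this is impossible.\<close>

section \<open>Symmetric forms on finite-dimensional function spaces\<close>

text \<open>The obstacle is that little may be said about the objects of the method before they are
  known to be well defined: A_j, P and the outward normals are definite descriptions, traces are
  limits, and the measure on a face depends on chosen vectors. Much of the proof turns these into
  usable identities. The hypothesis on the smoother bounds eigenvalues, while stability in the
  energy norm needs an inequality between quadratic forms; a Rayleigh quotient links the two.
  Coercivity gives positivity only up to functions of vanishing DG norm, so definiteness becomes a
  geometric question about elements that may be nonconvex and whose faces are controlled only
  through inscribed simplices. These describe an element near relative interior points of a face and
  nowhere else, which is why the relative boundaries remain as exceptional set. Collecting all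
  elements that carry one value replaces a walk from element to element towards the boundary of the
  domain.\<close>

locale function_space =
  fixes V :: "('a \<Rightarrow> real) set"
  assumes zero_mem: "(\<lambda>x. 0) \<in> V"
    and lin_mem: "u \<in> V \<Longrightarrow> v \<in> V \<Longrightarrow> (\<lambda>x. a * u x + b * v x) \<in> V"
begin

lemma scale_mem: "u \<in> V \<Longrightarrow> (\<lambda>x. a * u x) \<in> V"
  using lin_mem[of u u a 0] by simp

lemma add_mem: "u \<in> V \<Longrightarrow> v \<in> V \<Longrightarrow> (\<lambda>x. u x + v x) \<in> V"
  using lin_mem[of u v 1 1] by simp

lemma diff_mem: "u \<in> V \<Longrightarrow> v \<in> V \<Longrightarrow> (\<lambda>x. u x - v x) \<in> V"
  using lin_mem[of u v 1 "-1"] by simp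

lemma sum_mem:
  assumes "\<And>i. i \<in> I \<Longrightarrow> u i \<in> V"
  shows "(\<lambda>x. \<Sum>i\<in>I. c i * u i x) \<in> V"
  using assms
proof (induction I rule: infinite_finite_induct)
  case (insert i I)
  have "(\<lambda>x. c i * u i x + 1 * (\<Sum>i\<in>I. c i * u i x)) \<in> V"
    by (rule lin_mem) (use insert in auto)
  then show ?case using insert by simp
qed (simp_all add: zero_mem)

text \<open>Linearity is asked for on \<open>V\<close> only: the traces and gradients in the DG form
  are under control for piecewise polynomials, not for arbitrary functions.\<close>

definition linear_functional :: "(('a \<Rightarrow> real) \<Rightarrow> real) \<Rightarrow> bool" where
  "linear_functional L \<longleftrightarrow>
     (\<forall>u\<in>V. \<forall>v\<in>V. \<forall>a b. L (\<lambda>x. a * u x + b * v x) = a * L u + b * L v)"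

lemma linear_functional_lin:
  assumes "linear_functional L" "u \<in> V" "v \<in> V"
  shows "L (\<lambda>x. a * u x + b * v x) = a * L u + b * L v"
  using assms unfolding linear_functional_def by blast

lemma linear_functional_zero: "linear_functional L \<Longrightarrow> L (\<lambda>x. 0) = 0"
  using linear_functional_lin[OF _ zero_mem zero_mem, of L 0 0] by simp

lemma linear_functional_sum:
  assumes L: "linear_functional L" and "\<And>i. i \<in> I \<Longrightarrow> u i \<in> V"
  shows "L (\<lambda>x. \<Sum>i\<in>I. c i * u i x) = (\<Sum>i\<in>I. c i * L (u i))"
  using assms(2)
proof (induction I rule: infinite_finite_induct)
  case (insert i I)
  have "L (\<lambda>x. c i * u i x + 1 * (\<Sum>i\<in>I. c i * u i x)) = c i * L (u i) + 1 * L (\<lambda>x. \<Sum>i\<in>I. c i * u i x)"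
    by (rule linear_functional_lin[OF L]) (use insert.prems in \<open>auto intro: sum_mem\<close>)
  then show ?case using insert by simp
qed (simp_all add: linear_functional_zero[OF L])

definition symmetric_form :: "(('a \<Rightarrow> real) \<Rightarrow> ('a \<Rightarrow> real) \<Rightarrow> real) \<Rightarrow> bool" where
  "symmetric_form f \<longleftrightarrow> (\<forall>u\<in>V. \<forall>v\<in>V. f u v = f v u) \<and> (\<forall>w\<in>V. linear_functional (\<lambda>u. f u w))"

lemma symmetric_formI:
  assumes "\<And>u v. u \<in> V \<Longrightarrow> v \<in> V \<Longrightarrow> f u v = f v u"
    and "\<And>u v w a b. u \<in> V \<Longrightarrow> v \<in> V \<Longrightarrow> w \<in> V \<Longrightarrow>
      f (\<lambda>x. a * u x + b * v x) w = a * f u w + b * f v w"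
  shows "symmetric_form f"
  using assms unfolding symmetric_form_def linear_functional_def by blast

lemma form_sym: "symmetric_form f \<Longrightarrow> u \<in> V \<Longrightarrow> v \<in> V \<Longrightarrow> f u v = f v u"
  unfolding symmetric_form_def by blast

lemma form_left: "symmetric_form f \<Longrightarrow> w \<in> V \<Longrightarrow> linear_functional (\<lambda>u. f u w)"
  unfolding symmetric_form_def by blast

lemma form_lin_left:
  assumes "symmetric_form f" "u \<in> V" "v \<in> V" "w \<in> V"
  shows "f (\<lambda>x. a * u x + b * v x) w = a * f u w + b * f v w"
  using form_left[OF assms(1,4)] assms unfolding linear_functional_def by blast

lemma form_lin_right:
  assumes "symmetric_form f" "u \<in> V" "v \<in> V" "w \<in> V"
  shows "f w (\<lambda>x. a * u x + b * v x) = a * f w u + b * f w v"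
  using form_lin_left[OF assms] form_sym[OF assms(1)] lin_mem assms by simp

lemma form_quadratic:
  assumes "symmetric_form f" "u \<in> V" "v \<in> V"
  shows "f (\<lambda>x. a * u x + b * v x) (\<lambda>x. a * u x + b * v x)
    = a\<^sup>2 * f u u + 2 * a * b * f u v + b\<^sup>2 * f v v"
  using form_lin_left[OF assms] form_lin_right[OF assms] lin_mem[OF assms(2,3)]
    form_sym[OF assms] assms
  by (simp add: algebra_simps power2_eq_square)

lemma form_zero_left: "symmetric_form f \<Longrightarrow> w \<in> V \<Longrightarrow> f (\<lambda>x. 0) w = 0"
  using linear_functional_zero[OF form_left] by auto

lemma symmetric_form_diff:
  assumes "symmetric_form f" "symmetric_form g"
  shows "symmetric_form (\<lambda>u v. c * f u v - g u v)"
  by (rule symmetric_formI)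
     (use form_sym[OF assms(1)] form_sym[OF assms(2)] in
       \<open>auto simp: form_lin_left[OF assms(1)] form_lin_left[OF assms(2)] algebra_simps\<close>)

text \<open>Stated for semidefinite forms, because \<open>Rayleigh_bound\<close> applies it to a
  form that vanishes at a nonzero vector.\<close>

lemma Cauchy_Schwarz_form:
  assumes f: "symmetric_form f" and pos: "\<And>v. v \<in> V \<Longrightarrow> f v v \<ge> 0" and u: "u \<in> V" and v: "v \<in> V"
  shows "(f u v)\<^sup>2 \<le> f u u * f v v"
proof (cases "f u u = 0")
  case True
  \<comment> \<open>An affine function of \<open>t\<close> that stays nonnegative has slope zero;
    with a nonzero slope, the instance chosen next would have the value -1.\<close>
  have "2 * t * f u v + f v v \<ge> 0" for t
    using pos[OF lin_mem[OF u v, of t 1]] form_quadratic[OF f u v, of t 1] True by simp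
  from this[of "- (f v v + 1) / (2 * f u v)"] have "f u v = 0"
    by (cases "f u v = 0") (auto simp: field_simps)
  then show ?thesis using True by simp
next
  case False
  then have "f u u > 0" using pos[OF u] by simp
  \<comment> \<open>Up to the factor \<open>- f u u\<close>, the test vector is the part of
    \<open>v\<close> orthogonal to \<open>u\<close>.\<close>
  moreover have "f u u * (f u u * f v v - (f u v)\<^sup>2) \<ge> 0"
    using pos[OF lin_mem[OF u v, of "f u v" "- f u u"]] form_quadratic[OF f u v, of "f u v" "- f u u"]
    by (simp add: algebra_simps power2_eq_square)
  ultimately show ?thesis
    by (simp add: zero_le_mult_iff)
qed

lemma form_triangle:
  assumes f: "symmetric_form f" and pos: "\<And>v. v \<in> V \<Longrightarrow> f v v \<ge> 0" and u: "u \<in> V" and v: "v \<in> V"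
  shows "sqrt (f (\<lambda>x. u x + v x) (\<lambda>x. u x + v x)) \<le> sqrt (f u u) + sqrt (f v v)"
proof (rule real_le_lsqrt)
  have "\<bar>f u v\<bar> \<le> sqrt (f u u) * sqrt (f v v)"
    using real_sqrt_le_mono[OF Cauchy_Schwarz_form[OF f pos u v]] by (simp add: real_sqrt_mult)
  then show "f (\<lambda>x. u x + v x) (\<lambda>x. u x + v x) \<le> (sqrt (f u u) + sqrt (f v v))\<^sup>2"
    using form_quadratic[OF f u v, of 1 1] pos[OF u] pos[OF v] by (simp add: power2_sum)
qed (use pos u v in auto)

section \<open>Orthonormal bases, Riesz representation and Rayleigh quotients\<close>

definition pos_def_form :: "(('a \<Rightarrow> real) \<Rightarrow> ('a \<Rightarrow> real) \<Rightarrow> real) \<Rightarrow> bool" where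
  "pos_def_form f \<longleftrightarrow> symmetric_form f \<and> (\<forall>v\<in>V. v \<noteq> (\<lambda>x. 0) \<longrightarrow> f v v > 0)"

definition orthonormal :: "(('a \<Rightarrow> real) \<Rightarrow> ('a \<Rightarrow> real) \<Rightarrow> real) \<Rightarrow> ('a \<Rightarrow> real) set \<Rightarrow> bool" where
  "orthonormal f S \<longleftrightarrow> finite S \<and> S \<subseteq> V \<and> (\<forall>d\<in>S. \<forall>e\<in>S. f d e = (if d = e then 1 else 0))"

lemma form_sum_left:
  assumes f: "symmetric_form f" and S: "S \<subseteq> V" and w: "w \<in> V"
  shows "f (\<lambda>x. \<Sum>e\<in>S. c e * e x) w = (\<Sum>e\<in>S. c e * f e w)"
  using linear_functional_sum[OF form_left[OF f w], of S "\<lambda>e. e" c] S by auto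

lemma orthonormal_coeff:
  assumes f: "symmetric_form f" and S: "orthonormal f S" and e: "e \<in> S"
  shows "f (\<lambda>x. \<Sum>d\<in>S. c d * d x) e = c e"
proof -
  have "S \<subseteq> V" "e \<in> V" using S e unfolding orthonormal_def by auto
  then have "f (\<lambda>x. \<Sum>d\<in>S. c d * d x) e = (\<Sum>d\<in>S. c d * f d e)"
    by (rule form_sum_left[OF f])
  also have "\<dots> = (\<Sum>d\<in>S. if d = e then c e else 0)"
    using S e unfolding orthonormal_def by (intro sum.cong) auto
  finally show ?thesis using S e unfolding orthonormal_def by simp
qed

text \<open>The family \<open>B\<close> may be dependent: a vector with zero remainder adds nothing
  to \<open>S\<close>. The coefficients are prescribed as \<open>f b e\<close>, so that the
  expansion passes to every linear combination of \<open>B\<close>.\<close>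

lemma Gram_Schmidt:
  assumes f: "pos_def_form f" and "finite B" "B \<subseteq> V"
  shows "\<exists>S. orthonormal f S \<and> (\<forall>b\<in>B. b = (\<lambda>x. \<Sum>e\<in>S. f b e * e x))"
  using assms(2,3)
proof (induction B)
  case empty
  show ?case by (rule exI[of _ "{}"]) (simp add: orthonormal_def)
next
  case (insert b B)
  have sym: "symmetric_form f" using f unfolding pos_def_form_def by blast
  obtain S where S: "orthonormal f S" and BS: "\<And>b. b \<in> B \<Longrightarrow> b = (\<lambda>x. \<Sum>e\<in>S. f b e * e x)"
    using insert by auto
  have SV: "S \<subseteq> V" "finite S" using S unfolding orthonormal_def by auto
  define s where "s = (\<lambda>x. \<Sum>e\<in>S. f b e * e x)"
  define r where "r = (\<lambda>x. b x - s x)"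
  have b: "b \<in> V" using insert by simp
  have s: "s \<in> V" unfolding s_def using SV by (intro sum_mem) auto
  have r: "r \<in> V" unfolding r_def by (rule diff_mem[OF b s])
  show ?case
  proof (cases "r = (\<lambda>x. 0)")
    case True
    then have "b = s" unfolding r_def by (auto simp: fun_eq_iff)
    then have "b = (\<lambda>x. \<Sum>e\<in>S. f b e * e x)" unfolding s_def .
    then show ?thesis using S BS by blast
  next
    case False
    then have rr: "f r r > 0" using f r unfolding pos_def_form_def by blast
    define q where "q = (\<lambda>x. (1 / sqrt (f r r)) * r x)"
    have q: "q \<in> V" unfolding q_def by (rule scale_mem[OF r])
    have fq: "f q w = f r w / sqrt (f r r)" if "w \<in> V" for w
      using form_lin_left[OF sym r r that, of "1 / sqrt (f r r)" 0] by (simp add: q_def)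
    have re: "f r e = 0" if "e \<in> S" for e
    proof -
      have "f r e = f b e - f s e"
        using form_lin_left[OF sym b s, of e 1 "-1"] that SV by (auto simp: r_def)
      then show ?thesis using orthonormal_coeff[OF sym S that, of "f b"] by (simp add: s_def)
    qed
    have qe: "f q e = 0" "f e q = 0" if "e \<in> S" for e
      using fq[of e] re[OF that] that SV form_sym[OF sym q, of e] by auto
    have qq: "f q q = 1"
      using fq[OF q] form_sym[OF sym r q] fq[OF r] rr by simp
    have qS: "q \<notin> S" using qq qe by force
    have S': "orthonormal f (insert q S)"
      using S q qe qq unfolding orthonormal_def by auto
    \<comment> \<open>Vectors treated earlier are combinations of \<open>S\<close>, hence orthogonal
      to \<open>q\<close>, and their expansions survive the enlargement of \<open>S\<close>.\<close>
    have "c = (\<lambda>x. \<Sum>e\<in>insert q S. f c e * e x)" if "c \<in> B" for c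
    proof -
      have "f c q = f (\<lambda>x. \<Sum>e\<in>S. f c e * e x) q"
        by (rule arg_cong[where f="\<lambda>c. f c q"]) (rule BS[OF that])
      also have "\<dots> = (\<Sum>e\<in>S. f c e * f e q)" by (rule form_sum_left[OF sym SV(1) q])
      also have "\<dots> = 0" by (simp add: qe)
      finally show ?thesis using BS[OF that] qS SV by (simp add: fun_eq_iff)
    qed
    moreover have "b = (\<lambda>x. \<Sum>e\<in>insert q S. f b e * e x)"
    proof -
      have "f s q = (\<Sum>e\<in>S. f b e * f e q)" unfolding s_def by (rule form_sum_left[OF sym SV(1) q])
      then have sq: "f s q = 0" by (simp add: qe)
      have "f b q = f r q + f s q"
        using form_lin_left[OF sym r s q, of 1 1] by (simp add: r_def)
      also have "\<dots> = sqrt (f r r)"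
        using sq form_sym[OF sym r q] fq[OF r] rr by (simp add: real_div_sqrt)
      finally have "f b q * q x = r x" for x using rr by (simp add: q_def)
      then have "b x = f b q * q x + s x" for x by (simp add: r_def)
      then show ?thesis using qS SV by (simp add: fun_eq_iff s_def)
    qed
    ultimately show ?thesis using S' by blast
  qed
qed

end

locale finite_dim_function_space = function_space +
  assumes finite_spanning: "\<exists>B. finite B \<and> B \<subseteq> V \<and> (\<forall>v\<in>V. \<exists>c. v = (\<lambda>x. \<Sum>b\<in>B. c b * b x))"
begin

lemma orthonormal_basis:
  assumes f: "pos_def_form f"
  obtains S where "orthonormal f S" "\<And>v. v \<in> V \<Longrightarrow> v = (\<lambda>x. \<Sum>e\<in>S. f v e * e x)"
proof -
  have sym: "symmetric_form f" using f unfolding pos_def_form_def by blast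
  obtain B where B: "finite B" "B \<subseteq> V" "\<And>v. v \<in> V \<Longrightarrow> \<exists>c. v = (\<lambda>x. \<Sum>b\<in>B. c b * b x)"
    using finite_spanning by blast
  obtain S where S: "orthonormal f S" "\<And>b. b \<in> B \<Longrightarrow> b = (\<lambda>x. \<Sum>e\<in>S. f b e * e x)"
    using Gram_Schmidt[OF f B(1,2)] by blast
  have SV: "S \<subseteq> V" using S(1) unfolding orthonormal_def by blast
  have "v = (\<lambda>x. \<Sum>e\<in>S. f v e * e x)" if v: "v \<in> V" for v
  proof
    fix x
    obtain c where c: "v = (\<lambda>x. \<Sum>b\<in>B. c b * b x)" using B(3)[OF v] by blast
    have "v x = (\<Sum>b\<in>B. c b * (\<Sum>e\<in>S. f b e * e x))"
      using S(2) by (subst c) (intro sum.cong refl arg_cong2[where f="(*)"], metis)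
    also have "\<dots> = (\<Sum>e\<in>S. (\<Sum>b\<in>B. c b * f b e) * e x)"
      unfolding sum_distrib_left sum_distrib_right by (subst sum.swap) (simp add: mult_ac)
    also have "\<dots> = (\<Sum>e\<in>S. f v e * e x)"
      using form_sum_left[OF sym B(2)] SV unfolding c by (intro sum.cong) (auto simp: subset_iff)
    finally show "v x = (\<Sum>e\<in>S. f v e * e x)" .
  qed
  then show ?thesis using S(1) that by blast
qed

text \<open>Existence and uniqueness form one statement because the operators of the method are
  definite descriptions. The representer has the coefficients \<open>L e\<close> in an orthonormal
  basis.\<close>

lemma Riesz_representation:
  assumes f: "pos_def_form f" and L: "linear_functional L"
  shows "\<exists>!w. w \<in> V \<and> (\<forall>v\<in>V. f w v = L v)"
proof -
  have sym: "symmetric_form f" using f unfolding pos_def_form_def by blast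
  obtain S where S: "orthonormal f S" "\<And>v. v \<in> V \<Longrightarrow> v = (\<lambda>x. \<Sum>e\<in>S. f v e * e x)"
    using orthonormal_basis[OF f] by blast
  have SV: "S \<subseteq> V" using S(1) unfolding orthonormal_def by blast
  define w where "w = (\<lambda>x. \<Sum>e\<in>S. L e * e x)"
  have w: "w \<in> V" unfolding w_def using SV by (intro sum_mem) auto
  have "f w v = L v" if v: "v \<in> V" for v
  proof -
    have "f w v = (\<Sum>e\<in>S. L e * f e v)" unfolding w_def by (rule form_sum_left[OF sym SV v])
    also have "\<dots> = (\<Sum>e\<in>S. f v e * L e)"
      using SV form_sym[OF sym v] by (intro sum.cong) auto
    also have "\<dots> = L (\<lambda>x. \<Sum>e\<in>S. f v e * e x)"
      using SV by (intro linear_functional_sum[OF L, symmetric]) auto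
    finally show ?thesis using S(2)[OF v] by metis
  qed
  then have ex: "w \<in> V \<and> (\<forall>v\<in>V. f w v = L v)" using w by blast
  have uniq: "w' = w''" if w': "w' \<in> V" "w'' \<in> V" and eq: "\<forall>v\<in>V. f w' v = f w'' v" for w' w''
  proof (rule ccontr)
    assume "w' \<noteq> w''"
    then have "(\<lambda>x. w' x - w'' x) \<noteq> (\<lambda>x. 0)" by (auto simp: fun_eq_iff)
    moreover have "f (\<lambda>x. w' x - w'' x) (\<lambda>x. w' x - w'' x) = 0"
      using form_lin_left[OF sym w' diff_mem[OF w'], of 1 "-1"] eq diff_mem[OF w'] by simp
    ultimately show False using f diff_mem[OF w'] unfolding pos_def_form_def by force
  qed
  show ?thesis
  proof (rule ex1I[where a=w])
    show "w \<in> V \<and> (\<forall>v\<in>V. f w v = L v)" by (rule ex)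
  next
    fix w' assume w': "w' \<in> V \<and> (\<forall>v\<in>V. f w' v = L v)"
    show "w' = w"
    proof (rule uniq)
      show "w' \<in> V" using w' by (rule conjunct1)
      show "w \<in> V" by (rule w)
      show "\<forall>v\<in>V. f w' v = f w v"
      proof
        fix v assume "v \<in> V"
        then have "f w' v = L v" "f w v = L v" using w' ex by blast+
        then show "f w' v = f w v" by simp
      qed
    qed
  qed
qed

text \<open>A maximiser of the Rayleigh quotient is an eigenvector, because it lies in the kernel of the
  positive semidefinite form \<open>M f - g\<close>, where \<open>M\<close> is the maximum.\<close>

lemma Rayleigh_bound:
  assumes f: "pos_def_form f" and g: "symmetric_form g"
    and eigen: "\<And>c v. v \<in> V \<Longrightarrow> v \<noteq> (\<lambda>x. 0) \<Longrightarrow> (\<forall>w\<in>V. g v w = c * f v w) \<Longrightarrow> c \<le> M"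
    and v: "v \<in> V"
  shows "g v v \<le> M * f v v"
proof (cases "v = (\<lambda>x. 0)")
  case True
  have "symmetric_form f" using f unfolding pos_def_form_def by (rule conjunct1)
  then have "g v v = 0" "f v v = 0"
    using form_zero_left[OF g zero_mem] form_zero_left[OF _ zero_mem] unfolding True by auto
  then show ?thesis by simp
next
  case False
  have sym: "symmetric_form f" using f unfolding pos_def_form_def by blast
  obtain S where S: "orthonormal f S" "\<And>v. v \<in> V \<Longrightarrow> v = (\<lambda>x. \<Sum>e\<in>S. f v e * e x)"
    using orthonormal_basis[OF f] by blast
  have SV: "S \<subseteq> V" "finite S" using S(1) unfolding orthonormal_def by auto
  define comb where "comb c = (\<lambda>x. \<Sum>e\<in>S. c e * e x)" for c :: "('a \<Rightarrow> real) \<Rightarrow> real"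
  have comb: "comb c \<in> V" for c unfolding comb_def using SV by (intro sum_mem) auto
  \<comment> \<open>\<open>K\<close> is the unit sphere of the coefficient space. A coefficient
    vector is a total function pinned to zero off \<open>S\<close>, so that \<open>K\<close> is a
    closed part of a product of compact sets.\<close>
  define K where "K = PiE UNIV (\<lambda>e. if e \<in> S then {-1..1::real} else {0}) \<inter> {c. (\<Sum>e\<in>S. (c e)\<^sup>2) = 1}"
  have ff: "f (comb c) (comb c) = (\<Sum>e\<in>S. (c e)\<^sup>2)" for c
  proof -
    have "f (comb c) (comb c) = (\<Sum>e\<in>S. c e * f e (comb c))"
      using form_sum_left[OF sym SV(1) comb] unfolding comb_def by blast
    also have "\<dots> = (\<Sum>e\<in>S. (c e)\<^sup>2)"
      using orthonormal_coeff[OF sym S(1), of _ c] form_sym[OF sym comb] SV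
      by (intro sum.cong) (auto simp: comb_def power2_eq_square subset_iff)
    finally show ?thesis .
  qed
  have gg: "g (comb c) (comb c) = (\<Sum>e\<in>S. c e * (\<Sum>d\<in>S. c d * g d e))" for c
  proof -
    have "g (comb c) (comb c) = (\<Sum>e\<in>S. c e * g e (comb c))"
      using form_sum_left[OF g SV(1) comb] unfolding comb_def by blast
    also have "\<dots> = (\<Sum>e\<in>S. c e * g (comb c) e)"
      using form_sym[OF g comb] SV by (intro sum.cong) auto
    also have "\<dots> = (\<Sum>e\<in>S. c e * (\<Sum>d\<in>S. c d * g d e))"
      using form_sum_left[OF g SV(1)] SV unfolding comb_def by (intro sum.cong) auto
    finally show ?thesis .
  qed
  have coord: "continuous_on A (\<lambda>c. c e)" for A and e :: "'a \<Rightarrow> real"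
    by (rule continuous_on_subset[OF continuous_on_product_coordinates]) simp
  have "compactin (product_topology (\<lambda>_. euclidean) UNIV) (PiE UNIV (\<lambda>e. if e \<in> S then {-1..1::real} else {0}))"
    by (subst compactin_PiE) auto
  then have "compact (PiE UNIV (\<lambda>e. if e \<in> S then {-1..1::real} else {0}))"
    by (simp add: euclidean_product_topology)
  moreover have "closed {c :: ('a \<Rightarrow> real) \<Rightarrow> real. (\<Sum>e\<in>S. (c e)\<^sup>2) = 1}"
    by (intro closed_Collect_eq continuous_intros coord)
  ultimately have K: "compact K" unfolding K_def by (rule compact_Int_closed)
  have unit: "\<exists>c\<in>K. w = (\<lambda>x. sqrt (f w w) * comb c x)" if w: "w \<in> V" "w \<noteq> (\<lambda>x. 0)" for w
  proof -
    have ww: "f w w > 0" using w f unfolding pos_def_form_def by blast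
    define c where "c e = (if e \<in> S then f w e / sqrt (f w w) else 0)" for e
    have eq: "w = (\<lambda>x. sqrt (f w w) * comb c x)"
    proof
      fix x
      have "w x = (\<Sum>e\<in>S. f w e * e x)" using S(2)[OF w(1)] by metis
      also have "\<dots> = sqrt (f w w) * comb c x"
        using ww by (simp add: comb_def c_def sum_distrib_left)
      finally show "w x = sqrt (f w w) * comb c x" .
    qed
    have "f w w = (sqrt (f w w))\<^sup>2 * f (comb c) (comb c)"
      using form_quadratic[OF sym comb comb, of "sqrt (f w w)" c 0 c] eq by simp
    then have sum1: "(\<Sum>e\<in>S. (c e)\<^sup>2) = 1" using ww ff by simp
    have "\<bar>c e\<bar> \<le> 1" if "e \<in> S" for e
      using member_le_sum[of e S "\<lambda>e. (c e)\<^sup>2"] that SV sum1 by (simp add: abs_square_le_1)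
    moreover have "c e = 0" if "e \<notin> S" for e using that by (simp add: c_def)
    ultimately have "c \<in> K" unfolding K_def using sum1 by (auto simp: abs_le_iff)
    then show ?thesis using eq by blast
  qed
  have "K \<noteq> {}" using unit[OF v False] by blast
  moreover have "continuous_on K (\<lambda>c. \<Sum>e\<in>S. c e * (\<Sum>d\<in>S. c d * g d e))"
    by (intro continuous_intros coord)
  ultimately obtain c where c: "c \<in> K" and
    max: "\<And>d. d \<in> K \<Longrightarrow> g (comb d) (comb d) \<le> g (comb c) (comb c)"
    using continuous_attains_sup[OF K] unfolding gg by blast
  define m where "m = g (comb c) (comb c)"
  have bound: "g w w \<le> m * f w w" if w: "w \<in> V" for w
  proof (cases "w = (\<lambda>x. 0)")
    case True
    then show ?thesis using form_zero_left[OF g w] form_zero_left[OF sym w] by simp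
  next
    case nz: False
    then have "f w w > 0" using w f unfolding pos_def_form_def by blast
    moreover obtain d where d: "d \<in> K" "w = (\<lambda>x. sqrt (f w w) * comb d x)" using unit[OF w nz] by blast
    then have "g w w = (sqrt (f w w))\<^sup>2 * g (comb d) (comb d)"
      using form_quadratic[OF g comb comb, of "sqrt (f w w)" d 0 d] by simp
    ultimately show ?thesis using max[OF d(1)] by (simp add: m_def mult.commute)
  qed
  have c1: "f (comb c) (comb c) = 1" using c ff unfolding K_def by simp
  have "m * f (comb c) w - g (comb c) w = 0" if w: "w \<in> V" for w
  proof -
    have "(m * f (comb c) w - g (comb c) w)\<^sup>2
        \<le> (m * f (comb c) (comb c) - g (comb c) (comb c)) * (m * f w w - g w w)"
      by (rule Cauchy_Schwarz_form[OF symmetric_form_diff[OF sym g] _ comb w]) (simp add: bound)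
    then show ?thesis by (simp add: c1 m_def)
  qed
  then have "\<forall>w\<in>V. g (comb c) w = m * f (comb c) w" by simp
  moreover have "comb c \<noteq> (\<lambda>x. 0)"
  proof
    assume eq: "comb c = (\<lambda>x. 0)"
    show False using c1 form_zero_left[OF sym zero_mem] unfolding eq by simp
  qed
  ultimately have "m \<le> M" by (intro eigen[OF comb])
  moreover have "f v v > 0" using False v f unfolding pos_def_form_def by blast
  ultimately have "m * f v v \<le> M * f v v" by (intro mult_right_mono) auto
  then show ?thesis using bound[OF v] by linarith
qed

end

section \<open>Piecewise smooth functions\<close>

lemma grad_eqI:
  assumes "(f has_derivative f') (at x)"
  shows "grad f x = (\<chi> i. f' (axis i 1))"
  unfolding grad_def using frechet_derivative_at[OF assms] by simp

lemma has_derivative_grad: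
  assumes "f differentiable at x"
  shows "(f has_derivative (\<lambda>h. grad f x \<bullet> h)) (at x)"
proof -
  let ?D = "frechet_derivative f (at x)"
  have D: "(f has_derivative ?D) (at x)" using assms frechet_derivative_works by blast
  then have lin: "linear ?D" by (rule has_derivative_linear)
  have "?D h = grad f x \<bullet> h" for h
  proof -
    have "?D h = ?D (\<Sum>i\<in>UNIV. h $ i *\<^sub>R axis i 1)"
      using basis_expansion[of h] by (simp add: scalar_mult_eq_scaleR)
    also have "\<dots> = (\<Sum>i\<in>UNIV. h $ i * ?D (axis i 1))"
      by (simp add: linear_sum[OF lin] linear_scale[OF lin])
    finally show ?thesis by (simp add: grad_def inner_vec_def mult.commute)
  qed
  then show ?thesis using D by presburger
qed

text \<open>\<open>grad\<close> at a point sees only a neighbourhood, so on an open element a DG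
  function has the gradient of its polynomial.\<close>

lemma grad_cong_open:
  assumes "f differentiable at x" "open S" "x \<in> S" "\<And>y. y \<in> S \<Longrightarrow> g y = f y"
  shows "grad g x = grad f x"
  using frechet_derivative_transform_within_open[OF assms(1-3), of g] assms(4)
  unfolding grad_def by simp

lemma grad_lin:
  assumes "f differentiable at x" "g differentiable at x"
  shows "grad (\<lambda>y. a * f y + b * g y) x = a *\<^sub>R grad f x + b *\<^sub>R grad g x"
proof -
  have "((\<lambda>y. a * f y + b * g y) has_derivative
      (\<lambda>h. a * (grad f x \<bullet> h) + b * (grad g x \<bullet> h))) (at x)"
    by (intro derivative_intros has_derivative_grad assms)
  then show ?thesis by (simp add: grad_eqI vec_eq_iff inner_axis)
qed

text \<open>This is what integrals and traces use of a polynomial: each elementwise piece extends to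
  a C1 function on the whole space, and its traces are values of the extension and of its
  gradient.\<close>

definition C1 :: "(real^'n \<Rightarrow> real) \<Rightarrow> bool" where
  "C1 f \<longleftrightarrow> (\<forall>x. f differentiable at x) \<and> continuous_on UNIV (grad f)"

lemma C1_continuous: "C1 f \<Longrightarrow> continuous_on A f"
  unfolding C1_def
  by (intro continuous_at_imp_continuous_on) (auto intro: differentiable_imp_continuous_within)

lemma C1I:
  assumes "\<And>x. (f has_derivative (\<lambda>h. g x \<bullet> h)) (at x)" "continuous_on UNIV g"
  shows "C1 f"
proof -
  have "grad f x = g x" for x
    using grad_eqI[OF assms(1), of x] by (simp add: vec_eq_iff inner_axis)
  then have "grad f = g" by auto
  then show ?thesis using assms unfolding C1_def differentiable_def by auto
qed

lemma C1_const: "C1 (\<lambda>x. c)"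
  by (rule C1I[of _ "\<lambda>x. 0"]) auto

lemma C1_coordinate: "C1 (\<lambda>x. x $ i)"
  by (rule C1I[of _ "\<lambda>x. axis i 1"]) (auto simp: inner_axis' intro!: derivative_eq_intros bounded_linear_imp_has_derivative bounded_linear_vec_nth)

lemma C1_lin:
  assumes "C1 f" "C1 g"
  shows "C1 (\<lambda>x. a * f x + b * g x)"
proof -
  have "grad (\<lambda>x. a * f x + b * g x) = (\<lambda>x. a *\<^sub>R grad f x + b *\<^sub>R grad g x)"
    using grad_lin assms unfolding C1_def by blast
  then show ?thesis using assms unfolding C1_def by (auto intro!: continuous_intros derivative_intros)
qed

lemma C1_mult:
  assumes "C1 f" "C1 g"
  shows "C1 (\<lambda>x. f x * g x)"
proof (rule C1I[where g = "\<lambda>x. f x *\<^sub>R grad g x + g x *\<^sub>R grad f x"])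
  show "((\<lambda>x. f x * g x) has_derivative (\<lambda>h. (f x *\<^sub>R grad g x + g x *\<^sub>R grad f x) \<bullet> h)) (at x)" for x
    using has_derivative_mult[OF has_derivative_grad has_derivative_grad, of f x g] assms
    unfolding C1_def by (simp add: algebra_simps)
  show "continuous_on UNIV (\<lambda>x. f x *\<^sub>R grad g x + g x *\<^sub>R grad f x)"
    using assms C1_continuous[of f UNIV] C1_continuous[of g UNIV] unfolding C1_def
    by (intro continuous_intros) auto
qed

lemma C1_sum: "(\<And>i. i \<in> I \<Longrightarrow> C1 (f i)) \<Longrightarrow> C1 (\<lambda>x. \<Sum>i\<in>I. f i x)"
proof (induction I rule: infinite_finite_induct)
  case (insert i I)
  then show ?case using C1_lin[of "f i" "\<lambda>x. \<Sum>i\<in>I. f i x" 1 1] by simp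
qed (simp_all add: C1_const)

lemma C1_prod: "(\<And>i. i \<in> I \<Longrightarrow> C1 (f i)) \<Longrightarrow> C1 (\<lambda>x. \<Prod>i\<in>I. f i x)"
  by (induction I rule: infinite_finite_induct) (simp_all add: C1_const C1_mult)

lemma C1_power: "C1 f \<Longrightarrow> C1 (\<lambda>x. f x ^ m)"
  by (induction m) (simp_all add: C1_const C1_mult)

section \<open>Polynomials of bounded total degree\<close>

definition monomial :: "('n::finite \<Rightarrow> nat) \<Rightarrow> real^'n \<Rightarrow> real" where
  "monomial \<alpha> x = (\<Prod>i\<in>UNIV. (x $ i) ^ \<alpha> i)"

lemma C1_monomial: "C1 (monomial \<alpha>)"
  unfolding monomial_def by (intro C1_prod C1_power C1_coordinate)

lemma polynomial_of_degree_alt: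
  "polynomial_of_degree p q \<longleftrightarrow> (\<exists>c. q = (\<lambda>x. \<Sum>\<alpha> | sum \<alpha> UNIV \<le> p. c \<alpha> * monomial \<alpha> x))"
  unfolding polynomial_of_degree_def monomial_def ..

lemma C1_polynomial: "polynomial_of_degree p q \<Longrightarrow> C1 q"
  unfolding polynomial_of_degree_alt by (auto intro!: C1_sum C1_mult C1_const C1_monomial)

lemma finite_multi_indices: "finite {\<alpha> :: 'n::finite \<Rightarrow> nat. sum \<alpha> UNIV \<le> p}"
proof (rule finite_subset)
  show "{\<alpha> :: 'n \<Rightarrow> nat. sum \<alpha> UNIV \<le> p} \<subseteq> PiE UNIV (\<lambda>_. {..p})"
  proof
    fix \<alpha> :: "'n \<Rightarrow> nat" assume "\<alpha> \<in> {\<alpha>. sum \<alpha> UNIV \<le> p}"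
    then have "\<alpha> i \<le> p" for i using member_le_sum[of i UNIV \<alpha>] by simp
    then show "\<alpha> \<in> PiE UNIV (\<lambda>_. {..p})" by (simp add: PiE_UNIV_domain)
  qed
  show "finite (PiE (UNIV :: 'n set) (\<lambda>_. {..p}))" by (intro finite_PiE) auto
qed

lemma polynomial_of_degree_lin:
  assumes "polynomial_of_degree p q" "polynomial_of_degree p r"
  shows "polynomial_of_degree p (\<lambda>x. a * q x + b * r x)"
proof -
  obtain c d where "q = (\<lambda>x. \<Sum>\<alpha> | sum \<alpha> UNIV \<le> p. c \<alpha> * monomial \<alpha> x)"
    "r = (\<lambda>x. \<Sum>\<alpha> | sum \<alpha> UNIV \<le> p. d \<alpha> * monomial \<alpha> x)"
    using assms unfolding polynomial_of_degree_alt by blast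
  then have "(\<lambda>x. a * q x + b * r x) =
      (\<lambda>x. \<Sum>\<alpha> | sum \<alpha> UNIV \<le> p. (a * c \<alpha> + b * d \<alpha>) * monomial \<alpha> x)"
    by (simp add: sum_distrib_left sum.distrib algebra_simps)
  then show ?thesis unfolding polynomial_of_degree_alt by (rule exI[of _ "\<lambda>\<alpha>. a * c \<alpha> + b * d \<alpha>"])
qed

lemma polynomial_of_degree_zero: "polynomial_of_degree p (\<lambda>x. 0)"
  unfolding polynomial_of_degree_def by (rule exI[of _ "\<lambda>_. 0"]) simp

lemma polynomial_of_degree_mono:
  assumes "polynomial_of_degree p q" "p \<le> p'"
  shows "polynomial_of_degree p' q"
proof -
  obtain c where c: "q = (\<lambda>x. \<Sum>\<alpha> | sum \<alpha> UNIV \<le> p. c \<alpha> * monomial \<alpha> x)"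
    using assms unfolding polynomial_of_degree_alt by blast
  have "q x = (\<Sum>\<alpha> | sum \<alpha> UNIV \<le> p'. (if sum \<alpha> UNIV \<le> p then c \<alpha> else 0) * monomial \<alpha> x)" for x
    unfolding c using assms(2) by (intro sum.mono_neutral_cong_left finite_multi_indices) auto
  then show ?thesis unfolding polynomial_of_degree_alt
    by (intro exI[of _ "\<lambda>\<alpha>. if sum \<alpha> UNIV \<le> p then c \<alpha> else 0"]) (rule ext)
qed

section \<open>Integrals and boundary traces of continuous functions\<close>

lemma set_integrable_continuous_bounded:
  fixes g :: "real^'n \<Rightarrow> 'b::euclidean_space"
  assumes "continuous_on UNIV g" "bounded S" "S \<in> sets lebesgue"
  shows "set_integrable lebesgue S g"
proof -
  obtain a where a: "S \<subseteq> cbox (-a) a" using bounded_subset_cbox_symmetric[OF assms(2)] by blast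
  have "set_integrable lebesgue (cbox (-a) a) g"
    by (rule absolutely_integrable_continuous) (rule continuous_on_subset[OF assms(1)], simp)
  then show ?thesis by (rule set_integrable_subset) (use a assms in auto)
qed

text \<open>The points of \<open>S\<close> where \<open>g\<close> is nonzero form an open set, and
  it is null because the integral of a nonnegative function vanishes; an open null set is
  empty.\<close>

lemma set_integral_zero_continuous:
  assumes "continuous_on UNIV g" "bounded S" "open S" "\<And>x. x \<in> S \<Longrightarrow> g x \<ge> (0::real)"
    and zero: "(LINT x:S|lebesgue. g x) \<le> 0" and x: "x \<in> S"
  shows "g (x :: real^'n) = 0"
proof (rule ccontr)
  assume nz: "g x \<noteq> 0"
  have int: "integrable lebesgue (\<lambda>x. indicator S x *\<^sub>R g x)"
    using set_integrable_continuous_bounded[OF assms(1,2)] \<open>open S\<close> unfolding set_integrable_def by auto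
  have nonneg: "indicator S x *\<^sub>R g x \<ge> 0" for x using assms(4) by (auto simp: indicator_def)
  have "(LINT x|lebesgue. indicator S x *\<^sub>R g x) = 0"
    using zero Bochner_Integration.integral_nonneg[of lebesgue "\<lambda>x. indicator S x *\<^sub>R g x"] nonneg
    unfolding set_lebesgue_integral_def by (simp add: eq_iff)
  then have "AE x in lebesgue. indicator S x *\<^sub>R g x = 0"
    using integral_nonneg_eq_0_iff_AE[OF int] nonneg by simp
  then have "AE x in lebesgue. x \<notin> S \<inter> g -` (- {0})"
    by eventually_elim (auto simp: indicator_def)
  moreover have op: "open (S \<inter> g -` (- {0}))"
    using assms(1,3) by (intro open_Int open_vimage) auto
  ultimately have "S \<inter> g -` (- {0}) \<in> null_sets lebesgue"
    by (subst AE_iff_null_sets) auto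
  then have "S \<inter> g -` (- {0}) = {}"
    using open_not_negligible[OF op] unfolding negligible_iff_null_sets by blast
  then show False using x nz by auto
qed

text \<open>Near \<open>x\<close> the function \<open>g\<close> oscillates by less than any given
  bound, so its averages over the part of \<open>\<kappa>\<close> in a small ball tend to
  \<open>g x\<close>.\<close>

lemma bdry_trace_continuous:
  fixes g :: "real^'n \<Rightarrow> 'b::euclidean_space"
  assumes g: "continuous_on UNIV g" and \<kappa>: "open \<kappa>" "bounded \<kappa>" and x: "x \<in> closure \<kappa>"
    and eq: "\<And>y. y \<in> \<kappa> \<Longrightarrow> w y = g y"
  shows "bdry_trace \<kappa> w x = g x"
proof -
  define avg where "avg r = (1 / measure lebesgue (\<kappa> \<inter> ball x r)) *\<^sub>R (LINT y:\<kappa> \<inter> ball x r|lebesgue. w y)" for r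
  have "(avg \<longlongrightarrow> g x) (at_right 0)"
  proof (rule tendstoI)
    fix e :: real assume e: "e > 0"
    have "isCont g x" using g continuous_on_eq_continuous_at by blast
    then obtain d where d: "d > 0" "\<And>y. dist y x < d \<Longrightarrow> dist (g y) (g x) < e / 2"
      using e unfolding continuous_at_eps_delta by (metis half_gt_zero)
    have "dist (avg r) (g x) < e" if r: "0 < r" "r < d" for r
    proof -
      let ?S = "\<kappa> \<inter> ball x r"
      let ?M = "measure lebesgue ?S"
      have S: "open ?S" "bounded ?S" "?S \<in> sets lebesgue" using \<kappa> by auto
      obtain y where "y \<in> \<kappa>" "dist y x < r" using x r(1) unfolding closure_approachable by blast
      then have "?S \<noteq> {}" by (auto simp: dist_commute)
      then have "?S \<notin> null_sets lebesgue"
        using open_not_negligible[OF S(1)] unfolding negligible_iff_null_sets by blast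
      have fin: "emeasure lebesgue ?S < \<infinity>" using emeasure_bounded_finite[OF S(2)] S(1) by simp
      \<comment> \<open>The average has to be a genuine one: for measure zero the quotient
        \<open>1 / ?M\<close> would be 0. The set is open, and nonempty because \<open>x\<close>
        lies in the closure.\<close>
      have "?M \<noteq> 0"
      proof
        assume "?M = 0"
        then have "emeasure lebesgue ?S = 0" using emeasure_eq_ennreal_measure[of lebesgue ?S] fin by simp
        then show False using \<open>?S \<notin> null_sets lebesgue\<close> S(3) by (simp add: null_sets_def)
      qed
      then have M: "?M > 0" using measure_nonneg[of lebesgue ?S] by linarith
      have int: "set_integrable lebesgue ?S h" if "continuous_on UNIV h" for h :: "real^'n \<Rightarrow> 'c::euclidean_space"
        by (rule set_integrable_continuous_bounded[OF that S(2,3)])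
      have gi: "set_integrable lebesgue ?S g" by (rule int[OF g])
      have const: "(LINT y:?S|lebesgue. c) = ?M *\<^sub>R c" for c :: "'c::euclidean_space"
        using S fin by (simp add: set_lebesgue_integral_def)
      have "(LINT y:?S|lebesgue. w y) = (LINT y:?S|lebesgue. g y)"
        by (rule set_lebesgue_integral_cong) (use S eq in auto)
      then have "?M *\<^sub>R (avg r - g x) = (LINT y:?S|lebesgue. g y) - (LINT y:?S|lebesgue. g x)"
        using M by (simp add: avg_def const algebra_simps)
      also have "\<dots> = (LINT y:?S|lebesgue. g y - g x)"
        by (rule set_integral_diff(2)[symmetric]) (intro gi int continuous_intros)+
      finally have "norm (?M *\<^sub>R (avg r - g x)) = norm (LINT y:?S|lebesgue. g y - g x)" by simp
      also have "\<dots> \<le> (LINT y:?S|lebesgue. norm (g y - g x))"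
        by (rule set_integral_norm_bound) (intro int continuous_intros g)
      also have "\<dots> \<le> (LINT y:?S|lebesgue. e / 2)"
      proof (intro set_integral_mono int continuous_intros g)
        fix y assume "y \<in> ?S"
        then have "dist y x < d" using r by (simp add: dist_commute)
        then show "norm (g y - g x) \<le> e / 2" using d(2)[of y] by (simp add: dist_norm)
      qed
      finally have "?M * norm (avg r - g x) \<le> ?M * (e / 2)" using M by (simp add: const)
      then show ?thesis using M e by (simp add: dist_norm)
    qed
    then show "\<forall>\<^sub>F r in at_right 0. dist (avg r) (g x) < e"
      unfolding eventually_at_right_field using d(1) by blast
  qed
  then show ?thesis unfolding bdry_trace_def avg_def[symmetric] by (rule tendsto_Lim[rotated]) simp
qed

lemma polytopal_element_bounded: "polytopal_element \<kappa> \<Longrightarrow> bounded \<kappa>"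
  unfolding polytopal_element_def
  by (metis bounded_Union bounded_subset closure_subset polytope_imp_bounded)

section \<open>The measure on a face\<close>

lemma sets_face_measure [simp]: "sets (face_measure F) = sets borel"
  by (simp add: face_measure_def Let_def)

text \<open>The two choices hidden in \<open>face_measure\<close> receive names; with
  \<open>prism\<close> and \<open>face_proj\<close> the measure of a set becomes the volume of the
  part of the prism above it.\<close>

definition face_normal :: "(real^'n) set \<Rightarrow> real^'n" where
  "face_normal F = (SOME n. unit_normal F n)"

definition face_base :: "(real^'n) set \<Rightarrow> real^'n" where
  "face_base F = (SOME a. a \<in> F)"

definition prism :: "(real^'n) set \<Rightarrow> (real^'n) set" where
  "prism F = {x + t *\<^sub>R face_normal F | x t. x \<in> F \<and> t \<in> {0..1}}"

definition face_proj :: "(real^'n) set \<Rightarrow> real^'n \<Rightarrow> real^'n" where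
  "face_proj F y = y - (face_normal F \<bullet> (y - face_base F)) *\<^sub>R face_normal F"

lemma prism_eq_image: "prism F = (\<lambda>(x, t). x + t *\<^sub>R face_normal F) ` (F \<times> {0..1})"
  unfolding prism_def by auto blast

lemma compact_prism: "compact F \<Longrightarrow> compact (prism F)"
  unfolding prism_eq_image
  by (auto intro!: compact_continuous_image compact_Times continuous_intros simp: case_prod_beta)

lemma face_measure_alt:
  "face_measure F = distr (restrict_space lborel (prism F)) borel (face_proj F)"
  unfolding face_measure_def Let_def prism_def face_proj_def[abs_def] face_normal_def face_base_def ..

lemma face_proj_measurable: "face_proj F \<in> borel_measurable borel"
  unfolding face_proj_def[abs_def]
  by (intro borel_measurable_continuous_onI continuous_intros)

lemma emeasure_face_measure:
  assumes "compact F" "A \<in> sets borel"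
  shows "emeasure (face_measure F) A = emeasure lborel {y \<in> prism F. face_proj F y \<in> A}"
proof -
  have P: "prism F \<in> sets borel" using compact_prism[OF assms(1)] by (rule borel_compact)
  have "face_proj F \<in> restrict_space lborel (prism F) \<rightarrow>\<^sub>M borel"
    by (rule measurable_restrict_space1) (use face_proj_measurable in simp)
  then have "emeasure (face_measure F) A =
      emeasure (restrict_space lborel (prism F)) (face_proj F -` A \<inter> prism F)"
    using assms(2) by (simp add: face_measure_alt emeasure_distr space_restrict_space)
  also have "\<dots> = emeasure lborel (face_proj F -` A \<inter> prism F)"
    by (rule emeasure_restrict_space) (use P in auto)
  finally show ?thesis by (simp add: vimage_def Int_def conj_commute)
qed

text \<open>The prism is compact, as a continuous image of a product of compact sets, and so has
  finite volume.\<close>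

lemma emeasure_face_measure_finite:
  assumes "compact F"
  shows "emeasure (face_measure F) A < \<infinity>"
proof (cases "A \<in> sets borel")
  case True
  have "emeasure lborel {y \<in> prism F. face_proj F y \<in> A} \<le> emeasure lborel (prism F)"
    using compact_prism[OF assms] by (intro emeasure_mono) (auto simp: borel_compact)
  also have "\<dots> < \<infinity>" by (rule emeasure_compact_finite[OF compact_prism[OF assms]])
  finally show ?thesis using emeasure_face_measure[OF assms True] by simp
qed (simp add: emeasure_notin_sets)

lemma set_integrable_face_measure:
  fixes g :: "real^'n \<Rightarrow> real"
  assumes F: "compact F" and g: "continuous_on F g"
  shows "set_integrable (face_measure F) F g"
proof -
  obtain B where B: "\<And>x. x \<in> F \<Longrightarrow> norm (g x) \<le> B"
    using compact_imp_bounded[OF compact_continuous_image[OF g F]] by (auto simp: bounded_iff)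
  have FB: "F \<in> sets borel" using F by (simp add: borel_compact)
  have "integrable (face_measure F) (\<lambda>x. indicator F x *\<^sub>R B)"
    using emeasure_face_measure_finite[OF F, of F] FB by simp
  moreover have "(\<lambda>x. indicator F x *\<^sub>R g x) \<in> borel_measurable (face_measure F)"
    using borel_measurable_continuous_on_indicator[OF FB g] measurable_cong_sets[OF sets_face_measure refl] by blast
  ultimately show ?thesis
    unfolding set_integrable_def
    by (rule Bochner_Integration.integrable_bound) (use B in \<open>force simp: indicator_def\<close>)
qed

section \<open>The discontinuous Galerkin space\<close>

locale dg_level =
  fixes \<Omega> :: "(real^'n) set" and D :: "'n discretization" and C\<sigma> :: "nat \<Rightarrow> real" and j :: nat
  assumes domain: "convex_polytopal_domain \<Omega>"
    and is_mesh: "is_mesh \<Omega> (mesh D j)"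
    and is_face_set: "is_face_set \<Omega> (mesh D j) (faces D j)"
begin

abbreviation "V \<equiv> dg_space \<Omega> D j"
abbreviation "T \<equiv> mesh D j"
abbreviation "\<F> \<equiv> faces D j"
abbreviation "\<A> \<equiv> dg_form C\<sigma> D j"

lemma finite_mesh: "finite T" and disjoint_mesh: "pairwise disjnt T"
  and closure_mesh: "closure \<Omega> = (\<Union>\<kappa>\<in>T. closure \<kappa>)"
  using is_mesh unfolding is_mesh_def by blast+

lemma element:
  assumes "\<kappa> \<in> T"
  shows "open \<kappa>" "\<kappa> \<noteq> {}" "connected \<kappa>" "bounded \<kappa>" "interior (closure \<kappa>) = \<kappa>"
proof -
  have "polytopal_element \<kappa>" using is_mesh assms unfolding is_mesh_def by blast
  then show "open \<kappa>" "\<kappa> \<noteq> {}" "connected \<kappa>" "bounded \<kappa>" "interior (closure \<kappa>) = \<kappa>"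
    using polytopal_element_bounded unfolding polytopal_element_def by blast+
qed

lemma element_unique: "\<kappa> \<in> T \<Longrightarrow> \<kappa>' \<in> T \<Longrightarrow> x \<in> \<kappa> \<Longrightarrow> x \<in> \<kappa>' \<Longrightarrow> \<kappa> = \<kappa>'"
  using disjoint_mesh unfolding pairwise_def disjnt_def by blast

text \<open>An element is an open subset of the closure of \<open>\<Omega>\<close>, and a convex
  open set is the interior of its closure.\<close>

lemma element_subset:
  assumes "\<kappa> \<in> T"
  shows "\<kappa> \<subseteq> \<Omega>"
proof -
  have "\<kappa> \<subseteq> closure \<Omega>" unfolding closure_mesh using assms closure_subset by blast
  then have "\<kappa> \<subseteq> interior (closure \<Omega>)" using element(1)[OF assms] by (rule interior_maximal)
  also have "\<dots> = \<Omega>" using domain convex_interior_closure interior_open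
    unfolding convex_polytopal_domain_def by blast
  finally show ?thesis .
qed

lemma sets_domain: "\<Omega> \<in> sets lebesgue"
  using domain unfolding convex_polytopal_domain_def by auto

lemma sets_element: "\<kappa> \<in> T \<Longrightarrow> \<kappa> \<in> sets lebesgue"
  using element(1) by auto

text \<open>The representatives vanish off the open elements, so integrability over the whole space
  reduces to finitely many bounded sets.\<close>

lemma integrable_piecewise:
  fixes f :: "real^'n \<Rightarrow> real"
  assumes piece: "\<And>\<kappa>. \<kappa> \<in> T \<Longrightarrow> \<exists>g. continuous_on UNIV g \<and> (\<forall>x\<in>\<kappa>. f x = g x)"
    and zero: "\<And>x. x \<notin> \<Union>T \<Longrightarrow> f x = 0"
  shows "integrable lebesgue f"
proof -
  have "set_integrable lebesgue \<kappa> f" if \<kappa>: "\<kappa> \<in> T" for \<kappa>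
  proof -
    obtain g where g: "continuous_on UNIV g" "\<forall>x\<in>\<kappa>. f x = g x" using piece[OF \<kappa>] by blast
    have "set_integrable lebesgue \<kappa> g"
      by (rule set_integrable_continuous_bounded[OF g(1) element(4)[OF \<kappa>] sets_element[OF \<kappa>]])
    then show ?thesis using g(2) set_integrable_cong[of lebesgue lebesgue \<kappa> \<kappa> f g] by auto
  qed
  then have "set_integrable lebesgue (\<Union>\<kappa>\<in>T. \<kappa>) f"
    by (intro set_integrable_UN finite_mesh sets_element)
  moreover have "(\<lambda>x. indicator (\<Union>\<kappa>\<in>T. \<kappa>) x *\<^sub>R f x) = f"
  proof
    show "indicator (\<Union>\<kappa>\<in>T. \<kappa>) x *\<^sub>R f x = f x" for x
      using zero[of x] by (cases "x \<in> \<Union>T") auto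
  qed
  ultimately show ?thesis unfolding set_integrable_def by simp
qed

lemma L2_piecewise:
  fixes f :: "real^'n \<Rightarrow> real"
  assumes piece: "\<And>\<kappa>. \<kappa> \<in> T \<Longrightarrow> \<exists>g. continuous_on UNIV g \<and> (\<forall>x\<in>\<kappa>. f x = g x)"
    and zero: "\<And>x. x \<notin> \<Union>T \<Longrightarrow> f x = 0"
  shows "L2 \<Omega> f"
proof -
  have "integrable lebesgue f" by (rule integrable_piecewise[OF assms])
  then have "set_borel_measurable lebesgue \<Omega> f"
    unfolding set_borel_measurable_def using sets_domain by simp
  moreover have "integrable lebesgue (\<lambda>x. (norm (f x))\<^sup>2)"
  proof (rule integrable_piecewise)
    fix \<kappa> assume "\<kappa> \<in> T"
    then obtain g where "continuous_on UNIV g" "\<forall>x\<in>\<kappa>. f x = g x" using piece by blast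
    then show "\<exists>g. continuous_on UNIV g \<and> (\<forall>x\<in>\<kappa>. (norm (f x))\<^sup>2 = g x)"
      by (intro exI[of _ "\<lambda>x. (norm (g x))\<^sup>2"]) (auto intro!: continuous_intros)
  qed (simp add: zero)
  then have "set_integrable lebesgue \<Omega> (\<lambda>x. (norm (f x))\<^sup>2)"
    unfolding set_integrable_def using sets_domain by (intro integrable_mult_indicator)
  ultimately show ?thesis unfolding L2_def by blast
qed

lemma dg_space_iff:
  "v \<in> V \<longleftrightarrow> (\<forall>\<kappa>\<in>T. \<exists>q. polynomial_of_degree (deg D j) q \<and> (\<forall>x\<in>\<kappa>. v x = q x)) \<and>
     (\<forall>x. x \<notin> \<Union>T \<longrightarrow> v x = 0)"
proof
  assume R: "(\<forall>\<kappa>\<in>T. \<exists>q. polynomial_of_degree (deg D j) q \<and> (\<forall>x\<in>\<kappa>. v x = q x)) \<and>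
     (\<forall>x. x \<notin> \<Union>T \<longrightarrow> v x = 0)"
  have "L2 \<Omega> v"
  proof (rule L2_piecewise)
    fix \<kappa> assume "\<kappa> \<in> T"
    then obtain q where "polynomial_of_degree (deg D j) q" "\<forall>x\<in>\<kappa>. v x = q x" using R by blast
    then show "\<exists>g. continuous_on UNIV g \<and> (\<forall>x\<in>\<kappa>. v x = g x)"
      using C1_continuous[OF C1_polynomial] by blast
  qed (use R in blast)
  then show "v \<in> V" unfolding dg_space_def using R by blast
qed (simp add: dg_space_def)

lemma dg_space_piece:
  assumes "v \<in> V" "\<kappa> \<in> T"
  shows "\<exists>q. C1 q \<and> (\<forall>x\<in>\<kappa>. v x = q x)"
  using assms C1_polynomial unfolding dg_space_iff by blast

lemma dg_space_outside: "v \<in> V \<Longrightarrow> x \<notin> \<Union>T \<Longrightarrow> v x = 0"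
  unfolding dg_space_iff by blast

section \<open>A finite spanning set of the DG space\<close>

definition basis_function :: "(real^'n) set \<Rightarrow> ('n \<Rightarrow> nat) \<Rightarrow> real^'n \<Rightarrow> real" where
  "basis_function \<kappa> \<alpha> x = (if x \<in> \<kappa> then monomial \<alpha> x else 0)"

lemma polynomial_monomial:
  fixes \<alpha> :: "'n \<Rightarrow> nat"
  assumes "sum \<alpha> UNIV \<le> p"
  shows "polynomial_of_degree p (monomial \<alpha>)"
proof -
  have "monomial \<alpha> x = (\<Sum>\<beta> | sum \<beta> UNIV \<le> p. (if \<beta> = \<alpha> then 1 else 0) * monomial \<beta> x)" for x :: "real^'n"
  proof -
    have "(\<Sum>\<beta> | sum \<beta> UNIV \<le> p. (if \<beta> = \<alpha> then 1 else 0) * monomial \<beta> x)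
        = (\<Sum>\<beta>\<in>{\<alpha>}. (if \<beta> = \<alpha> then 1 else 0) * monomial \<beta> x)"
      using assms by (intro sum.mono_neutral_right finite_multi_indices) auto
    then show ?thesis by simp
  qed
  then show ?thesis unfolding polynomial_of_degree_alt
    by (intro exI[of _ "\<lambda>\<beta>. if \<beta> = \<alpha> then 1 else 0"]) (rule ext)
qed

lemma basis_function_mem:
  assumes "\<kappa> \<in> T" "sum \<alpha> UNIV \<le> deg D j"
  shows "basis_function \<kappa> \<alpha> \<in> V"
  unfolding dg_space_iff
proof (intro conjI ballI allI impI)
  fix \<kappa>' assume \<kappa>': "\<kappa>' \<in> T"
  show "\<exists>q. polynomial_of_degree (deg D j) q \<and> (\<forall>x\<in>\<kappa>'. basis_function \<kappa> \<alpha> x = q x)"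
  proof (cases "\<kappa>' = \<kappa>")
    case True
    then show ?thesis
      by (intro exI[of _ "monomial \<alpha>"]) (simp add: polynomial_monomial[OF assms(2)] basis_function_def)
  next
    case False
    then have "\<forall>x\<in>\<kappa>'. basis_function \<kappa> \<alpha> x = 0"
      using element_unique[OF \<kappa>' assms(1)] by (auto simp: basis_function_def)
    then show ?thesis by (intro exI[of _ "\<lambda>x. 0"]) (simp add: polynomial_of_degree_zero)
  qed
qed (use assms in \<open>auto simp: basis_function_def\<close>)

sublocale finite_dim_function_space V
proof
  show zero: "(\<lambda>x. 0) \<in> V"
    unfolding dg_space_iff using polynomial_of_degree_zero by blast
  show lin: "(\<lambda>x. a * u x + b * v x) \<in> V" if u: "u \<in> V" and v: "v \<in> V" for u v a b
    unfolding dg_space_iff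
  proof (intro conjI ballI allI impI)
    fix \<kappa> assume \<kappa>: "\<kappa> \<in> T"
    obtain q where "polynomial_of_degree (deg D j) q" "\<forall>x\<in>\<kappa>. u x = q x"
      using u \<kappa> unfolding dg_space_iff by blast
    moreover obtain r where "polynomial_of_degree (deg D j) r" "\<forall>x\<in>\<kappa>. v x = r x"
      using v \<kappa> unfolding dg_space_iff by blast
    ultimately show "\<exists>q. polynomial_of_degree (deg D j) q \<and> (\<forall>x\<in>\<kappa>. a * u x + b * v x = q x)"
      by (intro exI[of _ "\<lambda>x. a * q x + b * r x"]) (simp add: polynomial_of_degree_lin)
  qed (use u v in \<open>simp add: dg_space_iff\<close>)
  define I where "I = T \<times> {\<alpha> :: 'n \<Rightarrow> nat. sum \<alpha> UNIV \<le> deg D j}"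
  define b where "b i = basis_function (fst i) (snd i)" for i :: "(real^'n) set \<times> ('n \<Rightarrow> nat)"
  have I: "finite I" unfolding I_def by (intro finite_cartesian_product finite_mesh finite_multi_indices)
  \<comment> \<open>Coefficients are attached to the functions in the image of \<open>I\<close>
    under \<open>b\<close>, whereas \<open>v\<close> expands over the indices. Once the span
    \<open>S\<close> is known to be a function space, \<open>S.sum_mem\<close> translates one sum
    into the other and absorbs possible repetitions.\<close>
  define S where "S = {v. \<exists>c. v = (\<lambda>x. \<Sum>e\<in>b ` I. c e * e x)}"
  interpret S: function_space S
  proof
    show "(\<lambda>x. 0) \<in> S" unfolding S_def by (auto intro!: exI[of _ "\<lambda>_. 0"])
    show "(\<lambda>x. a * u x + d * v x) \<in> S" if "u \<in> S" "v \<in> S" for u v a d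
    proof -
      obtain k l where "u = (\<lambda>x. \<Sum>e\<in>b ` I. k e * e x)" "v = (\<lambda>x. \<Sum>e\<in>b ` I. l e * e x)"
        using \<open>u \<in> S\<close> \<open>v \<in> S\<close> unfolding S_def by blast
      then have "(\<lambda>x. a * u x + d * v x) = (\<lambda>x. \<Sum>e\<in>b ` I. (a * k e + d * l e) * e x)"
        by (simp add: sum_distrib_left sum.distrib algebra_simps)
      then show ?thesis unfolding S_def by (intro CollectI exI[of _ "\<lambda>e. a * k e + d * l e"])
    qed
  qed
  have bS: "b i \<in> S" if i: "i \<in> I" for i
  proof -
    have eq: "(\<Sum>e\<in>b ` I. (if e = b i then 1 else 0) * e x) = (\<Sum>e\<in>{b i}. (if e = b i then 1 else 0) * e x)" for x
    proof (rule sum.mono_neutral_right)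
      show "finite (b ` I)" "{b i} \<subseteq> b ` I" using i I by blast+
      show "\<forall>e\<in>b ` I - {b i}. (if e = b i then 1 else 0) * e x = 0"
      proof
        fix e assume "e \<in> b ` I - {b i}"
        then have "e \<noteq> b i" by blast
        then show "(if e = b i then 1 else 0) * e x = 0" by (simp only: if_False mult_zero_left)
      qed
    qed
    have b: "b i = (\<lambda>x. \<Sum>e\<in>b ` I. (if e = b i then 1 else 0) * e x)"
      unfolding eq by (simp only: sum.insert finite.emptyI empty_iff not_False_eq_True sum.empty simp_thms if_True mult_1 add_0_right)
    show ?thesis unfolding S_def mem_Collect_eq
      by (rule exI[of _ "\<lambda>e. if e = b i then 1 else 0"]) (rule b)
  qed
  have "v \<in> S" if v: "v \<in> V" for v
  proof -
    have "\<exists>c. \<forall>x\<in>\<kappa>. v x = (\<Sum>\<alpha> | sum \<alpha> UNIV \<le> deg D j. c \<alpha> * monomial \<alpha> x)" if \<kappa>: "\<kappa> \<in> T" for \<kappa>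
    proof -
      obtain q where "polynomial_of_degree (deg D j) q" "\<forall>x\<in>\<kappa>. v x = q x"
        using v \<kappa> unfolding dg_space_iff by blast
      moreover then obtain c where "q = (\<lambda>x. \<Sum>\<alpha> | sum \<alpha> UNIV \<le> deg D j. c \<alpha> * monomial \<alpha> x)"
        unfolding polynomial_of_degree_alt by blast
      ultimately show ?thesis by (intro exI[of _ c]) simp
    qed
    then obtain c where c: "\<And>\<kappa> x. \<kappa> \<in> T \<Longrightarrow> x \<in> \<kappa> \<Longrightarrow>
        v x = (\<Sum>\<alpha> | sum \<alpha> UNIV \<le> deg D j. c \<kappa> \<alpha> * monomial \<alpha> x)"
      by metis
    have eq: "(\<Sum>i\<in>I. c (fst i) (snd i) * b i x) =
        (\<Sum>\<kappa>\<in>T. \<Sum>\<alpha> | sum \<alpha> UNIV \<le> deg D j. c \<kappa> \<alpha> * basis_function \<kappa> \<alpha> x)" for x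
      unfolding I_def b_def by (simp add: sum.cartesian_product case_prod_beta)
    have "v x = (\<Sum>i\<in>I. c (fst i) (snd i) * b i x)" for x
    proof (cases "x \<in> \<Union>T")
      case True
      then obtain \<kappa> where \<kappa>: "\<kappa> \<in> T" "x \<in> \<kappa>" by blast
      have "(\<Sum>\<kappa>\<in>T. \<Sum>\<alpha> | sum \<alpha> UNIV \<le> deg D j. c \<kappa> \<alpha> * basis_function \<kappa> \<alpha> x)
          = (\<Sum>\<kappa>\<in>{\<kappa>}. \<Sum>\<alpha> | sum \<alpha> UNIV \<le> deg D j. c \<kappa> \<alpha> * basis_function \<kappa> \<alpha> x)"
      proof (intro sum.mono_neutral_right finite_mesh ballI sum.neutral)
        fix \<kappa>' \<alpha> assume "\<kappa>' \<in> T - {\<kappa>}"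
        then have "x \<notin> \<kappa>'" using element_unique[OF \<kappa>(1) _ \<kappa>(2)] by blast
        then show "c \<kappa>' \<alpha> * basis_function \<kappa>' \<alpha> x = 0" by (simp add: basis_function_def)
      qed (use \<kappa> in auto)
      then show ?thesis using c[OF \<kappa>] \<kappa> by (simp add: eq basis_function_def)
    next
      case False
      then show ?thesis using dg_space_outside[OF v False]
        by (auto simp: eq basis_function_def intro!: sum.neutral)
    qed
    then have "v = (\<lambda>x. \<Sum>i\<in>I. c (fst i) (snd i) * b i x)" by (rule ext)
    then show ?thesis using S.sum_mem[of I b "\<lambda>i. c (fst i) (snd i)"] bS by simp
  qed
  moreover have "b ` I \<subseteq> V" unfolding b_def I_def using basis_function_mem by auto
  ultimately show "\<exists>B. finite B \<and> B \<subseteq> V \<and> (\<forall>v\<in>V. \<exists>c. v = (\<lambda>x. \<Sum>b\<in>B. c b * b x))"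
    using I unfolding S_def by (intro exI[of _ "b ` I"]) blast
qed

section \<open>The L2 inner product on the DG space\<close>

lemma product_integrable:
  assumes u: "u \<in> V" and v: "v \<in> V"
  shows "set_integrable lebesgue \<Omega> (\<lambda>x. u x * v x)"
proof -
  have "integrable lebesgue (\<lambda>x. u x * v x)"
  proof (rule integrable_piecewise)
    fix \<kappa> assume \<kappa>: "\<kappa> \<in> T"
    obtain q where q: "C1 q" "\<And>x. x \<in> \<kappa> \<Longrightarrow> u x = q x" using dg_space_piece[OF u \<kappa>] by blast
    obtain r where r: "C1 r" "\<And>x. x \<in> \<kappa> \<Longrightarrow> v x = r x" using dg_space_piece[OF v \<kappa>] by blast
    show "\<exists>g. continuous_on UNIV g \<and> (\<forall>x\<in>\<kappa>. u x * v x = g x)"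
      by (rule exI[of _ "\<lambda>x. q x * r x"]) (simp add: q r C1_continuous C1_mult)
  qed (simp add: dg_space_outside[OF u])
  then show ?thesis unfolding set_integrable_def using sets_domain by (intro integrable_mult_indicator)
qed

lemma l2_inner_symmetric_form: "symmetric_form (l2_inner \<Omega>)"
proof (rule symmetric_formI)
  show "l2_inner \<Omega> u v = l2_inner \<Omega> v u" for u v by (simp add: l2_inner_def mult.commute)
  show "l2_inner \<Omega> (\<lambda>x. a * u x + b * v x) w = a * l2_inner \<Omega> u w + b * l2_inner \<Omega> v w"
    if "u \<in> V" "v \<in> V" "w \<in> V" for u v w a b
    using product_integrable[OF that(1,3)] product_integrable[OF that(2,3)]
    by (simp add: l2_inner_def algebra_simps set_integral_add(2))
qed

text \<open>The form is definite on functions and not merely on classes: a vanishing integral makes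
  the polynomial zero at every point of an open element, and off the elements the representative is
  zero.\<close>

lemma l2_inner_pos_def: "pos_def_form (l2_inner \<Omega>)"
  unfolding pos_def_form_def
proof (intro conjI ballI impI l2_inner_symmetric_form)
  fix v assume v: "v \<in> V" and nz: "v \<noteq> (\<lambda>x. 0)"
  show "l2_inner \<Omega> v v > 0"
  proof (rule ccontr)
    assume "\<not> l2_inner \<Omega> v v > 0"
    then have le: "(LINT x:\<Omega>|lebesgue. v x * v x) \<le> 0" by (simp add: l2_inner_def)
    have "v x = 0" for x
    proof (cases "x \<in> \<Union>T")
      case True
      then obtain \<kappa> where \<kappa>: "\<kappa> \<in> T" "x \<in> \<kappa>" by blast
      obtain q where q: "C1 q" "\<And>x. x \<in> \<kappa> \<Longrightarrow> v x = q x" using dg_space_piece[OF v \<kappa>(1)] by blast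
      have int: "set_integrable lebesgue \<kappa> (\<lambda>x. v x * v x)"
        by (rule set_integrable_subset[OF product_integrable[OF v v] sets_element[OF \<kappa>(1)] element_subset[OF \<kappa>(1)]])
      have "(LINT x:\<kappa>|lebesgue. q x * q x) = (LINT x:\<kappa>|lebesgue. v x * v x)"
        using q(2) sets_element[OF \<kappa>(1)] by (intro set_lebesgue_integral_cong) auto
      also have "\<dots> \<le> (LINT x:\<Omega>|lebesgue. v x * v x)"
        unfolding set_lebesgue_integral_def
        using int product_integrable[OF v v] element_subset[OF \<kappa>(1)] unfolding set_integrable_def
        by (intro integral_mono) (auto simp: indicator_def)
      finally have "q x * q x = 0"
        using le element[OF \<kappa>(1)] \<kappa>(2)
        by (intro set_integral_zero_continuous[of "\<lambda>x. q x * q x" \<kappa>] continuous_intros C1_continuous q) auto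
      then show ?thesis using q(2)[OF \<kappa>(2)] by simp
    qed (rule dg_space_outside[OF v])
    then show False using nz by auto
  qed
qed

section \<open>The discontinuous Galerkin form\<close>

lemma grad_piece:
  assumes "\<kappa> \<in> T" "C1 q" "\<And>x. x \<in> \<kappa> \<Longrightarrow> v x = q x" "x \<in> \<kappa>"
  shows "grad v x = grad q x"
  using grad_cong_open[of q x \<kappa> v] element(1) assms unfolding C1_def by blast

lemma trace_piece:
  assumes \<kappa>: "\<kappa> \<in> T" and q: "C1 q" "\<And>x. x \<in> \<kappa> \<Longrightarrow> v x = q x" and x: "x \<in> closure \<kappa>"
  shows "bdry_trace \<kappa> v x = q x" "bdry_trace \<kappa> (grad v) x = grad q x"
proof -
  show "bdry_trace \<kappa> v x = q x"
    by (rule bdry_trace_continuous[OF C1_continuous[OF q(1)] element(1,4)[OF \<kappa>] x q(2)])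
  show "bdry_trace \<kappa> (grad v) x = grad q x"
    using q(1) grad_piece[OF \<kappa> q] unfolding C1_def
    by (intro bdry_trace_continuous element(1,4)[OF \<kappa>] x) auto
qed

lemma neighboursD: "\<kappa> \<in> neighbours T F \<Longrightarrow> \<kappa> \<in> T \<and> F \<subseteq> closure \<kappa> \<and> F \<subseteq> frontier \<kappa>"
  unfolding neighbours_def by (auto simp: frontier_def)

text \<open>A \<open>Lim\<close> is additive only where the limits exist; the C1 extensions of the
  two pieces provide this.\<close>

lemma trace_lin:
  assumes u: "u \<in> V" and v: "v \<in> V" and \<kappa>: "\<kappa> \<in> T" and x: "x \<in> closure \<kappa>"
  shows "bdry_trace \<kappa> (\<lambda>y. a * u y + b * v y) x = a * bdry_trace \<kappa> u x + b * bdry_trace \<kappa> v x"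
    and "bdry_trace \<kappa> (grad (\<lambda>y. a * u y + b * v y)) x
      = a *\<^sub>R bdry_trace \<kappa> (grad u) x + b *\<^sub>R bdry_trace \<kappa> (grad v) x"
proof -
  obtain q where q: "C1 q" "\<And>x. x \<in> \<kappa> \<Longrightarrow> u x = q x" using dg_space_piece[OF u \<kappa>] by blast
  obtain r where r: "C1 r" "\<And>x. x \<in> \<kappa> \<Longrightarrow> v x = r x" using dg_space_piece[OF v \<kappa>] by blast
  have "grad (\<lambda>y. a * q y + b * r y) x = a *\<^sub>R grad q x + b *\<^sub>R grad r x"
    using grad_lin q(1) r(1) unfolding C1_def by blast
  then show "bdry_trace \<kappa> (\<lambda>y. a * u y + b * v y) x = a * bdry_trace \<kappa> u x + b * bdry_trace \<kappa> v x"
    "bdry_trace \<kappa> (grad (\<lambda>y. a * u y + b * v y)) x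
      = a *\<^sub>R bdry_trace \<kappa> (grad u) x + b *\<^sub>R bdry_trace \<kappa> (grad v) x"
    using trace_piece[OF \<kappa> C1_lin[OF q(1) r(1)], of "\<lambda>y. a * u y + b * v y" a b x]
      trace_piece[OF \<kappa> q x] trace_piece[OF \<kappa> r x] q(2) r(2) x by auto
qed

lemma face:
  assumes "F \<in> \<F>"
  shows "(int CARD('n) - 1) simplex F" "compact F" "convex F"
proof -
  show "(int CARD('n) - 1) simplex F" using is_face_set assms unfolding is_face_set_def by blast
  then show "compact F" "convex F" using compact_simplex convex_simplex by blast+
qed

lemma jump_lin:
  assumes "u \<in> V" "v \<in> V" "x \<in> F"
  shows "jump D j F (\<lambda>y. a * u y + b * v y) x = a *\<^sub>R jump D j F u x + b *\<^sub>R jump D j F v x"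
proof -
  have "bdry_trace \<kappa> (\<lambda>y. a * u y + b * v y) x = a * bdry_trace \<kappa> u x + b * bdry_trace \<kappa> v x"
    if "\<kappa> \<in> neighbours T F" for \<kappa>
    using trace_lin(1)[OF assms(1,2)] neighboursD[OF that] assms(3) by blast
  then show ?thesis
    unfolding jump_def by (simp add: scaleR_sum_right sum.distrib[symmetric] scaleR_add_left)
qed

lemma average_grad_lin:
  assumes "u \<in> V" "v \<in> V" "x \<in> F"
  shows "average D j F (grad (\<lambda>y. a * u y + b * v y)) x
    = a *\<^sub>R average D j F (grad u) x + b *\<^sub>R average D j F (grad v) x"
proof -
  have "bdry_trace \<kappa> (grad (\<lambda>y. a * u y + b * v y)) x
      = a *\<^sub>R bdry_trace \<kappa> (grad u) x + b *\<^sub>R bdry_trace \<kappa> (grad v) x"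
    if "\<kappa> \<in> neighbours T F" for \<kappa>
    using trace_lin(2)[OF assms(1,2)] neighboursD[OF that] assms(3) by blast
  then show ?thesis
    unfolding average_def by (simp add: sum.distrib scaleR_sum_right[symmetric] scaleR_add_right mult.commute)
qed

lemma trace_continuous:
  assumes v: "v \<in> V" and \<kappa>: "\<kappa> \<in> neighbours T F"
  shows "continuous_on F (bdry_trace \<kappa> v)" "continuous_on F (bdry_trace \<kappa> (grad v))"
proof -
  have \<kappa>: "\<kappa> \<in> T" "F \<subseteq> closure \<kappa>" using neighboursD[OF \<kappa>] by auto
  obtain q where q: "C1 q" "\<And>x. x \<in> \<kappa> \<Longrightarrow> v x = q x" using dg_space_piece[OF v \<kappa>(1)] by blast
  have "continuous_on F q" "continuous_on F (grad q)"
    using q(1) C1_continuous[of q F] continuous_on_subset unfolding C1_def by auto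
  then show "continuous_on F (bdry_trace \<kappa> v)" "continuous_on F (bdry_trace \<kappa> (grad v))"
    using trace_piece[OF \<kappa>(1) q] \<kappa>(2) by (auto cong: continuous_on_cong_simp simp: subset_iff simp_implies_def)
qed

lemma jump_continuous: "v \<in> V \<Longrightarrow> continuous_on F (jump D j F v)"
  unfolding jump_def[abs_def] by (intro continuous_intros trace_continuous)

lemma average_grad_continuous: "v \<in> V \<Longrightarrow> continuous_on F (average D j F (grad v))"
  unfolding average_def[abs_def] by (intro continuous_intros trace_continuous)

lemma dg_form_symmetric: "symmetric_form \<A>"
proof (rule symmetric_formI)
  show "\<A> u v = \<A> v u" for u v
    by (simp add: dg_form_def inner_commute add.commute)
  fix u v w a b assume u: "u \<in> V" and v: "v \<in> V" and w: "w \<in> V"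
  let ?s = "\<lambda>x. a * u x + b * v x"
  have 1: "(LINT x:\<kappa>|lebesgue. grad ?s x \<bullet> grad w x) =
      a * (LINT x:\<kappa>|lebesgue. grad u x \<bullet> grad w x) + b * (LINT x:\<kappa>|lebesgue. grad v x \<bullet> grad w x)"
    if \<kappa>: "\<kappa> \<in> T" for \<kappa>
  proof -
    obtain q where q: "C1 q" "\<And>x. x \<in> \<kappa> \<Longrightarrow> u x = q x" using dg_space_piece[OF u \<kappa>] by blast
    obtain r where r: "C1 r" "\<And>x. x \<in> \<kappa> \<Longrightarrow> v x = r x" using dg_space_piece[OF v \<kappa>] by blast
    obtain p where p: "C1 p" "\<And>x. x \<in> \<kappa> \<Longrightarrow> w x = p x" using dg_space_piece[OF w \<kappa>] by blast
    have cong: "(LINT x:\<kappa>|lebesgue. f x) = (LINT x:\<kappa>|lebesgue. g x)"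
      if "\<And>x. x \<in> \<kappa> \<Longrightarrow> f x = g x" for f g :: "real^'n \<Rightarrow> real"
      using that sets_element[OF \<kappa>] by (intro set_lebesgue_integral_cong) auto
    have int: "set_integrable lebesgue \<kappa> (\<lambda>x. grad f x \<bullet> grad p x)" if "C1 f" for f
      using that p(1) element(4)[OF \<kappa>] sets_element[OF \<kappa>] unfolding C1_def
      by (intro set_integrable_continuous_bounded continuous_intros) auto
    have "grad ?s x = a *\<^sub>R grad q x + b *\<^sub>R grad r x" if "x \<in> \<kappa>" for x
      using grad_piece[OF \<kappa> C1_lin[OF q(1) r(1)], of ?s a b x] that q r
      by (simp add: grad_lin C1_def)
    then have "(LINT x:\<kappa>|lebesgue. grad ?s x \<bullet> grad w x) =
        (LINT x:\<kappa>|lebesgue. a * (grad q x \<bullet> grad p x) + b * (grad r x \<bullet> grad p x))"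
      using grad_piece[OF \<kappa> p] by (intro cong) (simp add: inner_add_left)
    also have "\<dots> = a * (LINT x:\<kappa>|lebesgue. grad q x \<bullet> grad p x) + b * (LINT x:\<kappa>|lebesgue. grad r x \<bullet> grad p x)"
      using int[OF q(1)] int[OF r(1)] by (subst set_integral_add(2)) auto
    also have "(LINT x:\<kappa>|lebesgue. grad q x \<bullet> grad p x) = (LINT x:\<kappa>|lebesgue. grad u x \<bullet> grad w x)"
      using grad_piece[OF \<kappa> p] grad_piece[OF \<kappa> q] by (intro cong) simp
    also have "(LINT x:\<kappa>|lebesgue. grad r x \<bullet> grad p x) = (LINT x:\<kappa>|lebesgue. grad v x \<bullet> grad w x)"
      using grad_piece[OF \<kappa> p] grad_piece[OF \<kappa> r] by (intro cong) simp
    finally show ?thesis .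
  qed
  \<comment> \<open>The abstract \<open>h\<close> stands for the two kinds of face integrand, the
    consistency terms and the penalty term; pointwise linearity on \<open>F\<close> carries over to
    the integral because both summands are continuous on the compact face.\<close>
  have face_lin: "(LINT x:F|face_measure F. h ?s x) =
      a * (LINT x:F|face_measure F. h u x) + b * (LINT x:F|face_measure F. h v x)"
    if F: "F \<in> \<F>" and h: "\<And>x. x \<in> F \<Longrightarrow> h ?s x = a * h u x + b * h v x"
      "continuous_on F (h u)" "continuous_on F (h v)"
    for F and h :: "(real^'n \<Rightarrow> real) \<Rightarrow> real^'n \<Rightarrow> real"
  proof -
    have "F \<in> sets (face_measure F)" using face(2)[OF F] by (simp add: borel_compact)
    then have "(LINT x:F|face_measure F. h ?s x) = (LINT x:F|face_measure F. a * h u x + b * h v x)"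
      using h(1) by (intro set_lebesgue_integral_cong) auto
    then show ?thesis
      using set_integrable_face_measure[OF face(2)[OF F] h(2)] set_integrable_face_measure[OF face(2)[OF F] h(3)]
      by (simp add: set_integral_add(2))
  qed
  note cont = jump_continuous[OF u] jump_continuous[OF v] jump_continuous[OF w]
    average_grad_continuous[OF u] average_grad_continuous[OF v] average_grad_continuous[OF w]
  have 2: "(LINT x:F|face_measure F. average D j F (grad ?s) x \<bullet> jump D j F w x + jump D j F ?s x \<bullet> average D j F (grad w) x) =
      a * (LINT x:F|face_measure F. average D j F (grad u) x \<bullet> jump D j F w x + jump D j F u x \<bullet> average D j F (grad w) x) +
      b * (LINT x:F|face_measure F. average D j F (grad v) x \<bullet> jump D j F w x + jump D j F v x \<bullet> average D j F (grad w) x)"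
    if F: "F \<in> \<F>" for F
    by (rule face_lin[OF F, of "\<lambda>f x. average D j F (grad f) x \<bullet> jump D j F w x + jump D j F f x \<bullet> average D j F (grad w) x"])
      (auto simp: jump_lin[OF u v] average_grad_lin[OF u v] algebra_simps inner_add_left intro!: continuous_intros cont)
  have 3: "(LINT x:F|face_measure F. penalty C\<sigma> D j F * (jump D j F ?s x \<bullet> jump D j F w x)) =
      a * (LINT x:F|face_measure F. penalty C\<sigma> D j F * (jump D j F u x \<bullet> jump D j F w x)) +
      b * (LINT x:F|face_measure F. penalty C\<sigma> D j F * (jump D j F v x \<bullet> jump D j F w x))"
    if F: "F \<in> \<F>" for F
    by (rule face_lin[OF F, of "\<lambda>f x. penalty C\<sigma> D j F * (jump D j F f x \<bullet> jump D j F w x)"])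
      (auto simp: jump_lin[OF u v] algebra_simps inner_add_left intro!: continuous_intros cont)
  have sum_lin: "(\<Sum>i\<in>I. X i) = a * (\<Sum>i\<in>I. Y i) + b * (\<Sum>i\<in>I. Z i)"
    if "\<And>i. i \<in> I \<Longrightarrow> X i = a * Y i + b * Z i" for I :: "(real^'n) set set" and X Y Z
    using that by (simp add: sum.distrib sum_distrib_left)
  let ?I1 = "\<lambda>f \<kappa>. LINT x:\<kappa>|lebesgue. grad f x \<bullet> grad w x"
  let ?I2 = "\<lambda>f F. LINT x:F|face_measure F.
    average D j F (grad f) x \<bullet> jump D j F w x + jump D j F f x \<bullet> average D j F (grad w) x"
  let ?I3 = "\<lambda>f F. LINT x:F|face_measure F. penalty C\<sigma> D j F * (jump D j F f x \<bullet> jump D j F w x)"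
  have S1: "sum (?I1 ?s) T = a * sum (?I1 u) T + b * sum (?I1 v) T" by (rule sum_lin) (rule 1)
  have S2: "sum (?I2 ?s) \<F> = a * sum (?I2 u) \<F> + b * sum (?I2 v) \<F>" by (rule sum_lin) (rule 2)
  have S3: "sum (?I3 ?s) \<F> = a * sum (?I3 u) \<F> + b * sum (?I3 v) \<F>" by (rule sum_lin) (rule 3)
  show "\<A> ?s w = a * \<A> u w + b * \<A> v w"
    unfolding dg_form_def S1 S2 S3 by (simp only: algebra_simps)
qed

end

section \<open>Geometry of faces\<close>

text \<open>The empty set is the simplex of dimension -1, so the positive dimension of the space is
  what counts here.\<close>

lemma face_simplex_nonempty:
  fixes F :: "(real^'n) set"
  assumes "(int CARD('n) - 1) simplex F"
  shows "F \<noteq> {}"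
proof
  assume "F = {}"
  moreover have "CARD('n) > 0" by simp
  ultimately show False using assms by (simp add: simplex_empty)
qed

lemma unit_normalD:
  assumes "unit_normal F n" "x \<in> F" "y \<in> F"
  shows "n \<bullet> y = n \<bullet> x"
proof -
  have "n \<bullet> (y - x) = 0" using assms unfolding unit_normal_def by blast
  then show ?thesis by (simp add: inner_diff_right)
qed

text \<open>One affine set contains the other and both have dimension one less than the
  space.\<close>

lemma affine_hull_face:
  fixes F :: "(real^'n) set"
  assumes F: "(int CARD('n) - 1) simplex F" and n: "unit_normal F n" and x: "x \<in> F"
  shows "affine hull F = {y. n \<bullet> y = n \<bullet> x}"
proof (rule affine_dim_equal)
  have "n \<noteq> 0" using n unfolding unit_normal_def by auto
  moreover have "CARD('n) > 0" by simp
  ultimately show "aff_dim (affine hull F) = aff_dim {y. n \<bullet> y = n \<bullet> x}"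
    using aff_dim_simplex[OF F] by (simp add: of_nat_diff Suc_le_eq)
  have "F \<subseteq> {y. n \<bullet> y = n \<bullet> x}"
    using unit_normalD[OF n x] by blast
  then show "affine hull F \<subseteq> {y. n \<bullet> y = n \<bullet> x}"
    by (rule hull_minimal) (rule affine_hyperplane)
  show "affine hull F \<noteq> {}" using face_simplex_nonempty[OF F] by (simp add: affine_hull_eq_empty)
qed (rule affine_affine_hull affine_hyperplane)+

text \<open>The part \<open>d\<close> of \<open>m\<close> orthogonal to \<open>n\<close> is a
  direction of the hyperplane of \<open>F\<close>, hence orthogonal to \<open>m\<close> as well,
  hence to itself.\<close>

lemma unit_normal_unique:
  fixes F :: "(real^'n) set"
  assumes F: "(int CARD('n) - 1) simplex F" and n: "unit_normal F n" and m: "unit_normal F m"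
  shows "m = n \<or> m = - n"
proof -
  obtain x where x: "x \<in> F" using face_simplex_nonempty[OF F] by blast
  have 1: "n \<bullet> n = 1" "m \<bullet> m = 1"
    using n m unfolding unit_normal_def by (simp_all add: norm_eq_1)
  define d where "d = m - (m \<bullet> n) *\<^sub>R n"
  have dn: "n \<bullet> d = 0" unfolding d_def by (simp add: inner_diff_right 1 inner_commute)
  then have "x + d \<in> affine hull F" using affine_hull_face[OF F n x] by (simp add: inner_add_right)
  then have dm: "m \<bullet> d = 0" using affine_hull_face[OF F m x] by (simp add: inner_add_right)
  have "d \<bullet> d = m \<bullet> d - (m \<bullet> n) * (n \<bullet> d)" unfolding d_def by (simp add: inner_diff_left)
  then have "d = 0" using dn dm by simp
  then have mn: "m = (m \<bullet> n) *\<^sub>R n" unfolding d_def by simp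
  then have "1 = (m \<bullet> n) * (m \<bullet> n)" using 1 inner_scaleR_left[of "m \<bullet> n" n m] by (metis inner_commute)
  then have "m \<bullet> n = 1 \<or> m \<bullet> n = -1" by (simp add: square_eq_1_iff)
  then show ?thesis using mn by auto
qed

text \<open>The local picture at a face of \<open>S\<close> with outward normal \<open>n\<close>:
  near a relative interior point, the open half ball on the inner side belongs to \<open>S\<close>
  and the dividing disc to \<open>F\<close>. What lies on the outer side is left open.\<close>

definition one_sided :: "(real^'n) set \<Rightarrow> (real^'n) set \<Rightarrow> real^'n \<Rightarrow> bool" where
  "one_sided S F n \<longleftrightarrow> unit_normal F n \<and> (\<forall>x\<in>rel_interior F. \<exists>r>0. \<forall>y\<in>ball x r.
     (n \<bullet> y < n \<bullet> x \<longrightarrow> y \<in> S) \<and> (n \<bullet> y = n \<bullet> x \<longrightarrow> y \<in> F))"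

lemma one_sided_mono: "one_sided S F n \<Longrightarrow> S \<subseteq> S' \<Longrightarrow> one_sided S' F n"
  unfolding one_sided_def by blast

lemma one_sidedD:
  assumes "one_sided S F n" "x \<in> rel_interior F"
  shows "\<forall>\<^sub>F t in at_right 0. x - t *\<^sub>R n \<in> S"
proof -
  have n: "norm n = 1" using assms unfolding one_sided_def unit_normal_def by blast
  then have nn: "n \<bullet> n = 1" by (simp add: norm_eq_1)
  obtain r where r: "r > 0" "\<forall>y\<in>ball x r. n \<bullet> y < n \<bullet> x \<longrightarrow> y \<in> S"
    using assms unfolding one_sided_def by meson
  have "x - t *\<^sub>R n \<in> S" if "0 < t" "t < r" for t
    using r(2) that n by (auto simp: dist_norm inner_diff_right nn)
  then show ?thesis unfolding eventually_at_right_field using r(1) by blast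
qed

text \<open>\<open>F\<close> lies in a facet of the convex body \<open>S\<close>, because it lies in the supporting hyperplane of
  \<open>S\<close> at one of its relative interior points.\<close>

lemma ex_one_sided:
  fixes F S :: "(real^'n) set"
  assumes F: "(int CARD('n) - 1) simplex F"
    and S: "convex S" "closed S" "interior S \<noteq> {}" "F \<subseteq> frontier S"
  shows "\<exists>n. one_sided (interior S) F n"
proof -
  have F': "convex F" "F \<noteq> {}" using convex_simplex[OF F] face_simplex_nonempty[OF F] .
  then obtain x0 where x0: "x0 \<in> rel_interior F" using rel_interior_eq_empty by blast
  have FS: "F \<subseteq> S" using S(2,4) frontier_subset_closed by blast
  have relS: "rel_interior S = interior S" by (rule rel_interior_nonempty_interior[OF S(3)])
  have x0F: "x0 \<in> F" using x0 rel_interior_subset by blast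
  then have "x0 \<in> S" "x0 \<notin> rel_interior S" using FS S(4) unfolding relS frontier_def by auto
  then obtain a where a: "a \<noteq> 0" "\<And>y. y \<in> S \<Longrightarrow> a \<bullet> x0 \<le> a \<bullet> y"
      "\<And>y. y \<in> interior S \<Longrightarrow> a \<bullet> x0 < a \<bullet> y"
    using supporting_hyperplane_rel_boundary[OF S(1)] unfolding relS by metis
  have aF: "a \<bullet> y = a \<bullet> x0" if y: "y \<in> F" for y
  proof -
    \<comment> \<open>The segment from \<open>y\<close> can be prolonged beyond the relative
      interior point \<open>x0\<close> inside \<open>F\<close>. As \<open>a\<close> is smallest at
      \<open>x0\<close>, it cannot increase from \<open>x0\<close> towards \<open>y\<close>
      either.\<close>
    obtain e where e: "e > 1" "(1 - e) *\<^sub>R y + e *\<^sub>R x0 \<in> F"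
      using x0 y convex_rel_interior_iff[OF F'] by blast
    then have "a \<bullet> x0 \<le> a \<bullet> ((1 - e) *\<^sub>R y + e *\<^sub>R x0)" using a(2) FS by blast
    then have "(e - 1) * (a \<bullet> y) \<le> (e - 1) * (a \<bullet> x0)" by (simp add: inner_add_right algebra_simps)
    then have "a \<bullet> y \<le> a \<bullet> x0" using e(1) by simp
    then show ?thesis using a(2)[of y] y FS by force
  qed
  \<comment> \<open>The functional \<open>a\<close> is minimal on \<open>F\<close>, so its negative
    points out of \<open>S\<close>.\<close>
  define n where "n = (- 1 / norm a) *\<^sub>R a"
  have n: "unit_normal F n"
    using a(1) aF unfolding unit_normal_def n_def by (auto simp: inner_diff_right)
  then have norm_n: "norm n = 1" unfolding unit_normal_def by blast
  obtain c where c: "c \<in> interior S" using S(3) by blast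
  define s where "s = n \<bullet> x0 - n \<bullet> c"
  have s: "s > 0" using a(1) a(3)[OF c] unfolding s_def n_def by (simp add: divide_strict_right_mono)
  have "\<exists>r>0. \<forall>y\<in>ball x r. (n \<bullet> y < n \<bullet> x \<longrightarrow> y \<in> interior S) \<and> (n \<bullet> y = n \<bullet> x \<longrightarrow> y \<in> F)"
    if x: "x \<in> rel_interior F" for x
  proof -
    have xF: "x \<in> F" using x rel_interior_subset by blast
    have nx: "n \<bullet> x = n \<bullet> x0" using aF[OF xF] unfolding n_def by simp
    obtain \<delta> where \<delta>: "\<delta> > 0" "ball x \<delta> \<inter> affine hull F \<subseteq> F" using x mem_rel_interior_ball by blast
    have inF: "z \<in> F" if "dist x z < \<delta>" "n \<bullet> z = n \<bullet> x" for z
      using \<delta>(2) that unfolding affine_hull_face[OF F n xF] by auto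
    \<comment> \<open>The point \<open>z\<close> constructed below satisfies
      \<open>(1 - e) * norm (z - x) < r * k\<close>. The bound \<open>r \<le> s / 2\<close> keeps
      \<open>e\<close> below one half, and \<open>2 * r * k \<le> \<delta>\<close> then brings
      \<open>z\<close> into the disc of radius \<open>\<delta>\<close>, hence into
      \<open>F\<close>.\<close>
    define k where "k = 1 + norm (c - x) / s"
    have k: "k \<ge> 1" unfolding k_def using s by simp
    define r where "r = min (s / 2) (\<delta> / (2 * k))"
    have r: "r > 0" "r \<le> s / 2" "2 * r * k \<le> \<delta>"
    proof -
      show "r > 0" "r \<le> s / 2" unfolding r_def using s k \<delta>(1) by auto
      have "r \<le> \<delta> / (2 * k)" unfolding r_def by simp
      then show "2 * r * k \<le> \<delta>" using k by (simp add: field_simps)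
    qed
    have "y \<in> interior S" if y: "dist x y < r" and lt: "n \<bullet> y < n \<bullet> x" for y
    proof -
      \<comment> \<open>\<open>y\<close> is a convex combination of the interior point
        \<open>c\<close> and a point \<open>z\<close>; this weight of \<open>c\<close> puts
        \<open>z\<close> into the hyperplane of \<open>F\<close>.\<close>
      define e where "e = (n \<bullet> x - n \<bullet> y) / s"
      have "n \<bullet> (x - y) \<le> norm n * norm (x - y)" by (rule norm_cauchy_schwarz)
      then have "n \<bullet> x - n \<bullet> y < r" using y by (simp add: norm_n inner_diff_right dist_norm)
      then have e: "0 < e" "e < r / s" using lt s unfolding e_def by (auto simp: divide_strict_right_mono)
      have "r / s \<le> 1 / 2" using r(2) s by (simp add: field_simps)
      then have e2: "e < 1 / 2" using e by linarith
      have es: "e * s = n \<bullet> x - n \<bullet> y" using s unfolding e_def by simp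
      define z where "z = (1 / (1 - e)) *\<^sub>R (y - e *\<^sub>R c)"
      have ez: "(1 - e) *\<^sub>R z = y - e *\<^sub>R c" unfolding z_def using e2 by simp
      then have yz: "y = z - e *\<^sub>R (z - c)" by (simp add: algebra_simps)
      have "(1 - e) * (n \<bullet> z) = n \<bullet> y - e * (n \<bullet> c)"
        using arg_cong[OF ez, of "\<lambda>w. n \<bullet> w"] by (simp add: inner_diff_right)
      also have "n \<bullet> c = n \<bullet> x - s" using nx unfolding s_def by simp
      finally have "(1 - e) * (n \<bullet> z) = (1 - e) * (n \<bullet> x)" using es by (simp add: algebra_simps)
      then have nz: "n \<bullet> z = n \<bullet> x" using e2 by simp
      have "(1 - e) *\<^sub>R (z - x) = (y - x) - e *\<^sub>R (c - x)"
        unfolding scaleR_diff_right ez by (simp add: algebra_simps)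
      then have "norm ((1 - e) *\<^sub>R (z - x)) \<le> norm (y - x) + norm (e *\<^sub>R (c - x))"
        by (simp only: norm_triangle_ineq4)
      then have "(1 - e) * norm (z - x) \<le> norm (y - x) + e * norm (c - x)"
        using e e2 by simp
      also have "\<dots> < r + (r / s) * norm (c - x)"
        using y e by (intro add_less_le_mono mult_right_mono) (auto simp: dist_norm norm_minus_commute)
      also have "\<dots> = r * k" unfolding k_def by (simp add: algebra_simps)
      finally have "(1 - e) * norm (z - x) < r * k" .
      moreover have "(1 / 2) * norm (z - x) \<le> (1 - e) * norm (z - x)"
        using e2 by (intro mult_right_mono) auto
      ultimately have "norm (z - x) < \<delta>" using r(3) by linarith
      then have "z \<in> S" using inF[OF _ nz] FS by (auto simp: dist_norm norm_minus_commute)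
      then show ?thesis
        using mem_interior_convex_shrink[OF S(1) c, of z e] e e2 yz by simp
    qed
    moreover have "y \<in> F" if y: "dist x y < r" "n \<bullet> y = n \<bullet> x" for y
    proof (rule inF)
      have "r \<le> 2 * r * k" using r(1) k mult_left_mono[of 1 k "2 * r"] by simp
      then show "dist x y < \<delta>" using y(1) r(3) by linarith
    qed (rule y(2))
    ultimately show ?thesis using r(1) by auto
  qed
  then show ?thesis using n unfolding one_sided_def by blast
qed

text \<open>The existence of a normal turns the choice \<open>face_normal\<close> into an actual
  unit normal. For faces of the mesh it comes from \<open>ex_one_sided_element\<close>.\<close>

context
  fixes F :: "(real^'n) set"
  assumes F: "(int CARD('n) - 1) simplex F" and normal: "\<exists>n. unit_normal F n"
begin

lemma unit_normal_face_normal: "unit_normal F (face_normal F)"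
  unfolding face_normal_def using normal by (rule someI_ex)

lemma face_base_mem: "face_base F \<in> F"
  unfolding face_base_def using face_simplex_nonempty[OF F] by (simp add: some_in_eq)

lemma face_normal_inner: "face_normal F \<bullet> face_normal F = 1"
  using unit_normal_face_normal unfolding unit_normal_def by (simp add: norm_eq_1)

lemma face_proj_prism:
  assumes "x \<in> F"
  shows "face_proj F (x + t *\<^sub>R face_normal F) = x"
proof -
  have "face_normal F \<bullet> (x - face_base F) = 0"
    using unit_normal_face_normal assms face_base_mem unfolding unit_normal_def by blast
  then have "face_normal F \<bullet> (x + t *\<^sub>R face_normal F - face_base F) = t"
    by (simp add: inner_diff_right inner_add_right face_normal_inner)
  then show ?thesis unfolding face_proj_def by simp
qed

lemma convex_prism: "convex (prism F)"
proof -
  have "prism F = (\<lambda>(x, t). x + t *\<^sub>R face_normal F) ` (F \<times> {0..1})" by (rule prism_eq_image)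
  moreover have "linear (\<lambda>(x, t). x + t *\<^sub>R face_normal F)"
    by (rule linearI) (auto simp: algebra_simps)
  ultimately show ?thesis
    using convex_linear_image convex_Times[OF convex_simplex[OF F]] convex_real_interval by metis
qed

text \<open>Otherwise the convex prism lies in a hyperplane with normal \<open>b\<close>. The edges
  of the prism make \<open>b\<close> orthogonal to \<open>face_normal F\<close>, so \<open>b\<close>
  is a direction of the hyperplane of \<open>F\<close>, on which the functional \<open>b\<close> is
  constant; thus \<open>b\<close> is orthogonal to itself.\<close>

lemma interior_prism: "interior (prism F) \<noteq> {}"
proof
  assume "interior (prism F) = {}"
  then obtain b c where b: "b \<noteq> 0" "prism F \<subseteq> {y. b \<bullet> y = c}"
    using empty_interior_subset_hyperplane[OF convex_prism] by blast
  let ?n = "face_normal F" and ?a = "face_base F"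
  have mem: "x + t *\<^sub>R ?n \<in> prism F" if "x \<in> F" "0 \<le> t" "t \<le> 1" for x t
    using that unfolding prism_def by auto
  have "b \<bullet> (?a + 0 *\<^sub>R ?n) = c" "b \<bullet> (?a + 1 *\<^sub>R ?n) = c"
    using b(2) mem[OF face_base_mem, of 0] mem[OF face_base_mem, of 1] by auto
  then have bn: "b \<bullet> ?n = 0" and ba: "b \<bullet> ?a = c" by (auto simp: inner_add_right)
  have "F \<subseteq> {y. b \<bullet> y = c}" using b(2) mem[of _ 0] by auto
  then have "affine hull F \<subseteq> {y. b \<bullet> y = c}" by (rule hull_minimal) (rule affine_hyperplane)
  moreover have "?a + b \<in> affine hull F"
    using affine_hull_face[OF F unit_normal_face_normal face_base_mem] bn
    by (simp add: inner_add_right inner_commute)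
  ultimately have "b \<bullet> b = 0" using ba by (auto simp: inner_add_right)
  then show False using b(1) by simp
qed

text \<open>The prism over \<open>F\<close> has interior points and therefore positive volume. This
  allows a constant jump to be recovered from its integral over the face.\<close>

lemma face_area_pos: "face_area F > 0"
proof -
  have cF: "compact F" using compact_simplex[OF F] .
  have "prism F \<noteq> {}" using interior_prism interior_subset by fastforce
  have all: "{y \<in> prism F. face_proj F y \<in> F} = prism F"
    using face_proj_prism unfolding prism_def by auto
  have "emeasure lborel (prism F) > 0"
  proof (rule ccontr)
    assume "\<not> emeasure lborel (prism F) > 0"
    then have "prism F \<in> null_sets lborel"
      using compact_prism[OF cF] by (auto simp: null_sets_def borel_compact)
    then have "negligible (prism F)"
      unfolding negligible_iff_null_sets using null_sets_completionI by blast
    then have "negligible (interior (prism F))" using negligible_subset interior_subset by blast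
    then show False using open_not_negligible[OF open_interior interior_prism] by blast
  qed
  then have "emeasure (face_measure F) F > 0"
    using emeasure_face_measure[OF cF, of F] all cF by (simp add: borel_compact)
  then show ?thesis
    unfolding face_area_def measure_def
    using emeasure_face_measure_finite[OF cF, of F] by (simp add: enn2real_positive_iff)
qed

text \<open>Prism points above the relative boundary of \<open>F\<close> lie on the frontier of the
  prism, since a ball inside the prism would project to a disc inside \<open>F\<close>. The frontier
  of a convex set is negligible.\<close>

lemma AE_face_rel_interior: "AE x in face_measure F. x \<in> rel_interior F"
proof -
  have cF: "compact F" using compact_simplex[OF F] .
  let ?n = "face_normal F"
  have rel: "rel_interior F = F - rel_frontier F"
    using rel_interior_subset[of F] compact_imp_closed[OF cF] unfolding rel_frontier_def by auto
  have "rel_interior F \<in> sets borel"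
    unfolding rel using cF compact_rel_frontier[OF cF] by (intro sets.Diff) (simp_all add: borel_compact)
  then have B: "- rel_interior F \<in> sets borel" by (rule borel_comp)
  have "{y \<in> prism F. face_proj F y \<in> - rel_interior F} \<subseteq> frontier (prism F)"
  proof
    fix y assume "y \<in> {y \<in> prism F. face_proj F y \<in> - rel_interior F}"
    then have y: "y \<in> prism F" and ny: "face_proj F y \<notin> rel_interior F" by auto
    then obtain x t where xt: "x \<in> F" "y = x + t *\<^sub>R ?n" unfolding prism_def by blast
    have nx: "x \<notin> rel_interior F" using ny xt face_proj_prism by simp
    have "y \<notin> interior (prism F)"
    proof
      assume "y \<in> interior (prism F)"
      then obtain r where r: "r > 0" "ball y r \<subseteq> prism F"
        using mem_interior by blast
      have "ball x r \<inter> affine hull F \<subseteq> F"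
      proof
        fix z assume z: "z \<in> ball x r \<inter> affine hull F"
        then have "z + t *\<^sub>R ?n \<in> ball y r" by (simp add: xt dist_norm)
        then obtain x' t' where x': "x' \<in> F" "z + t *\<^sub>R ?n = x' + t' *\<^sub>R ?n"
          using r unfolding prism_def by blast
        have "?n \<bullet> z = ?n \<bullet> x'"
          using z affine_hull_face[OF F unit_normal_face_normal x'(1)] by blast
        then have "t = t'"
          using arg_cong[OF x'(2), of "\<lambda>w. ?n \<bullet> w"] by (simp add: inner_add_right face_normal_inner)
        then show "z \<in> F" using x' by simp
      qed
      then show False using nx xt(1) r(1) mem_rel_interior_ball by blast
    qed
    then show "y \<in> frontier (prism F)" using y closure_subset unfolding frontier_def by blast
  qed
  then have "negligible {y \<in> prism F. face_proj F y \<in> - rel_interior F}"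
    using negligible_convex_frontier[OF convex_prism] negligible_subset by blast
  moreover have "{y \<in> prism F. face_proj F y \<in> - rel_interior F} \<in> sets borel"
  proof -
    have "{y \<in> prism F. face_proj F y \<in> - rel_interior F} = prism F \<inter> (face_proj F -` (- rel_interior F) \<inter> space borel)"
      by auto
    then show ?thesis
      using measurable_sets[OF face_proj_measurable B] compact_prism[OF cF] by (simp add: borel_compact sets.Int)
  qed
  ultimately have "emeasure lborel {y \<in> prism F. face_proj F y \<in> - rel_interior F} = 0"
    unfolding negligible_iff_null_sets by (simp add: null_sets_completion_iff null_setsD1)
  then have "- rel_interior F \<in> null_sets (face_measure F)"
    using emeasure_face_measure[OF cF B] B by (simp add: null_sets_def)
  then have "AE x in face_measure F. x \<notin> - rel_interior F" by (rule AE_not_in)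
  then show ?thesis by simp
qed

text \<open>Because the face has positive area, the almost everywhere clause in
  \<open>outward_normal\<close> yields a point at which the local picture of the face is
  available.\<close>

lemma AE_face_witness:
  assumes "AE x in face_measure F. P x"
  obtains x where "x \<in> rel_interior F" "P x"
proof -
  have "\<exists>x. x \<in> rel_interior F \<and> P x"
  proof (rule ccontr)
    assume none: "\<nexists>x. x \<in> rel_interior F \<and> P x"
    have "AE x in face_measure F. x \<in> rel_interior F \<and> P x"
      using AE_face_rel_interior assms by (rule AE_conjI)
    then have "AE x in face_measure F. x \<notin> F"
      by (rule eventually_mono) (use none in blast)
    moreover have "F \<in> sets (face_measure F)" using compact_simplex[OF F] by (simp add: borel_compact)
    ultimately have "emeasure (face_measure F) F = 0" using AE_iff_null_sets by blast
    then show False using face_area_pos unfolding face_area_def measure_def by simp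
  qed
  then show ?thesis using that by blast
qed

end

text \<open>Adding one direction raises the dimension by at most one, so the cylinder still fits
  into a hyperplane.\<close>

lemma negligible_cylinder:
  fixes G :: "(real^'n) set"
  assumes "aff_dim G < int CARD('n) - 1"
  shows "negligible {z + s *\<^sub>R e | z s. z \<in> G}"
proof (cases "G = {}")
  case False
  then obtain a where a: "a \<in> G" by blast
  let ?H = "affine hull (insert (a + e) G)"
  have "aff_dim (insert (a + e) G) < int DIM(real^'n)" using assms by (auto simp: aff_dim_insert)
  then have "aff_dim ?H < int DIM(real^'n)" by simp
  then obtain b c where bc: "b \<noteq> 0" "?H \<subseteq> {y. b \<bullet> y = c}" using aff_lowdim_subset_hyperplane by blast
  have "{z + s *\<^sub>R e | z s. z \<in> G} \<subseteq> ?H"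
  proof clarify
    fix z s assume "z \<in> G"
    then have "1 *\<^sub>R z + s *\<^sub>R (a + e) + (- s) *\<^sub>R a \<in> ?H"
      using a by (intro mem_affine_3 affine_affine_hull) (auto intro: hull_inc)
    then show "z + s *\<^sub>R e \<in> ?H" by (simp add: algebra_simps)
  qed
  then have "{z + s *\<^sub>R e | z s. z \<in> G} \<subseteq> {y. b \<bullet> y = c}" using bc(2) by blast
  moreover have "negligible {y. b \<bullet> y = c}" using negligible_hyperplane bc(1) by blast
  ultimately show ?thesis using negligible_subset by blast
qed simp

text \<open>A bounded set with interior points casts a shadow of full dimension along any direction, and
  the shadow is already cast by its frontier.\<close>

lemma frontier_not_in_rel_frontiers:
  fixes A :: "(real^'n) set"
  assumes A: "bounded A" "interior A \<noteq> {}"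
    and \<F>: "finite \<F>" "\<And>F. F \<in> \<F> \<Longrightarrow> (int CARD('n) - 1) simplex F"
  shows "\<not> frontier A \<subseteq> (\<Union>F\<in>\<F>. rel_frontier F)"
proof
  assume sub: "frontier A \<subseteq> (\<Union>F\<in>\<F>. rel_frontier F)"
  \<comment> \<open>Any direction serves; \<open>undefined\<close> merely names some
    coordinate.\<close>
  define e :: "real^'n" where "e = axis undefined 1"
  have e: "norm e = 1" unfolding e_def by simp
  have "interior A \<subseteq> (\<Union>F\<in>\<F>. \<Union>G\<in>{G. G facet_of F}. {z + s *\<^sub>R e | z s. z \<in> G})"
  proof
    fix y assume y: "y \<in> interior A"
    obtain B where B: "\<And>z. z \<in> A \<Longrightarrow> norm z \<le> B" using A(1) unfolding bounded_iff by blast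
    \<comment> \<open>The line through \<open>y\<close> in direction \<open>e\<close> leaves the
      bounded set \<open>A\<close> and so meets its frontier, that is, a facet of some face; this
      puts \<open>y\<close> into the cylinder over that facet.\<close>
    let ?L = "range (\<lambda>t. y + t *\<^sub>R e)"
    have "connected ?L" by (intro connected_continuous_image continuous_intros) simp
    moreover have "y + 0 *\<^sub>R e \<in> ?L \<inter> A" using y interior_subset by auto
    moreover have "y + (norm y + \<bar>B\<bar> + 1) *\<^sub>R e \<in> ?L - A"
    proof -
      have "norm ((norm y + \<bar>B\<bar> + 1) *\<^sub>R e) \<le> norm (y + (norm y + \<bar>B\<bar> + 1) *\<^sub>R e) + norm y"
        by (metis add_diff_cancel_left' norm_triangle_ineq4)
      then have "norm (y + (norm y + \<bar>B\<bar> + 1) *\<^sub>R e) > B" by (simp add: e)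
      then show ?thesis using B by force
    qed
    ultimately have "?L \<inter> frontier A \<noteq> {}" by (intro connected_Int_frontier) blast+
    then obtain t where "y + t *\<^sub>R e \<in> frontier A" by blast
    then obtain F where F: "F \<in> \<F>" "y + t *\<^sub>R e \<in> rel_frontier F" using sub by blast
    then obtain G where G: "G facet_of F" "y + t *\<^sub>R e \<in> G"
      using rel_frontier_of_polyhedron[OF simplex_imp_polyhedron[OF \<F>(2)[OF F(1)]]] by blast
    have "y = (y + t *\<^sub>R e) + (- t) *\<^sub>R e" by simp
    then show "y \<in> (\<Union>F\<in>\<F>. \<Union>G\<in>{G. G facet_of F}. {z + s *\<^sub>R e | z s. z \<in> G})"
      using F(1) G by blast
  qed
  moreover have "negligible (\<Union>F\<in>\<F>. \<Union>G\<in>{G. G facet_of F}. {z + s *\<^sub>R e | z s. z \<in> G})"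
  proof (intro negligible_Union finite_imageI \<F>(1); clarify)
    fix F assume F: "F \<in> \<F>"
    have fin: "finite {G. G facet_of F}"
      by (rule finite_polyhedron_facets[OF simplex_imp_polyhedron[OF \<F>(2)[OF F]]])
    show "negligible (\<Union>G\<in>{G. G facet_of F}. {z + s *\<^sub>R e | z s. z \<in> G})"
    proof (intro negligible_Union finite_imageI fin; clarify)
      fix G assume "G facet_of F"
      then have "aff_dim G = int CARD('n) - 1 - 1"
        unfolding facet_of_def using aff_dim_simplex[OF \<F>(2)[OF F]] by simp
      then show "negligible {z + s *\<^sub>R e | z s. z \<in> G}" by (intro negligible_cylinder) simp
    qed
  qed
  ultimately have "negligible (interior A)" using negligible_subset by blast
  then show False using open_not_negligible[OF open_interior A(2)] by blast
qed

section \<open>Definiteness of the form\<close>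

text \<open>From the face-simplex condition \<open>face_simplex\<close> keeps what is needed for the
  local picture of a single face: a simplex inside the element that has the face on its
  boundary.\<close>

locale dg_coercive = dg_level \<Omega> D C\<sigma> j
  for \<Omega> :: "(real^'n) set" and D :: "'n discretization" and C\<sigma> :: "nat \<Rightarrow> real" and j :: nat +
  assumes degree_pos: "deg D j \<ge> 1" and penalty_pos: "C\<sigma> j > 0"
    and face_simplex: "\<And>\<kappa> F. \<kappa> \<in> mesh D j \<Longrightarrow> F \<in> faces D j \<Longrightarrow> F \<subseteq> frontier \<kappa> \<Longrightarrow>
      \<exists>S. (int CARD('n) simplex S) \<and> interior S \<subseteq> \<kappa> \<and> F \<subseteq> frontier S"
    and coercive: "\<exists>c>0. \<forall>v\<in>dg_space \<Omega> D j.
      dg_form C\<sigma> D j v v \<ge> c * (dg_norm C\<sigma> D j v (grad v))\<^sup>2"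
begin

lemma finite_neighbours: "finite (neighbours T F)"
  unfolding neighbours_def using finite_mesh by simp

lemma card_neighbours:
  assumes "F \<in> \<F>"
  shows "\<not> F \<subseteq> frontier \<Omega> \<and> card (neighbours T F) = 2 \<or> F \<subseteq> frontier \<Omega> \<and> card (neighbours T F) = 1"
  using is_face_set assms unfolding is_face_set_def by blast

text \<open>The element may be nonconvex, but the simplex supplied for the face is convex, and being
  one-sided passes from its interior to the larger element.\<close>

lemma ex_one_sided_element:
  assumes F: "F \<in> \<F>" and \<kappa>: "\<kappa> \<in> neighbours T F"
  shows "\<exists>n. one_sided \<kappa> F n"
proof -
  obtain S where S: "int CARD('n) simplex S" "interior S \<subseteq> \<kappa>" "F \<subseteq> frontier S"
    using face_simplex[OF _ F] neighboursD[OF \<kappa>] by blast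
  have cS: "convex S" "closed S" using convex_simplex[OF S(1)] closed_simplex[OF S(1)] .
  have dim: "aff_dim S = int DIM(real^'n)" using aff_dim_simplex[OF S(1)] by simp
  have "S \<noteq> {}"
  proof
    assume "S = {}"
    then show False using aff_dim_simplex[OF S(1)] by simp
  qed
  then have "interior S \<noteq> {}"
    using interior_rel_interior[OF dim] rel_interior_eq_empty[OF cS(1)] by simp
  then show ?thesis using ex_one_sided[OF face(1)[OF F] cS _ S(3)] one_sided_mono[OF _ S(2)] by blast
qed

lemma ex_rel_interior_face:
  assumes "F \<in> \<F>"
  obtains x where "x \<in> rel_interior F"
  using rel_interior_eq_empty[OF face(3)[OF assms]] face_simplex_nonempty[OF face(1)[OF assms]] by blast

lemma one_sided_not_both:
  assumes "one_sided \<kappa> F n" "x \<in> rel_interior F"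
    and "\<forall>\<^sub>F t in at_right (0::real). x - t *\<^sub>R n \<in> \<kappa>'" "\<kappa> \<in> T" "\<kappa>' \<in> T"
  shows "\<kappa> = \<kappa>'"
proof -
  have "\<forall>\<^sub>F t in at_right (0::real). x - t *\<^sub>R n \<in> \<kappa> \<and> x - t *\<^sub>R n \<in> \<kappa>'"
    using one_sidedD[OF assms(1,2)] assms(3) by (rule eventually_conj)
  then obtain t where "x - t *\<^sub>R n \<in> \<kappa>" "x - t *\<^sub>R n \<in> \<kappa>'"
    using eventually_happens[of _ "at_right (0::real)"] by fastforce
  then show ?thesis using element_unique assms(4,5) by blast
qed

text \<open>With equal normals, both elements would contain the same points just inside the face,
  although they are disjoint.\<close>

lemma one_sided_opposite:
  assumes F: "F \<in> \<F>" and \<kappa>: "\<kappa> \<in> T" "\<kappa>' \<in> T" "\<kappa> \<noteq> \<kappa>'"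
    and n: "one_sided \<kappa> F n" "one_sided \<kappa>' F n'"
  shows "n' = - n"
proof (rule ccontr)
  assume "n' \<noteq> - n"
  then have eq: "n' = n" using unit_normal_unique[OF face(1)[OF F]] n unfolding one_sided_def by blast
  obtain x where x: "x \<in> rel_interior F" using ex_rel_interior_face[OF F] .
  have "\<kappa> = \<kappa>'" by (rule one_sided_not_both[OF n(1) x one_sidedD[OF n(2)[unfolded eq] x] \<kappa>(1,2)])
  then show False using \<kappa>(3) by simp
qed

text \<open>The only rival of \<open>n\<close> is its negative. At a boundary face, both together
  would make a boundary point the midpoint of two points of the convex open domain; at an interior
  face, the side beyond is occupied by the other neighbour.\<close>

lemma outward_normal_eq:
  assumes F: "F \<in> \<F>" and \<kappa>: "\<kappa> \<in> neighbours T F" and n: "one_sided \<kappa> F n"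
  shows "outward_normal \<kappa> F = n"
  unfolding outward_normal_def
proof (rule the_equality)
  have un: "unit_normal F n" using n unfolding one_sided_def by blast
  then have ex: "\<exists>n. unit_normal F n" by blast
  have "AE x in face_measure F. \<forall>\<^sub>F t in at_right 0. x - t *\<^sub>R n \<in> \<kappa>"
    by (rule eventually_mono[OF AE_face_rel_interior[OF face(1)[OF F] ex]]) (rule one_sidedD[OF n])
  then show "unit_normal F n \<and> (AE x in face_measure F. \<forall>\<^sub>F t in at_right 0. x - t *\<^sub>R n \<in> \<kappa>)"
    using un by blast
  fix m assume m: "unit_normal F m \<and> (AE x in face_measure F. \<forall>\<^sub>F t in at_right 0. x - t *\<^sub>R m \<in> \<kappa>)"
  show "m = n"
  proof (rule ccontr)
    assume "m \<noteq> n"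
    then have mn: "m = - n" using unit_normal_unique[OF face(1)[OF F] un] m by blast
    obtain x where x: "x \<in> rel_interior F" and xm: "\<forall>\<^sub>F t in at_right 0. x - t *\<^sub>R m \<in> \<kappa>"
      using AE_face_witness[OF face(1)[OF F] ex conjunct2[OF m]] by blast
    have \<kappa>T: "\<kappa> \<in> T" using neighboursD[OF \<kappa>] by blast
    consider "F \<subseteq> frontier \<Omega>" | "card (neighbours T F) = 2" using card_neighbours[OF F] by blast
    then show False
    proof cases
      case 1
      have "\<forall>\<^sub>F t in at_right 0. x - t *\<^sub>R m \<in> \<kappa> \<and> x - t *\<^sub>R n \<in> \<kappa>"
        using xm one_sidedD[OF n x] by (rule eventually_conj)
      then obtain t where "x - t *\<^sub>R m \<in> \<kappa>" "x - t *\<^sub>R n \<in> \<kappa>"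
        using eventually_happens[of _ "at_right (0::real)"] by fastforce
      then have t: "x + t *\<^sub>R n \<in> \<Omega>" "x - t *\<^sub>R n \<in> \<Omega>" using element_subset[OF \<kappa>T] by (auto simp: mn)
      have "convex \<Omega>" "open \<Omega>" using domain unfolding convex_polytopal_domain_def by blast+
      then have "(1 / 2) *\<^sub>R (x + t *\<^sub>R n) + (1 / 2) *\<^sub>R (x - t *\<^sub>R n) \<in> \<Omega>"
        using convexD[OF _ t, of "1 / 2" "1 / 2"] by simp
      moreover have "(1 / 2) *\<^sub>R (x + t *\<^sub>R n) + (1 / 2) *\<^sub>R (x - t *\<^sub>R n) = x"
        by (simp add: algebra_simps scaleR_add_left[symmetric])
      ultimately have "x \<in> \<Omega>" by simp
      moreover have "x \<in> frontier \<Omega>" using 1 x rel_interior_subset by blast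
      ultimately show False using \<open>open \<Omega>\<close> by (simp add: frontier_def interior_open)
    next
      case 2
      then have "neighbours T F \<noteq> {\<kappa>}" by auto
      then obtain \<kappa>' where \<kappa>': "\<kappa>' \<in> neighbours T F" "\<kappa>' \<noteq> \<kappa>" using \<kappa> by blast
      have \<kappa>'T: "\<kappa>' \<in> T" using neighboursD[OF \<kappa>'(1)] by blast
      obtain n' where n': "one_sided \<kappa>' F n'" using ex_one_sided_element[OF F \<kappa>'(1)] by blast
      have "n' = m" using one_sided_opposite[OF F \<kappa>T \<kappa>'T \<kappa>'(2)[symmetric] n n'] mn by simp
      then have "\<kappa>' = \<kappa>" using one_sided_not_both[OF n' x _ \<kappa>'T \<kappa>T] xm by simp
      then show False using \<kappa>'(2) by simp
    qed
  qed
qed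

lemma diameter_element_pos:
  assumes "\<kappa> \<in> T"
  shows "diameter \<kappa> > 0"
proof -
  obtain x r where r: "r > 0" "ball x r \<subseteq> \<kappa>"
    using element(1,2)[OF assms] open_contains_ball by (metis ex_in_conv)
  have "diameter (ball x r) \<le> diameter \<kappa>" by (rule diameter_subset[OF r(2) element(4)[OF assms]])
  then show ?thesis using r(1) by simp
qed

lemma face_penalty_pos:
  assumes "F \<in> \<F>"
  shows "penalty C\<sigma> D j F > 0"
proof -
  let ?S = "(\<lambda>\<kappa>. (real (deg D j))\<^sup>2 / diameter \<kappa>) ` neighbours T F"
  have "neighbours T F \<noteq> {}" using card_neighbours[OF assms] by auto
  then have "Max ?S \<in> ?S" using finite_neighbours by (intro Max_in) auto
  then have "Max ?S > 0" using diameter_element_pos neighboursD degree_pos by auto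
  then show ?thesis unfolding penalty_def using penalty_pos by simp
qed

text \<open>All summands of the squared norm are nonnegative and so vanish. A zero gradient on a
  connected element gives a constant; the jump is then constant along a face, and its integral is a
  positive multiple of its squared length.\<close>

lemma dg_norm_zero_imp_piecewise_constant:
  assumes v: "v \<in> V" and zero: "dg_norm C\<sigma> D j v (grad v) = 0"
  shows "\<exists>c. (\<forall>\<kappa>\<in>T. \<forall>x\<in>\<kappa>. v x = c \<kappa>) \<and>
    (\<forall>F\<in>\<F>. (\<Sum>\<kappa>\<in>neighbours T F. c \<kappa> *\<^sub>R outward_normal \<kappa> F) = 0)"
proof -
  let ?X = "\<lambda>\<kappa>. LINT x:\<kappa>|lebesgue. (norm (grad v x))\<^sup>2"
  let ?Y = "\<lambda>F. LINT x:F|face_measure F. penalty C\<sigma> D j F * (norm (jump D j F v x))\<^sup>2"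
  have X: "?X \<kappa> \<ge> 0" for \<kappa>
    unfolding set_lebesgue_integral_def by (intro Bochner_Integration.integral_nonneg) simp
  have Y: "?Y F \<ge> 0" if "F \<in> \<F>" for F
    unfolding set_lebesgue_integral_def using face_penalty_pos[OF that]
    by (intro Bochner_Integration.integral_nonneg) simp
  have fin: "finite \<F>" using is_face_set unfolding is_face_set_def by blast
  have "sum ?X T + sum ?Y \<F> = 0" using zero unfolding dg_norm_def by simp
  moreover have "sum ?X T \<ge> 0" "sum ?Y \<F> \<ge> 0" using X Y by (auto intro: sum_nonneg)
  ultimately have "sum ?X T = 0" "sum ?Y \<F> = 0" by linarith+
  then have X0: "?X \<kappa> = 0" if "\<kappa> \<in> T" for \<kappa>
    using sum_nonneg_eq_0_iff[of T ?X] finite_mesh X that by blast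
  have Y0: "?Y F = 0" if "F \<in> \<F>" for F
    using sum_nonneg_eq_0_iff[of \<F> ?Y] fin Y that \<open>sum ?Y \<F> = 0\<close> by blast
  have "\<exists>c. \<forall>x\<in>\<kappa>. v x = c" if \<kappa>: "\<kappa> \<in> T" for \<kappa>
  proof -
    obtain q where q: "C1 q" "\<And>x. x \<in> \<kappa> \<Longrightarrow> v x = q x" using dg_space_piece[OF v \<kappa>] by blast
    have "(LINT x:\<kappa>|lebesgue. (norm (grad q x))\<^sup>2) = ?X \<kappa>"
      using grad_piece[OF \<kappa> q] sets_element[OF \<kappa>] by (intro set_lebesgue_integral_cong) auto
    then have le: "(LINT x:\<kappa>|lebesgue. (norm (grad q x))\<^sup>2) \<le> 0" using X0[OF \<kappa>] by simp
    have gq: "grad q x = 0" if x: "x \<in> \<kappa>" for x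
    proof -
      have "(norm (grad q x))\<^sup>2 = 0"
        by (rule set_integral_zero_continuous[OF _ element(4,1)[OF \<kappa>] _ le x])
          (use q(1) in \<open>auto simp: C1_def intro!: continuous_intros\<close>)
      then show ?thesis by simp
    qed
    have "(q has_derivative (\<lambda>h. 0)) (at x)" if x: "x \<in> \<kappa>" for x
    proof -
      have "q differentiable at x" using q(1) unfolding C1_def by blast
      from has_derivative_grad[OF this] show ?thesis unfolding gq[OF x] by simp
    qed
    then have "q x = q y" if "x \<in> \<kappa>" "y \<in> \<kappa>" for x y
      using has_derivative_zero_unique_connected[OF element(1,3)[OF \<kappa>]] that by blast
    moreover obtain y where "y \<in> \<kappa>" using element(2)[OF \<kappa>] by blast
    ultimately have "\<forall>x\<in>\<kappa>. v x = q y" using q(2) by metis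
    then show ?thesis by blast
  qed
  then have "\<forall>\<kappa>\<in>T. \<exists>c. \<forall>x\<in>\<kappa>. v x = c" by blast
  then obtain c where c: "\<forall>\<kappa>\<in>T. \<forall>x\<in>\<kappa>. v x = c \<kappa>" using bchoice by meson
  have "(\<Sum>\<kappa>\<in>neighbours T F. c \<kappa> *\<^sub>R outward_normal \<kappa> F) = 0" if F: "F \<in> \<F>" for F
  proof -
    let ?w = "\<Sum>\<kappa>\<in>neighbours T F. c \<kappa> *\<^sub>R outward_normal \<kappa> F"
    have jump: "jump D j F v x = ?w" if x: "x \<in> F" for x
      unfolding jump_def
    proof (rule sum.cong[OF refl])
      fix \<kappa> assume "\<kappa> \<in> neighbours T F"
      then have \<kappa>: "\<kappa> \<in> T" "x \<in> closure \<kappa>" using neighboursD x by blast+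
      have "bdry_trace \<kappa> v x = c \<kappa>"
        by (rule trace_piece(1)[OF \<kappa>(1) C1_const _ \<kappa>(2)]) (use c \<kappa>(1) in blast)
      then show "bdry_trace \<kappa> v x *\<^sub>R outward_normal \<kappa> F = c \<kappa> *\<^sub>R outward_normal \<kappa> F" by simp
    qed
    have FB: "F \<in> sets (face_measure F)" using face(2)[OF F] by (simp add: borel_compact)
    obtain \<kappa> where "\<kappa> \<in> neighbours T F" using card_neighbours[OF F] by fastforce
    then have ex: "\<exists>n. unit_normal F n" using ex_one_sided_element[OF F] unfolding one_sided_def by blast
    have "?Y F = (LINT x:F|face_measure F. penalty C\<sigma> D j F * (norm ?w)\<^sup>2)"
      using jump FB by (intro set_lebesgue_integral_cong) auto
    also have "\<dots> = face_area F * (penalty C\<sigma> D j F * (norm ?w)\<^sup>2)"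
      using emeasure_face_measure_finite[OF face(2)[OF F], of F] FB
      by (simp add: set_lebesgue_integral_def face_area_def)
    finally show ?thesis
      using Y0[OF F] face_area_pos[OF face(1)[OF F] ex] face_penalty_pos[OF F] by simp
  qed
  then show ?thesis using c by blast
qed

lemma dg_norm_zero_imp_zero:
  assumes v: "v \<in> V" and zero: "dg_norm C\<sigma> D j v (grad v) = 0"
  shows "v = (\<lambda>x. 0)"
proof -
  obtain c where c: "\<And>\<kappa> x. \<kappa> \<in> T \<Longrightarrow> x \<in> \<kappa> \<Longrightarrow> v x = c \<kappa>"
    and jump: "\<And>F. F \<in> \<F> \<Longrightarrow> (\<Sum>\<kappa>\<in>neighbours T F. c \<kappa> *\<^sub>R outward_normal \<kappa> F) = 0"
    using dg_norm_zero_imp_piecewise_constant[OF assms] by blast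
  have "c \<kappa>0 = 0" if \<kappa>0: "\<kappa>0 \<in> T" for \<kappa>0
  proof (rule ccontr)
    assume nz: "c \<kappa>0 \<noteq> 0"
    \<comment> \<open>Elements of \<open>U\<close> need not be adjacent: only the frontier of their
      union matters.\<close>
    define U where "U = {\<kappa>\<in>T. c \<kappa> = c \<kappa>0}"
    define A where "A = (\<Union>\<kappa>\<in>U. closure \<kappa>)"
    have U: "finite U" "U \<subseteq> T" "\<kappa>0 \<in> U" unfolding U_def using finite_mesh \<kappa>0 by auto
    have A: "bounded A" "closed A"
      unfolding A_def using U element(4) by (auto intro!: bounded_UN closed_UN bounded_closure)
    have sub: "\<kappa> \<subseteq> interior A" if "\<kappa> \<in> U" for \<kappa>
    proof (rule interior_maximal)
      show "\<kappa> \<subseteq> A" unfolding A_def using that closure_subset[of \<kappa>] by blast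
      show "open \<kappa>" using that U(2) element(1) by blast
    qed
    then have "interior A \<noteq> {}" using U(3) element(2)[OF \<kappa>0] by blast
    have "frontier A \<subseteq> (\<Union>F\<in>\<F>. rel_frontier F)"
    proof
      fix x assume x: "x \<in> frontier A"
      then have "x \<in> A" and nint: "x \<notin> interior A" using A(2) unfolding frontier_def by auto
      then obtain \<kappa> where \<kappa>: "\<kappa> \<in> U" "x \<in> closure \<kappa>" unfolding A_def by blast
      have \<kappa>T: "\<kappa> \<in> T" and c\<kappa>: "c \<kappa> \<noteq> 0" using \<kappa>(1) nz unfolding U_def by auto
      have "x \<notin> \<kappa>" using nint sub[OF \<kappa>(1)] by blast
      then have "x \<in> frontier \<kappa>" using \<kappa>(2) element(1)[OF \<kappa>T] unfolding frontier_def by (simp add: interior_open)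
      moreover have "frontier \<kappa> = \<Union>{F\<in>\<F>. F \<subseteq> frontier \<kappa>}"
        using is_face_set \<kappa>T unfolding is_face_set_def by blast
      ultimately obtain F where F: "F \<in> \<F>" "F \<subseteq> frontier \<kappa>" "x \<in> F" by blast
      have \<kappa>F: "\<kappa> \<in> neighbours T F" unfolding neighbours_def using \<kappa>T F(2) by blast
      obtain n where n: "one_sided \<kappa> F n" using ex_one_sided_element[OF F(1) \<kappa>F] by blast
      have on: "outward_normal \<kappa> F = n" by (rule outward_normal_eq[OF F(1) \<kappa>F n])
      have n0: "n \<noteq> 0" using n unfolding one_sided_def unit_normal_def by auto
      \<comment> \<open>With a single neighbour the jump would be
        \<open>c \<kappa> *\<^sub>R n\<close>, which is nonzero.\<close>
      have "neighbours T F \<noteq> {\<kappa>}"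
        using jump[OF F(1)] c\<kappa> n0 on by auto
      then obtain \<kappa>' where \<kappa>'F: "\<kappa>' \<in> neighbours T F" "\<kappa>' \<noteq> \<kappa>" using \<kappa>F by blast
      have card2: "card (neighbours T F) = 2"
      proof -
        have "card {\<kappa>, \<kappa>'} \<le> card (neighbours T F)"
          using \<kappa>F \<kappa>'F(1) by (intro card_mono finite_neighbours) auto
        then show ?thesis using card_neighbours[OF F(1)] \<kappa>'F(2) by auto
      qed
      have "{\<kappa>, \<kappa>'} = neighbours T F"
        by (rule card_subset_eq[OF finite_neighbours]) (use \<kappa>F \<kappa>'F card2 in auto)
      then have nb: "neighbours T F = {\<kappa>, \<kappa>'}" ..
      obtain n' where n': "one_sided \<kappa>' F n'" using ex_one_sided_element[OF F(1) \<kappa>'F(1)] by blast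
      have \<kappa>'T: "\<kappa>' \<in> T" using neighboursD[OF \<kappa>'F(1)] by blast
      have n'_eq: "n' = - n" by (rule one_sided_opposite[OF F(1) \<kappa>T \<kappa>'T \<kappa>'F(2)[symmetric] n n'])
      have on': "outward_normal \<kappa>' F = - n" using outward_normal_eq[OF F(1) \<kappa>'F(1) n'] n'_eq by simp
      \<comment> \<open>The opposite normals turn the vanishing vector jump into equality of the two
        values.\<close>
      have "(c \<kappa> - c \<kappa>') *\<^sub>R n = 0"
        using jump[OF F(1)] \<kappa>'F(2) unfolding nb by (simp add: on on' algebra_simps)
      then have "c \<kappa>' = c \<kappa>" using n0 by simp
      then have \<kappa>'U: "\<kappa>' \<in> U" using \<kappa>(1) \<kappa>'T unfolding U_def by simp
      have "x \<notin> rel_interior F"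
      proof
        assume xr: "x \<in> rel_interior F"
        obtain r where r: "r > 0" "\<And>y. y \<in> ball x r \<Longrightarrow> (n \<bullet> y < n \<bullet> x \<longrightarrow> y \<in> \<kappa>) \<and> (n \<bullet> y = n \<bullet> x \<longrightarrow> y \<in> F)"
          using n xr unfolding one_sided_def by meson
        obtain r' where r': "r' > 0" "\<And>y. y \<in> ball x r' \<Longrightarrow> n' \<bullet> y < n' \<bullet> x \<longrightarrow> y \<in> \<kappa>'"
          using n' xr unfolding one_sided_def by meson
        \<comment> \<open>Two half balls, one in each neighbour, and the dividing disc in
          \<open>F\<close> fill a ball, so \<open>x\<close> would be interior to
          \<open>A\<close>.\<close>
        have "ball x (min r r') \<subseteq> A"
        proof
          fix y assume "y \<in> ball x (min r r')"
          then have y: "y \<in> ball x r" "y \<in> ball x r'" by auto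
          consider "n \<bullet> y < n \<bullet> x" | "n' \<bullet> y < n' \<bullet> x" | "n \<bullet> y = n \<bullet> x"
            unfolding n'_eq by fastforce
          then show "y \<in> A"
          proof cases
            case 1
            then have "y \<in> \<kappa>" using r(2)[OF y(1)] by blast
            then show ?thesis using sub[OF \<kappa>(1)] interior_subset by blast
          next
            case 2
            then have "y \<in> \<kappa>'" using r'(2)[OF y(2)] by blast
            then show ?thesis using sub[OF \<kappa>'U] interior_subset by blast
          next
            case 3
            then have "y \<in> F" using r(2)[OF y(1)] by blast
            then have "y \<in> closure \<kappa>" using neighboursD[OF \<kappa>F] by blast
            then show ?thesis using \<kappa>(1) unfolding A_def by blast
          qed
        qed
        then show False using nint r(1) r'(1) mem_interior by fastforce
      qed
      then have "x \<in> rel_frontier F" using F(3) closure_subset unfolding rel_frontier_def by blast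
      then show "x \<in> (\<Union>F\<in>\<F>. rel_frontier F)" using F(1) by blast
    qed
    moreover have "finite \<F>" using is_face_set unfolding is_face_set_def by blast
    ultimately show False
      using frontier_not_in_rel_frontiers[OF A(1) \<open>interior A \<noteq> {}\<close>] face(1) by blast
  qed
  then have "v x = 0" for x
    using c dg_space_outside[OF v] by (cases "x \<in> \<Union>T") auto
  then show ?thesis by (rule ext)
qed

lemma dg_form_nonneg:
  assumes "v \<in> V"
  shows "\<A> v v \<ge> 0"
proof -
  obtain c where "c > 0" "\<A> v v \<ge> c * (dg_norm C\<sigma> D j v (grad v))\<^sup>2" using coercive assms by blast
  moreover have "c * (dg_norm C\<sigma> D j v (grad v))\<^sup>2 \<ge> 0" using \<open>c > 0\<close> by simp
  ultimately show ?thesis by linarith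
qed

lemma dg_form_pos_def: "pos_def_form \<A>"
  unfolding pos_def_form_def
proof (intro conjI ballI impI dg_form_symmetric)
  fix v assume v: "v \<in> V" and nz: "v \<noteq> (\<lambda>x. 0)"
  obtain c where c: "c > 0" "\<A> v v \<ge> c * (dg_norm C\<sigma> D j v (grad v))\<^sup>2" using coercive v by blast
  have "dg_norm C\<sigma> D j v (grad v) \<noteq> 0" using dg_norm_zero_imp_zero[OF v] nz by blast
  then have "c * (dg_norm C\<sigma> D j v (grad v))\<^sup>2 > 0" using c(1) by simp
  then show "\<A> v v > 0" using c(2) by linarith
qed

section \<open>The smoother\<close>

lemma linear_functional_right: "symmetric_form f \<Longrightarrow> w \<in> V \<Longrightarrow> linear_functional (f w)"
  unfolding linear_functional_def using form_lin_right by blast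

lemma dg_operator:
  assumes "u \<in> V"
  shows "dg_operator \<Omega> C\<sigma> D j u \<in> V"
    and "\<And>v. v \<in> V \<Longrightarrow> l2_inner \<Omega> (dg_operator \<Omega> C\<sigma> D j u) v = \<A> u v"
  using theI'[OF Riesz_representation[OF l2_inner_pos_def linear_functional_right[OF dg_form_symmetric assms]]]
  unfolding dg_operator_def by blast+

lemma dg_operator_unique:
  assumes "u \<in> V" "w \<in> V" "\<And>v. v \<in> V \<Longrightarrow> l2_inner \<Omega> w v = \<A> u v"
  shows "dg_operator \<Omega> C\<sigma> D j u = w"
  unfolding dg_operator_def
  by (rule the1_equality[OF Riesz_representation[OF l2_inner_pos_def linear_functional_right[OF dg_form_symmetric assms(1)]]])
    (use assms in blast)

lemma dg_operator_add:
  assumes u: "u \<in> V" and v: "v \<in> V"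
  shows "dg_operator \<Omega> C\<sigma> D j (\<lambda>x. u x + v x)
    = (\<lambda>x. dg_operator \<Omega> C\<sigma> D j u x + dg_operator \<Omega> C\<sigma> D j v x)"
proof (rule dg_operator_unique[OF add_mem[OF u v] add_mem[OF dg_operator(1)[OF u] dg_operator(1)[OF v]]])
  fix w assume w: "w \<in> V"
  show "l2_inner \<Omega> (\<lambda>x. dg_operator \<Omega> C\<sigma> D j u x + dg_operator \<Omega> C\<sigma> D j v x) w = \<A> (\<lambda>x. u x + v x) w"
    using form_lin_left[OF l2_inner_symmetric_form dg_operator(1)[OF u] dg_operator(1)[OF v] w, of 1 1]
      form_lin_left[OF dg_form_symmetric u v w, of 1 1] dg_operator(2)[OF u w] dg_operator(2)[OF v w]
    by simp
qed

lemma energy_norm_eq: "v \<in> V \<Longrightarrow> energy_norm \<Omega> C\<sigma> D 1 j v = sqrt (\<A> v v)"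
  unfolding energy_norm_def using dg_operator(2)[of v v] by simp

lemma energy_norm_zero: "energy_norm \<Omega> C\<sigma> D 1 j (\<lambda>x. 0) = 0"
  using energy_norm_eq[OF zero_mem] form_zero_left[OF dg_form_symmetric zero_mem] by simp

lemma energy_norm_nonneg: "v \<in> V \<Longrightarrow> energy_norm \<Omega> C\<sigma> D 1 j v \<ge> 0"
  using energy_norm_eq dg_form_nonneg by simp

lemma energy_norm_triangle:
  "u \<in> V \<Longrightarrow> v \<in> V \<Longrightarrow>
    energy_norm \<Omega> C\<sigma> D 1 j (\<lambda>x. u x + v x) \<le> energy_norm \<Omega> C\<sigma> D 1 j u + energy_norm \<Omega> C\<sigma> D 1 j v"
  using form_triangle[OF dg_form_symmetric dg_form_nonneg] energy_norm_eq add_mem by simp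

end

locale dg_smoother = dg_coercive \<Omega> D C\<sigma> j
  for \<Omega> :: "(real^'n) set" and D :: "'n discretization" and C\<sigma> :: "nat \<Rightarrow> real" and j :: nat +
  assumes spectral_bound: "\<And>c. is_eigenvalue \<Omega> C\<sigma> D j c \<Longrightarrow> \<bar>c\<bar> \<le> smooth_par D j"
begin

abbreviation "G \<equiv> smoother \<Omega> C\<sigma> D j"

text \<open>An eigenvector of the DG form relative to the L2 inner product is an eigenfunction of
  \<open>dg_operator\<close>, so the eigenvalue bound passes to the quadratic forms.\<close>

lemma dg_form_le:
  assumes "v \<in> V"
  shows "\<A> v v \<le> smooth_par D j * l2_inner \<Omega> v v"
proof (rule Rayleigh_bound[OF l2_inner_pos_def dg_form_symmetric _ assms])
  fix c w assume w: "w \<in> V" "w \<noteq> (\<lambda>x. 0)" and eq: "\<forall>v\<in>V. \<A> w v = c * l2_inner \<Omega> w v"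
  have "dg_operator \<Omega> C\<sigma> D j w = (\<lambda>x. c * w x)"
  proof (rule dg_operator_unique[OF w(1) scale_mem[OF w(1)]])
    fix v assume v: "v \<in> V"
    show "l2_inner \<Omega> (\<lambda>x. c * w x) v = \<A> w v"
      using form_lin_left[OF l2_inner_symmetric_form w(1) w(1) v, of c 0] eq v by simp
  qed
  then have "is_eigenvalue \<Omega> C\<sigma> D j c" unfolding is_eigenvalue_def using w by blast
  then show "c \<le> smooth_par D j" using spectral_bound by force
qed

lemma smoother_mem: "v \<in> V \<Longrightarrow> G v \<in> V"
  unfolding smoother_def using lin_mem[of v "dg_operator \<Omega> C\<sigma> D j v" 1 "- inverse (smooth_par D j)"] dg_operator(1)
  by simp

lemma smoother_add: "u \<in> V \<Longrightarrow> v \<in> V \<Longrightarrow> G (\<lambda>x. u x + v x) = (\<lambda>x. G u x + G v x)"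
  unfolding smoother_def by (simp add: dg_operator_add algebra_simps)

text \<open>Expand the energy of \<open>v\<close> minus \<open>w / L\<close>, where \<open>w\<close>
  is A_j applied to \<open>v\<close>: the mixed term is \<open>- 2 * N / L\<close> with
  \<open>N\<close> the squared L2 norm of \<open>w\<close>, and the quadratic term is at most
  \<open>N / L\<close>.\<close>

lemma smoother_energy:
  assumes v: "v \<in> V"
  shows "energy_norm \<Omega> C\<sigma> D 1 j (G v) \<le> energy_norm \<Omega> C\<sigma> D 1 j v"
proof -
  define L where "L = smooth_par D j"
  define w where "w = dg_operator \<Omega> C\<sigma> D j v"
  define N where "N = l2_inner \<Omega> w w"
  have w: "w \<in> V" unfolding w_def by (rule dg_operator(1)[OF v])
  have vw: "\<A> v w = N" unfolding N_def using dg_operator(2)[OF v w] by (simp add: w_def)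
  have ww: "\<A> w w \<le> L * N" "\<A> w w \<ge> 0" using dg_form_le[OF w] dg_form_nonneg[OF w] unfolding N_def L_def .
  \<comment> \<open>This form also covers \<open>L = 0\<close>, where the inverse is 0 and the
    smoother is the identity. The sign of \<open>inverse L * N\<close> then follows from that of the
    energy of \<open>w\<close>.\<close>
  have LL: "inverse L = L * (inverse L)\<^sup>2" by (cases "L = 0") (auto simp: power2_eq_square)
  then have LN: "inverse L * N = (inverse L)\<^sup>2 * (L * N)" by (metis mult.assoc mult.commute)
  have 1: "inverse L * N \<ge> 0" "(inverse L)\<^sup>2 * \<A> w w \<le> inverse L * N"
    unfolding LN using ww by (auto intro!: mult_left_mono mult_nonneg_nonneg[of "(inverse L)\<^sup>2"])
  have "\<A> (G v) (G v) = \<A> v v - 2 * inverse L * N + (inverse L)\<^sup>2 * \<A> w w"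
    using form_quadratic[OF dg_form_symmetric v w, of 1 "- inverse L"]
    by (simp add: smoother_def w_def[symmetric] L_def[symmetric] vw)
  then have "\<A> (G v) (G v) \<le> \<A> v v" using 1 by linarith
  then show ?thesis using energy_norm_eq[OF v] energy_norm_eq[OF smoother_mem[OF v]] by simp
qed

lemma smoother_power_mem: "v \<in> V \<Longrightarrow> (G ^^ m) v \<in> V"
  by (induction m) (auto intro: smoother_mem)

lemma smoother_power_add:
  "u \<in> V \<Longrightarrow> v \<in> V \<Longrightarrow> (G ^^ m) (\<lambda>x. u x + v x) = (\<lambda>x. (G ^^ m) u x + (G ^^ m) v x)"
  by (induction m) (auto simp: smoother_add smoother_power_mem)

lemma smoother_power_energy:
  "v \<in> V \<Longrightarrow> energy_norm \<Omega> C\<sigma> D 1 j ((G ^^ m) v) \<le> energy_norm \<Omega> C\<sigma> D 1 j v"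
proof (induction m)
  case (Suc m)
  then show ?case using smoother_energy[OF smoother_power_mem[of v m]] by simp
qed simp

end

section \<open>Recursion over the levels\<close>

locale dg_two_level = fine: dg_smoother \<Omega> D C\<sigma> j + coarse: dg_smoother \<Omega> D C\<sigma> "j - 1"
  for \<Omega> :: "(real^'n) set" and D :: "'n discretization" and C\<sigma> :: "nat \<Rightarrow> real" and j :: nat +
  assumes nested: "\<And>\<kappa>. \<kappa> \<in> mesh D j \<Longrightarrow> \<exists>K\<in>mesh D (j - 1). \<kappa> \<subseteq> K"
    and degree_mono: "deg D (j - 1) \<le> deg D j"
begin

lemma prolong_mem:
  assumes "v \<in> coarse.V"
  shows "prolong D j v \<in> fine.V"
  unfolding fine.dg_space_iff
proof (intro conjI ballI allI impI)
  fix \<kappa> assume \<kappa>: "\<kappa> \<in> mesh D j"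
  then obtain K where K: "K \<in> mesh D (j - 1)" "\<kappa> \<subseteq> K" using nested by blast
  then obtain q where q: "polynomial_of_degree (deg D (j - 1)) q" "\<forall>x\<in>K. v x = q x"
    using assms unfolding coarse.dg_space_iff by blast
  have "\<forall>x\<in>\<kappa>. prolong D j v x = q x" using q(2) K(2) \<kappa> by (auto simp: prolong_def)
  then show "\<exists>q. polynomial_of_degree (deg D j) q \<and> (\<forall>x\<in>\<kappa>. prolong D j v x = q x)"
    using polynomial_of_degree_mono[OF q(1) degree_mono] by blast
qed (simp add: prolong_def)

text \<open>Here the definiteness of the form pays off: the definite description of the projection
  is resolved by Riesz representation with respect to the coarse DG form.\<close>

lemma coarse_proj_mem:
  assumes v: "v \<in> fine.V"
  shows "coarse_proj \<Omega> C\<sigma> D j v \<in> coarse.V"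
proof -
  have "coarse.linear_functional (\<lambda>z. fine.\<A> v (prolong D j z))"
    unfolding coarse.linear_functional_def
  proof (intro ballI allI)
    fix y z a b assume y: "y \<in> coarse.V" and z: "z \<in> coarse.V"
    have "prolong D j (\<lambda>x. a * y x + b * z x) = (\<lambda>x. a * prolong D j y x + b * prolong D j z x)"
      by (auto simp: prolong_def)
    then show "fine.\<A> v (prolong D j (\<lambda>x. a * y x + b * z x)) =
        a * fine.\<A> v (prolong D j y) + b * fine.\<A> v (prolong D j z)"
      using fine.form_lin_right[OF fine.dg_form_symmetric prolong_mem[OF y] prolong_mem[OF z] v] by simp
  qed
  from theI'[OF coarse.Riesz_representation[OF coarse.dg_form_pos_def this]]
  show ?thesis unfolding coarse_proj_def by blast
qed

text \<open>\<open>Id - I (Id - E) P\<close> is \<open>(Id - I P) + I E P\<close>, and the smoother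
  distributes over the sum; \<open>E\<close> itself may be any map of the coarse space.\<close>

lemma multilevel_step_split:
  fixes m1 m2 :: nat
  assumes E: "\<And>z. z \<in> coarse.V \<Longrightarrow> E z \<in> coarse.V" and v: "v \<in> fine.V"
  defines "z \<equiv> coarse_proj \<Omega> C\<sigma> D j ((fine.G ^^ m1) v)"
  shows "multilevel_step \<Omega> C\<sigma> D m1 m2 j E v = (\<lambda>x. multilevel_step \<Omega> C\<sigma> D m1 m2 j (\<lambda>w x. 0) v x
      + (fine.G ^^ m2) (prolong D j (E z)) x)"
    and "multilevel_step \<Omega> C\<sigma> D m1 m2 j (\<lambda>w x. 0) v \<in> fine.V"
proof -
  define w where "w = (fine.G ^^ m1) v"
  have w: "w \<in> fine.V" unfolding w_def by (rule fine.smoother_power_mem[OF v])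
  have z: "z \<in> coarse.V" unfolding z_def w_def[symmetric] by (rule coarse_proj_mem[OF w])
  define r where "r = (\<lambda>x. w x - prolong D j z x)"
  have r: "r \<in> fine.V" unfolding r_def by (rule fine.diff_mem[OF w prolong_mem[OF z]])
  have two: "multilevel_step \<Omega> C\<sigma> D m1 m2 j (\<lambda>w x. 0) v = (fine.G ^^ m2) r"
    unfolding multilevel_step_def Let_def w_def[symmetric] z_def[unfolded w_def[symmetric], symmetric] r_def by simp
  have "(\<lambda>x. w x - prolong D j (\<lambda>y. z y - E z y) x) = (\<lambda>x. r x + prolong D j (E z) x)"
    unfolding r_def by (auto simp: prolong_def)
  then show "multilevel_step \<Omega> C\<sigma> D m1 m2 j E v = (\<lambda>x. multilevel_step \<Omega> C\<sigma> D m1 m2 j (\<lambda>w x. 0) v x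
      + (fine.G ^^ m2) (prolong D j (E z)) x)"
    unfolding two fine.smoother_power_add[OF r prolong_mem[OF E[OF z]], symmetric]
    unfolding multilevel_step_def Let_def w_def[symmetric] z_def[unfolded w_def[symmetric], symmetric] by simp
  show "multilevel_step \<Omega> C\<sigma> D m1 m2 j (\<lambda>w x. 0) v \<in> fine.V"
    unfolding two by (rule fine.smoother_power_mem[OF r])
qed

lemma multilevel_step_mem:
  assumes E: "\<And>z. z \<in> coarse.V \<Longrightarrow> E z \<in> coarse.V" and v: "v \<in> fine.V"
  shows "multilevel_step \<Omega> C\<sigma> D m1 m2 j E v \<in> fine.V"
proof (subst multilevel_step_split(1)[of E])
  show "(\<lambda>x. multilevel_step \<Omega> C\<sigma> D m1 m2 j (\<lambda>w x. 0) v x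
      + (fine.G ^^ m2) (prolong D j (E (coarse_proj \<Omega> C\<sigma> D j ((fine.G ^^ m1) v)))) x) \<in> fine.V"
    by (intro fine.add_mem multilevel_step_split(2)[of E] fine.smoother_power_mem prolong_mem E
        coarse_proj_mem v)
qed (use E v in auto)

text \<open>The stability constant enters twice, once for the projection and once for the
  prolongation, while both runs of the smoother cost nothing.\<close>

lemma multilevel_step_energy:
  assumes E: "\<And>z. z \<in> coarse.V \<Longrightarrow> E z \<in> coarse.V" and v: "v \<in> fine.V"
    and E_bound: "\<And>z. z \<in> coarse.V \<Longrightarrow>
      energy_norm \<Omega> C\<sigma> D 1 (j - 1) (E z) \<le> \<gamma> * energy_norm \<Omega> C\<sigma> D 1 (j - 1) z" and "\<gamma> \<ge> 0"
    and two: "energy_norm \<Omega> C\<sigma> D 1 j (multilevel_step \<Omega> C\<sigma> D m1 m2 j (\<lambda>w x. 0) v)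
      \<le> \<theta> * energy_norm \<Omega> C\<sigma> D 1 j v"
    and C: "C \<ge> 0" and prolong: "\<And>z. z \<in> coarse.V \<Longrightarrow>
      energy_norm \<Omega> C\<sigma> D 1 j (prolong D j z) \<le> C * energy_norm \<Omega> C\<sigma> D 1 (j - 1) z"
    and proj: "\<And>w. w \<in> fine.V \<Longrightarrow>
      energy_norm \<Omega> C\<sigma> D 1 (j - 1) (coarse_proj \<Omega> C\<sigma> D j w) \<le> C * energy_norm \<Omega> C\<sigma> D 1 j w"
  shows "energy_norm \<Omega> C\<sigma> D 1 j (multilevel_step \<Omega> C\<sigma> D m1 m2 j E v)
    \<le> (\<theta> + C\<^sup>2 * \<gamma>) * energy_norm \<Omega> C\<sigma> D 1 j v"
proof -
  define w where "w = (fine.G ^^ m1) v"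
  define z where "z = coarse_proj \<Omega> C\<sigma> D j w"
  have w: "w \<in> fine.V" unfolding w_def by (rule fine.smoother_power_mem[OF v])
  have z: "z \<in> coarse.V" unfolding z_def by (rule coarse_proj_mem[OF w])
  have Ez: "prolong D j (E z) \<in> fine.V" by (rule prolong_mem[OF E[OF z]])
  have "energy_norm \<Omega> C\<sigma> D 1 j ((fine.G ^^ m2) (prolong D j (E z)))
      \<le> energy_norm \<Omega> C\<sigma> D 1 j (prolong D j (E z))" by (rule fine.smoother_power_energy[OF Ez])
  also have "\<dots> \<le> C * energy_norm \<Omega> C\<sigma> D 1 (j - 1) (E z)" by (rule prolong[OF E[OF z]])
  also have "\<dots> \<le> C * (\<gamma> * energy_norm \<Omega> C\<sigma> D 1 (j - 1) z)" by (rule mult_left_mono[OF E_bound[OF z] C])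
  also have "\<dots> \<le> C * (\<gamma> * (C * energy_norm \<Omega> C\<sigma> D 1 j w))"
    using proj[OF w] C \<open>\<gamma> \<ge> 0\<close> unfolding z_def by (intro mult_left_mono)
  also have "\<dots> \<le> C * (\<gamma> * (C * energy_norm \<Omega> C\<sigma> D 1 j v))"
    using fine.smoother_power_energy[OF v] C \<open>\<gamma> \<ge> 0\<close> unfolding w_def by (intro mult_left_mono)
  also have "\<dots> = C\<^sup>2 * \<gamma> * energy_norm \<Omega> C\<sigma> D 1 j v" by (simp add: power2_eq_square)
  finally have "energy_norm \<Omega> C\<sigma> D 1 j ((fine.G ^^ m2) (prolong D j (E z)))
      \<le> C\<^sup>2 * \<gamma> * energy_norm \<Omega> C\<sigma> D 1 j v" .
  moreover have "energy_norm \<Omega> C\<sigma> D 1 j (multilevel_step \<Omega> C\<sigma> D m1 m2 j E v)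
      \<le> energy_norm \<Omega> C\<sigma> D 1 j (multilevel_step \<Omega> C\<sigma> D m1 m2 j (\<lambda>w x. 0) v)
        + energy_norm \<Omega> C\<sigma> D 1 j ((fine.G ^^ m2) (prolong D j (E z)))"
  proof (subst multilevel_step_split(1)[of E])
    show "energy_norm \<Omega> C\<sigma> D 1 j (\<lambda>x. multilevel_step \<Omega> C\<sigma> D m1 m2 j (\<lambda>w x. 0) v x
        + (fine.G ^^ m2) (prolong D j (E (coarse_proj \<Omega> C\<sigma> D j ((fine.G ^^ m1) v)))) x)
      \<le> energy_norm \<Omega> C\<sigma> D 1 j (multilevel_step \<Omega> C\<sigma> D m1 m2 j (\<lambda>w x. 0) v)
        + energy_norm \<Omega> C\<sigma> D 1 j ((fine.G ^^ m2) (prolong D j (E z)))"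
      unfolding z_def w_def
      by (intro fine.energy_norm_triangle multilevel_step_split(2)[of E] fine.smoother_power_mem
          prolong_mem E coarse_proj_mem v)
  qed (use E v in auto)
  ultimately show ?thesis using two by (simp add: distrib_right)
qed

end

text \<open>The two cases of the smoothing condition give the common bound \<open>M b d \<ge> P a\<^sup>2 K\<close>.\<close>

lemma smoothing_steps_suffice:
  fixes a b d K M P Q :: real
  assumes "a \<ge> 0" "b > 0" "d > 0" "K \<ge> 0" "M > 0" "0 \<le> Q" "Q \<le> P"
    and M: "M \<ge> (if a \<le> b then P * b * (K / d) else P * (a\<^sup>2 / b) * (K / d))"
  shows "K * (a * (Q / M))\<^sup>2 \<le> d * (b * (P / M))"
proof -
  \<comment> \<open>In the application \<open>a\<close> and \<open>b\<close> are
    \<open>Ctilde\<close> on levels \<open>j - 1\<close> and \<open>j\<close>, \<open>Q\<close> and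
    \<open>P\<close> the degree powers of these levels, \<open>M\<close> the product of the square
    roots, \<open>d\<close> the gap \<open>Chat - C2lvl\<close> and \<open>K\<close> the product
    \<open>Cstab\<^sup>2 * Chat\<^sup>2\<close>. For \<open>a \<le> b\<close> the prescribed bound
    is the stronger one, because then \<open>a\<^sup>2 / b \<le> b\<close>.\<close>
  have P: "P \<ge> 0" using assms by linarith
  have "P * (a\<^sup>2 / b) * (K / d) \<le> M"
  proof (cases "a \<le> b")
    case True
    have "a\<^sup>2 / b \<le> b"
      using power_mono[OF True \<open>a \<ge> 0\<close>, of 2] \<open>b > 0\<close> by (simp add: field_simps power2_eq_square)
    then have "P * (a\<^sup>2 / b) * (K / d) \<le> P * b * (K / d)"
      using P assms by (intro mult_right_mono mult_left_mono) auto
    then show ?thesis using M True by simp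
  qed (use M in simp)
  then have 1: "P * a\<^sup>2 * K \<le> M * b * d" using assms by (simp add: field_simps)
  have "K * (a * Q)\<^sup>2 \<le> K * (a * P)\<^sup>2"
    using assms by (intro mult_left_mono power_mono) auto
  also have "\<dots> = P * (P * a\<^sup>2 * K)" by (simp add: power2_eq_square)
  also have "\<dots> \<le> P * (M * b * d)" by (rule mult_left_mono[OF 1 P])
  finally have "K * (a * Q)\<^sup>2 / M\<^sup>2 \<le> P * (M * b * d) / M\<^sup>2" by (rule divide_right_mono) simp
  then show ?thesis using \<open>M > 0\<close> by (simp add: power2_eq_square field_simps)
qed

section \<open>From the family of discretizations to single levels\<close>

lemma multigrid_family_level:
  assumes "multigrid_family \<Omega> \<DD>" "D \<in> \<DD>" "j \<in> {1..levels D}"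
  shows "is_mesh \<Omega> (mesh D j)" "is_face_set \<Omega> (mesh D j) (faces D j)" "deg D j \<ge> 1"
  using assms unfolding multigrid_family_def by blast+

lemma multigrid_family_nested:
  assumes "multigrid_family \<Omega> \<DD>" "D \<in> \<DD>" "j \<in> {2..levels D}"
  shows "\<forall>\<kappa>\<in>mesh D j. \<exists>K\<in>mesh D (j - 1). \<kappa> \<subseteq> K" "deg D (j - 1) \<le> deg D j"
proof -
  obtain C where "h_multigrid C D \<or> p_multigrid C D"
    using assms(1,2) unfolding multigrid_family_def by blast
  then have "(\<forall>\<kappa>\<in>mesh D j. \<exists>K\<in>mesh D (j - 1). \<kappa> \<subseteq> K) \<and> deg D (j - 1) \<le> deg D j"
  proof
    assume "h_multigrid C D"
    then show ?thesis using assms(3) unfolding h_multigrid_def by auto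
  next
    assume "p_multigrid C D"
    then have "mesh D j = mesh D (j - 1)" "deg D (j - 1) \<le> deg D j"
      using assms(3) unfolding p_multigrid_def same_mesh_def by blast+
    then show ?thesis by auto
  qed
  then show "\<forall>\<kappa>\<in>mesh D j. \<exists>K\<in>mesh D (j - 1). \<kappa> \<subseteq> K" "deg D (j - 1) \<le> deg D j" by blast+
qed

lemma dg_smoother_level:
  assumes "convex_polytopal_domain \<Omega>" "multigrid_family \<Omega> \<DD>" "face_simplex_condition \<DD>"
    and "\<And>j. C\<sigma> j > 0" "continuous_coercive \<Omega> \<DD> C\<sigma>" "smoothing_condition \<Omega> \<DD> C\<sigma> Ceig"
    and D: "D \<in> \<DD>" and j: "j \<in> {1..levels D}"
  shows "dg_smoother \<Omega> D C\<sigma> j"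
proof
  show "convex_polytopal_domain \<Omega>" "C\<sigma> j > 0" by (rule assms)+
  show "is_mesh \<Omega> (mesh D j)" "is_face_set \<Omega> (mesh D j) (faces D j)" "deg D j \<ge> 1"
    by (rule multigrid_family_level[OF assms(2) D j])+
  fix \<kappa> F assume \<kappa>: "\<kappa> \<in> mesh D j" and F: "F \<in> faces D j" "F \<subseteq> frontier \<kappa>"
  obtain \<T> where \<T>: "\<forall>T\<in>\<T>. (int CARD('a) simplex T) \<and> interior T \<subseteq> \<kappa>"
    "\<forall>F\<in>faces D j. F \<subseteq> frontier \<kappa> \<longrightarrow> (\<exists>T\<in>\<T>. F = frontier (closure \<kappa>) \<inter> frontier T)"
    using assms(3) D j \<kappa> unfolding face_simplex_condition_def by metis
  then obtain T where "T \<in> \<T>" "F = frontier (closure \<kappa>) \<inter> frontier T" using F by blast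
  then show "\<exists>S. (int CARD('a) simplex S) \<and> interior S \<subseteq> \<kappa> \<and> F \<subseteq> frontier S" using \<T>(1) by blast
next
  show "\<exists>c>0. \<forall>v\<in>dg_space \<Omega> D j. dg_form C\<sigma> D j v v \<ge> c * (dg_norm C\<sigma> D j v (grad v))\<^sup>2"
    using assms(5) D j unfolding continuous_coercive_def by blast
  show "\<bar>c\<bar> \<le> smooth_par D j" if "is_eigenvalue \<Omega> C\<sigma> D j c" for c
    using assms(6) D j that unfolding smoothing_condition_def by blast
qed

theorem theorem9:
  fixes \<Omega> :: "(real^'n) set"
    and \<DD> :: "'n discretization set"
    and E :: "(real^'n \<Rightarrow> real) \<Rightarrow> (real^'n \<Rightarrow> real)"
    and C\<sigma> Ceig CL2 :: "nat \<Rightarrow> real"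
    and C2lvl Cstab :: real
    and k \<mu> :: nat
  assumes dimension: "CARD('n) \<in> {2, 3}"
    and domain: "convex_polytopal_domain \<Omega>"
    and extension: "extension_operator \<Omega> E"
    and family: "multigrid_family \<Omega> \<DD>"
    and conditions: "face_simplex_condition \<DD>" "volume_condition \<DD>"
      "subtriangulation_condition \<DD>" "covering_condition \<Omega> \<DD>" "agglomeration_condition \<DD>"
    and penalty: "\<And>j. C\<sigma> j > 0" "continuous_coercive \<Omega> \<DD> C\<sigma>"
    and regularity: "real k > real CARD('n) / 2"
    and mu: "interpolation_index \<Omega> E \<DD> C\<sigma> k \<mu>"
    and CL2: "\<And>j. CL2 j > 0" "L2_error_estimate \<Omega> \<DD> C\<sigma> k \<mu> CL2"
    and Ceig: "\<And>j. Ceig j > 0" "inverse_estimate \<Omega> \<DD> C\<sigma> Ceig"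
    and smoothing: "smoothing_condition \<Omega> \<DD> C\<sigma> Ceig"
    and two_level: "C2lvl > 0" "two_level_estimate \<Omega> \<DD> C\<sigma> Ceig CL2 \<mu> C2lvl"
    and stability: "Cstab \<ge> 1" "stability_estimate \<Omega> \<DD> C\<sigma> Cstab"
  shows "\<exists>Chat > C2lvl. \<forall>D\<in>\<DD>. \<forall>m1 m2 :: nat.
    (\<forall>j\<in>{2..levels D}.
       sqrt (real m1 + 1) * sqrt (real m2 + 1) \<ge>
         (if Ctilde Ceig CL2 (j - 1) \<le> Ctilde Ceig CL2 j
          then real (deg D j) ^ (2 + \<mu>) * Ctilde Ceig CL2 j
                 * (Cstab\<^sup>2 * Chat\<^sup>2 / (Chat - C2lvl))
          else real (deg D j) ^ (2 + \<mu>) * ((Ctilde Ceig CL2 (j - 1))\<^sup>2 / Ctilde Ceig CL2 j)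
                 * (Cstab\<^sup>2 * Chat\<^sup>2 / (Chat - C2lvl)))) \<longrightarrow>
    (\<forall>j\<in>{1..levels D}. \<forall>v\<in>dg_space \<Omega> D j.
       energy_norm \<Omega> C\<sigma> D 1 j (wcycle_error \<Omega> C\<sigma> D m1 m2 j v)
         \<le> Chat * Sigma_factor Ceig CL2 \<mu> D m1 m2 j * energy_norm \<Omega> C\<sigma> D 1 j v)"
proof (intro exI[of _ "C2lvl + 1"] conjI ballI allI impI)
  \<comment> \<open>This value depends on \<open>C2lvl\<close> alone, so one constant serves all
    discretizations and levels, and the denominator \<open>Chat - C2lvl\<close> becomes 1.\<close>
  let ?Chat = "C2lvl + 1" and ?S = "Sigma_factor Ceig CL2 \<mu>"
  show "?Chat > C2lvl" by simp
  fix D m1 m2 j v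
  assume D: "D \<in> \<DD>" and steps: "\<forall>j\<in>{2..levels D}.
       sqrt (real m1 + 1) * sqrt (real m2 + 1) \<ge>
         (if Ctilde Ceig CL2 (j - 1) \<le> Ctilde Ceig CL2 j
          then real (deg D j) ^ (2 + \<mu>) * Ctilde Ceig CL2 j
                 * (Cstab\<^sup>2 * ?Chat\<^sup>2 / (?Chat - C2lvl))
          else real (deg D j) ^ (2 + \<mu>) * ((Ctilde Ceig CL2 (j - 1))\<^sup>2 / Ctilde Ceig CL2 j)
                 * (Cstab\<^sup>2 * ?Chat\<^sup>2 / (?Chat - C2lvl)))"
  let ?E = "wcycle_error \<Omega> C\<sigma> D m1 m2" and ?en = "energy_norm \<Omega> C\<sigma> D 1"
  have smoother: "dg_smoother \<Omega> D C\<sigma> j" if "j \<in> {1..levels D}" for j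
    by (rule dg_smoother_level[OF domain family conditions(1) penalty smoothing D that])
  have Ct: "Ctilde Ceig CL2 j \<ge> 0" for j
    using Ceig(1)[of j] CL2(1)[of j] CL2(1)[of "j - 1"] unfolding Ctilde_def by simp
  \<comment> \<open>Membership is carried along because the coarse error operator is applied to its
    own output, to which the bound extends only inside the space.\<close>
  have claim: "1 \<le> j \<Longrightarrow> j \<le> levels D \<Longrightarrow> \<forall>v\<in>dg_space \<Omega> D j.
      ?E j v \<in> dg_space \<Omega> D j \<and> ?en j (?E j v) \<le> ?Chat * ?S D m1 m2 j * ?en j v" for j
  proof (induction j rule: dec_induct)
    case base
    then interpret dg_smoother \<Omega> D C\<sigma> 1 using smoother by simp
    \<comment> \<open>By the convention for \<open>Ctilde\<close> the factor at level 1 is zero, and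
      the bound reads 0 <= 0.\<close>
    show ?case using zero_mem energy_norm_zero by (simp add: Sigma_factor_def Ctilde_def)
  next
    case (step i)
    define j where "j = Suc i"
    have j: "j \<in> {2..levels D}" "j \<in> {1..levels D}" "j - 1 \<in> {1..levels D}" "j - 1 = i"
      using step.hyps step.prems unfolding j_def by auto
    interpret dg_two_level \<Omega> D C\<sigma> j
      using smoother[OF j(2)] smoother[OF j(3)] multigrid_family_nested[OF family D j(1)]
      by (intro dg_two_level.intro dg_two_level_axioms.intro) auto
    \<comment> \<open>The square reflects the two coarse iterations of the W-cycle.\<close>
    define \<gamma> where "\<gamma> = (?Chat * ?S D m1 m2 (j - 1))\<^sup>2"
    have IH: "?E i z \<in> coarse.V" "?en i (?E i z) \<le> ?Chat * ?S D m1 m2 i * ?en i z"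
      if "z \<in> coarse.V" for z
      using step.IH step.prems that j(4) by auto
    have rec: "?E j = multilevel_step \<Omega> C\<sigma> D m1 m2 j (?E i \<circ> ?E i)"
      using step.hyps unfolding j_def by (cases i) auto
    have mem2: "(?E i \<circ> ?E i) z \<in> coarse.V" if "z \<in> coarse.V" for z
      using IH(1) that by simp
    have S_nonneg: "?S D m1 m2 i \<ge> 0" for i using Ct[of i] unfolding Sigma_factor_def by simp
    have E2: "?en (j - 1) ((?E i \<circ> ?E i) z) \<le> \<gamma> * ?en (j - 1) z" if z: "z \<in> coarse.V" for z
    proof -
      have "?en i (?E i (?E i z)) \<le> ?Chat * ?S D m1 m2 i * ?en i (?E i z)" using IH z by blast
      also have "\<dots> \<le> ?Chat * ?S D m1 m2 i * (?Chat * ?S D m1 m2 i * ?en i z)"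
        using IH(2)[OF z] S_nonneg two_level(1) by (intro mult_left_mono) auto
      finally show ?thesis unfolding \<gamma>_def j(4) by (simp add: power2_eq_square)
    qed
    \<comment> \<open>The smoothing condition compares neighbouring levels; the power of the coarse
      degree is replaced by that of the fine one, as degrees do not decrease with the level. At
      \<open>j = 2\<close> the left side is zero.\<close>
    have "Cstab\<^sup>2 * ?Chat\<^sup>2 * (?S D m1 m2 (j - 1))\<^sup>2 \<le> (?Chat - C2lvl) * ?S D m1 m2 j"
      unfolding Sigma_factor_def
    proof (rule smoothing_steps_suffice)
      show "Ctilde Ceig CL2 j > 0"
        using j(1) Ceig(1)[of j] CL2(1)[of j] CL2(1)[of "j - 1"] by (simp add: Ctilde_def add_pos_pos)
      show "real (deg D (j - 1)) ^ (2 + \<mu>) \<le> real (deg D j) ^ (2 + \<mu>)"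
        using degree_mono by (intro power_mono) auto
      show "sqrt (1 + real m1) * sqrt (1 + real m2) \<ge>
         (if Ctilde Ceig CL2 (j - 1) \<le> Ctilde Ceig CL2 j
          then real (deg D j) ^ (2 + \<mu>) * Ctilde Ceig CL2 j * (Cstab\<^sup>2 * ?Chat\<^sup>2 / (?Chat - C2lvl))
          else real (deg D j) ^ (2 + \<mu>) * ((Ctilde Ceig CL2 (j - 1))\<^sup>2 / Ctilde Ceig CL2 j)
                 * (Cstab\<^sup>2 * ?Chat\<^sup>2 / (?Chat - C2lvl)))"
        unfolding add.commute[of 1 "real m1"] add.commute[of 1 "real m2"] by (rule bspec[OF steps j(1)])
    qed (use Ct in auto)
    then have gain: "C2lvl * ?S D m1 m2 j + Cstab\<^sup>2 * \<gamma> \<le> ?Chat * ?S D m1 m2 j"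
      unfolding \<gamma>_def power_mult_distrib by (simp add: algebra_simps)
    have "?E j v \<in> fine.V \<and> ?en j (?E j v) \<le> ?Chat * ?S D m1 m2 j * ?en j v" if v: "v \<in> fine.V" for v
    proof
      show "?E j v \<in> fine.V" unfolding rec by (rule multilevel_step_mem[OF mem2 v])
      have "?en j (?E j v) \<le> (C2lvl * ?S D m1 m2 j + Cstab\<^sup>2 * \<gamma>) * ?en j v"
        unfolding rec
      proof (rule multilevel_step_energy[OF mem2 v E2])
        show "?en j (multilevel_step \<Omega> C\<sigma> D m1 m2 j (\<lambda>w x. 0) v) \<le> C2lvl * ?S D m1 m2 j * ?en j v"
          using two_level(2) D j(1) v unfolding two_level_estimate_def by blast
        show "?en j (prolong D j z) \<le> Cstab * ?en (j - 1) z" if "z \<in> coarse.V" for z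
          using stability(2) D j(1) that unfolding stability_estimate_def by blast
        show "?en (j - 1) (coarse_proj \<Omega> C\<sigma> D j w) \<le> Cstab * ?en j w" if "w \<in> fine.V" for w
          using stability(2) D j(1) that unfolding stability_estimate_def by blast
      qed (use stability(1) in \<open>auto simp: \<gamma>_def\<close>)
      also have "\<dots> \<le> ?Chat * ?S D m1 m2 j * ?en j v"
        by (rule mult_right_mono[OF gain fine.energy_norm_nonneg[OF v]])
      finally show "?en j (?E j v) \<le> ?Chat * ?S D m1 m2 j * ?en j v" .
    qed
    then show ?case unfolding j_def by blast
  qed
  assume "j \<in> {1..levels D}" "v \<in> dg_space \<Omega> D j"
  then show "?en j (?E j v) \<le> ?Chat * ?S D m1 m2 j * ?en j v" using claim[of j] by auto
qed

end
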